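(* Let $n\ge2$ and take coefficients in $\mathbb Z$ or an arbitrary field. Each of the sets $$\{\breve c(T,\sigma):(T,\sigma)\in\mathsf{Comb}^2_n,\ \text{the root of }T\text{ is blue}\}$$ and $$\{\breve c(T,\sigma):(T,\sigma)\in\mathsf{Lyn}^2_n,\ \text{the root of }T\text{ is red}\}$$ is a basis for $\tilde H^{n-2}(\Pi_n^w\setminus\{\hat 0\})$, where $\mathsf{Comb}^2_n$ and $\mathsf{Lyn}^2_n$ are the sets of bicolored combs and of bicolored Lyndon trees with leaf label set $\{1,\dots,n\}$.
   Context: Poset. Let $[n]=\{1,\dots,n\}$. A weighted partition of $[n]$ is a set $\{B_1^{v_1},\dots,B_t^{v_t}\}$ where $\{B_1,\dots,B_t\}$ is a partition of $[n]$ and $v_i\in\{0,1,\dots,|B_i|-1\}$. The poset $\Pi_n^w$ is the set of weighted partitions of $[n]$ ordered by: $\{A_1^{w_1},\dots,A_s^{w_s}\}\le\{B_1^{v_1},\dots,B_t^{v_t}\}$ iff $\{A_j\}$ refines $\{B_k\}$ and whenever $B_k=A_{i_1}\cup\cdots\cup A_{i_l}$, then $v_k-(w_{i_1}+\cdots+w_{i_l})\in\{0,\dots,l-1\}$. Its minimum is $\hat 0=\{\{1\}^0,\dots,\{n\}^0\}$. Cohomology. For a finite poset $P$ the reduced cochain module $C_r(P)$ is the free module (over the coefficient ring) on chains $\alpha_0<\cdots<\alpha_r$ ($C_{-1}$ is spanned by the empty chain), with $\delta_r(\alpha_0<\cdots<\alpha_r)=\sum_{i=0}^{r+1}(-1)^i\sum_{\alpha\in(\alpha_{i-1},\alpha_i)}(\alpha_0<\cdots<\alpha_{i-1}<\alpha<\alpha_i<\cdots<\alpha_r)$,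 where $\alpha_{-1},\alpha_{r+1}$ are an adjoined minimum and maximum; $\tilde H^r(P)=\ker\delta_r/\operatorname{im}\delta_{r-1}$. Maximal chains are identified with their classes in top cohomology. Trees. A bicolored binary tree is a complete plane binary tree (every internal node has a left child and a right child) with each internal node colored red or blue. $\mathcal{BT}_n$ is the set of pairs $(T,\sigma)$ with $T$ a bicolored binary tree with $n$ leaves and $\sigma\in\mathfrak S_n$, the $j$th leaf from left to right being labeled $\sigma(j)$. A tree is normalized if the leftmost leaf of each subtree (rooted at any node) has the smallest label in that subtree. A bicolored comb is a normalized tree such that for each internal node $x$ whose right child $y$ is not a leaf, $x$ is red and $y$ is blue; $\mathsf{Comb}^2_n$ is the set of bicolored combs in $\mathcal{BT}_n$. $L(x),R(x)$ are the left and right children of an internal node $x$; the valency $v(x)$ of a node is the smallest leaf label of the subtree rooted at $x$. An internal node $x$ is a Lyndon node if $v(R(L(x)))>v(R(x))$; the condition is regarded as satisfied when $L(x)$ is a leaf. A bicolored Lyndon tree is a normalized tree such that every internal node $x$ that is not a Lyndon node is blue and its left child is red; $\mathsf{Lyn}^2_n$ is the set of bicolored Lyndon trees in $\mathcal{BT}_n$. Chains. Put $u(\text{blue})=0$, $u(\text{red})=1$; to $u$-merge two blocks $A^a,B^b$ means to replace them by $(A\cup B)^{a+b+u}$. Postorder lists the internal nodes of the left subtree (recursively), then those of the right subtree, then the root. $c(T,\sigma)$ is the maximal chain of $\Pi_n^w$ starting at $\hat 0$ whose rank $k$ element is obtained from its rank $k-1$ element by $u(\mathrm{col}_k)$-merging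 the blocks whose underlying sets are the leaf label sets of the left and right subtrees of the $k$th internal node in postorder, $\mathrm{col}_k$ being its color. $\breve c(T,\sigma)=c(T,\sigma)\setminus\{\hat 0\}$. *)

theory Defs
  imports
    "Jordan_Normal_Form.VS_Connect"
    "HOL-Algebra.QuotRing"
    "HOL-Library.Disjoint_Sets"
begin

section \<open>Quotients and bases of modules\<close>

text \<open>The module analogue of \<^const>\<open>FactRing\<close>; the two multiplicative fields of the record
  carry no information for modules.\<close>

definition quotient_module :: "('k, 'a, 'm) module_scheme \<Rightarrow> 'a set \<Rightarrow> ('k, 'a set) module" where
  "quotient_module M N =
    \<lparr>carrier = a_rcosets\<^bsub>M\<^esub> N, mult = (\<lambda>_ _. N), one = N, zero = N, add = set_add M,
     smult = (\<lambda>k X. \<Union>x\<in>X. N +>\<^bsub>M\<^esub> (k \<odot>\<^bsub>M\<^esub> x))\<rparr>"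

definition module_basis :: "('k, 'r) ring_scheme \<Rightarrow> ('k, 'a, 'm) module_scheme \<Rightarrow> 'a set \<Rightarrow> bool" where
  "module_basis R M S \<longleftrightarrow>
    S \<subseteq> carrier M \<and> \<not> LinearCombinations.module.lin_dep R M S \<and>
    LinearCombinations.module.span R M S = carrier M"


section \<open>Reduced cohomology of a finite poset\<close>

text \<open>A poset is given by its carrier \<open>P\<close> and its (weak) order \<open>leq\<close>.
  An \<open>r\<close>-chain has \<open>r + 1\<close> elements and is listed increasingly. The index \<open>r\<close> is an integer,
  the only \<open>(-1)\<close>-chain being the empty list; there are no \<open>r\<close>-chains for \<open>r < -1\<close>.\<close>

definition poset_chains :: "'a set \<Rightarrow> ('a \<Rightarrow> 'a \<Rightarrow> bool) \<Rightarrow> int \<Rightarrow> 'a list set" where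
  "poset_chains P leq r =
    {c. set c \<subseteq> P \<and> sorted_wrt (\<lambda>x y. leq x y \<and> x \<noteq> y) c \<and> int (length c) = r + 1}"

text \<open>\<open>P\<close> is finite, so the free module on the chains consists of all functions on the chains.\<close>

definition cochains ::
    "'a set \<Rightarrow> ('a \<Rightarrow> 'a \<Rightarrow> bool) \<Rightarrow> int \<Rightarrow> ('k::comm_ring_1, 'a list \<Rightarrow> 'k) module" where
  "cochains P leq r = ring.func_space class_ring (poset_chains P leq r)"

definition single_cochain ::
    "'a set \<Rightarrow> ('a \<Rightarrow> 'a \<Rightarrow> bool) \<Rightarrow> int \<Rightarrow> 'a list \<Rightarrow> 'a list \<Rightarrow> 'k::comm_ring_1" where
  "single_cochain P leq r c = (\<lambda>d\<in>poset_chains P leq r. if d = c then 1 else 0)"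

text \<open>The open interval between the consecutive entries \<open>i - 1\<close> and \<open>i\<close> of the chain \<open>c\<close>;
  a missing entry stands for the adjoined minimum or maximum and imposes no condition.\<close>

definition gap :: "'a set \<Rightarrow> ('a \<Rightarrow> 'a \<Rightarrow> bool) \<Rightarrow> 'a list \<Rightarrow> nat \<Rightarrow> 'a set" where
  "gap P leq c i =
    {x \<in> P. (0 < i \<longrightarrow> leq (c ! (i - 1)) x \<and> c ! (i - 1) \<noteq> x) \<and>
            (i < length c \<longrightarrow> leq x (c ! i) \<and> x \<noteq> c ! i)}"

definition coboundary ::
    "'a set \<Rightarrow> ('a \<Rightarrow> 'a \<Rightarrow> bool) \<Rightarrow> int \<Rightarrow> ('a list \<Rightarrow> 'k::comm_ring_1) \<Rightarrow> 'a list \<Rightarrow> 'k" where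
  "coboundary P leq r f =
    (\<lambda>d\<in>poset_chains P leq (r + 1). \<Sum>c\<in>poset_chains P leq r. f c *
      (\<Sum>i\<le>length c. (- 1) ^ i *
        (\<Sum>x\<in>gap P leq c i. if d = take i c @ x # drop i c then 1 else 0)))"

definition coboundaries ::
    "'a set \<Rightarrow> ('a \<Rightarrow> 'a \<Rightarrow> bool) \<Rightarrow> int \<Rightarrow> ('a list \<Rightarrow> 'k::comm_ring_1) set" where
  "coboundaries P leq r = coboundary P leq (r - 1) ` carrier (cochains P leq (r - 1))"

definition cocycles ::
    "'a set \<Rightarrow> ('a \<Rightarrow> 'a \<Rightarrow> bool) \<Rightarrow> int \<Rightarrow> ('a list \<Rightarrow> 'k::comm_ring_1) set" where
  "cocycles P leq r = a_kernel (cochains P leq r) (cochains P leq (r + 1)) (coboundary P leq r)"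

definition cohomology ::
    "'a set \<Rightarrow> ('a \<Rightarrow> 'a \<Rightarrow> bool) \<Rightarrow> int \<Rightarrow> ('k::comm_ring_1, ('a list \<Rightarrow> 'k) set) module" where
  "cohomology P leq r =
    quotient_module ((cochains P leq r)\<lparr>carrier := cocycles P leq r\<rparr>) (coboundaries P leq r)"

definition chain_class ::
    "'a set \<Rightarrow> ('a \<Rightarrow> 'a \<Rightarrow> bool) \<Rightarrow> int \<Rightarrow> 'a list \<Rightarrow> ('a list \<Rightarrow> 'k::comm_ring_1) set" where
  "chain_class P leq r c = coboundaries P leq r +>\<^bsub>cochains P leq r\<^esub> single_cochain P leq r c"

text \<open>A set of chains, identified with their classes, is a basis for the cohomology
  with coefficients in \<open>'k\<close>: distinct chains represent distinct classes, and the classes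
  form a basis.\<close>

definition cohomology_basis ::
    "'k::comm_ring_1 itself \<Rightarrow> 'a set \<Rightarrow> ('a \<Rightarrow> 'a \<Rightarrow> bool) \<Rightarrow> int \<Rightarrow> 'a list set \<Rightarrow> bool" where
  "cohomology_basis K P leq r S \<longleftrightarrow>
    S \<subseteq> poset_chains P leq r \<and>
    inj_on (chain_class P leq r :: 'a list \<Rightarrow> ('a list \<Rightarrow> 'k) set) S \<and>
    module_basis class_ring (cohomology P leq r :: ('k, ('a list \<Rightarrow> 'k) set) module)
      (chain_class P leq r ` S)"


section \<open>Weighted partitions\<close>

text \<open>A weighted partition is the set of its pairs (block, weight).\<close>

type_synonym wpartition = "(nat set \<times> nat) set"

definition weighted_partitions :: "nat \<Rightarrow> wpartition set" where
  "weighted_partitions n =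
    {\<pi>. partition_on {1..n} (fst ` \<pi>) \<and> inj_on fst \<pi> \<and> (\<forall>(B, v)\<in>\<pi>. v \<in> {0..card B - 1})}"

definition wp_le :: "nat \<Rightarrow> wpartition \<Rightarrow> wpartition \<Rightarrow> bool" where
  "wp_le n \<alpha> \<beta> \<longleftrightarrow>
    refines {1..n} (fst ` \<alpha>) (fst ` \<beta>) \<and>
    (\<forall>(B, v)\<in>\<beta>. int v - (\<Sum>(A, w)\<in>{p \<in> \<alpha>. fst p \<subseteq> B}. int w)
                  \<in> {0..int (card {p \<in> \<alpha>. fst p \<subseteq> B}) - 1})"

definition wp_bot :: "nat \<Rightarrow> wpartition" where
  "wp_bot n = (\<lambda>i. ({i}, 0)) ` {1..n}"


section \<open>Bicolored binary trees\<close>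

datatype color = Blue | Red

text \<open>The pair \<open>(T, \<sigma>)\<close> is encoded by writing the label \<open>\<sigma>(j)\<close> into the \<open>j\<close>th leaf of \<open>T\<close>.\<close>

datatype bitree = Leaf nat | Node color bitree bitree

fun leaves :: "bitree \<Rightarrow> nat list" where
  "leaves (Leaf a) = [a]"
| "leaves (Node c l r) = leaves l @ leaves r"

definition BT :: "nat \<Rightarrow> bitree set" where
  "BT n = {t. distinct (leaves t) \<and> set (leaves t) = {1..n}}"

fun subtrees :: "bitree \<Rightarrow> bitree set" where
  "subtrees (Leaf a) = {Leaf a}"
| "subtrees (Node c l r) = insert (Node c l r) (subtrees l \<union> subtrees r)"

fun root_color :: "bitree \<Rightarrow> color option" where
  "root_color (Leaf a) = None"
| "root_color (Node c l r) = Some c"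

definition valency :: "bitree \<Rightarrow> nat" where
  "valency t = Min (set (leaves t))"

definition normalized :: "bitree \<Rightarrow> bool" where
  "normalized t \<longleftrightarrow> (\<forall>s\<in>subtrees t. hd (leaves s) = Min (set (leaves s)))"

definition bicolored_comb :: "bitree \<Rightarrow> bool" where
  "bicolored_comb t \<longleftrightarrow> normalized t \<and>
    (\<forall>c l d rl rr. Node c l (Node d rl rr) \<in> subtrees t \<longrightarrow> c = Red \<and> d = Blue)"

definition Comb2 :: "nat \<Rightarrow> bitree set" where
  "Comb2 n = {t \<in> BT n. bicolored_comb t}"

fun Lyndon_node :: "bitree \<Rightarrow> bool" where
  "Lyndon_node (Node c (Node d ll lr) r) \<longleftrightarrow> valency lr > valency r"
| "Lyndon_node (Node c (Leaf a) r) \<longleftrightarrow> True"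
| "Lyndon_node (Leaf a) \<longleftrightarrow> False"

definition bicolored_Lyndon :: "bitree \<Rightarrow> bool" where
  "bicolored_Lyndon t \<longleftrightarrow> normalized t \<and>
    (\<forall>c l r. Node c l r \<in> subtrees t \<and> \<not> Lyndon_node (Node c l r) \<longrightarrow>
      c = Blue \<and> root_color l = Some Red)"

definition Lyn2 :: "nat \<Rightarrow> bitree set" where
  "Lyn2 n = {t \<in> BT n. bicolored_Lyndon t}"


section \<open>The chain of a tree\<close>

fun color_weight :: "color \<Rightarrow> nat" where
  "color_weight Blue = 0"
| "color_weight Red = 1"

definition merge_blocks :: "nat \<Rightarrow> nat set \<Rightarrow> nat set \<Rightarrow> wpartition \<Rightarrow> wpartition" where
  "merge_blocks k A B \<pi> =
    {p \<in> \<pi>. fst p \<noteq> A \<and> fst p \<noteq> B} \<union>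
    {(A \<union> B, a + b + k) | a b. (A, a) \<in> \<pi> \<and> (B, b) \<in> \<pi>}"

text \<open>Each internal node is represented by the subtree rooted at it.\<close>

fun postorder :: "bitree \<Rightarrow> bitree list" where
  "postorder (Leaf a) = []"
| "postorder (Node c l r) = postorder l @ postorder r @ [Node c l r]"

fun merge_node :: "bitree \<Rightarrow> wpartition \<Rightarrow> wpartition" where
  "merge_node (Node c l r) \<pi> = merge_blocks (color_weight c) (set (leaves l)) (set (leaves r)) \<pi>"
| "merge_node (Leaf a) \<pi> = \<pi>"

fun merge_chain :: "wpartition \<Rightarrow> bitree list \<Rightarrow> wpartition list" where
  "merge_chain \<pi> [] = [\<pi>]"
| "merge_chain \<pi> (x # xs) = \<pi> # merge_chain (merge_node x \<pi>) xs"

definition tree_chain :: "nat \<Rightarrow> bitree \<Rightarrow> wpartition list" where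
  "tree_chain n t = merge_chain (wp_bot n) (postorder t)"

definition reduced_tree_chain :: "nat \<Rightarrow> bitree \<Rightarrow> wpartition list" where
  "reduced_tree_chain n t = removeAll (wp_bot n) (tree_chain n t)"

end

theory Submission
  imports Defs
begin

text \<open>A cohomology class in top degree is a function on maximal chains modulo alternating face sums,
  so every chain with one level removed is a linear relation among the maximal chains completing it.
  As in the theory of Groebner bases, call a level of a maximal chain leading if the chain is the
  largest of the completions of the corresponding face. Two overlapping leading levels are
  reconciled by \<open>\<delta>\<delta> = 0\<close>, so the chains without leading levels form a basis.

  To get leading levels that are determined locally, a chain is read from the top, each block being
  split in place so that the part with the smaller minimum stays on the left. A maximal chain then
  amounts to a normalized tree together with an order in which its internal nodes are expanded.
  For one rule the chains without leading levels are exactly the chains \<open>c(T)\<close> of the bicolored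
  combs with blue root. For another rule they come from the bicolored Lyndon trees with red root,
  expanded from left to right; exchanging two expansions of disjoint blocks only changes the sign
  of the class, so this chain agrees up to sign with \<open>c(T)\<close>.\<close>

section \<open>Bases of top cohomology in terms of functions on chains\<close>

text \<open>One largest completion per face is not enough. Leading levels may be adjacent, and a
  chain must be the largest among all chains that differ from it only at its leading levels.
  Changing one level can reorder the lists at all lower levels but never above, so chains are
  compared by local keys, lexicographically from the top. At the first level where two chains
  differ, the comparison follows a \<open>run\<close> of consecutive leading splits down to the
  level where the chains meet again. The colour of the root comes from the top level, which has no
  split above it. A face without its top entry has exactly two completions: their top weights differ
  by one, the smaller one making the first split blue and the larger one red. Combs declare the red
  completion leading and Lyndon trees the blue one, so the chains that remain have a blue and a red
  root respectively. All relations have coefficients 1 and -1 at their leading chains, so every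
  equation is solved without division and the argument works over any commutative ring with
  1.\<close>

definition del :: "nat \<Rightarrow> 'a list \<Rightarrow> 'a list" where
  "del j c = take j c @ drop (Suc j) c"

lemma length_del: "j < length c \<Longrightarrow> length (del j c) = length c - 1"
  by (simp add: del_def)

lemma set_del: "set (del j c) \<subseteq> set c"
  by (auto simp: del_def dest: in_set_takeD in_set_dropD)

lemma nth_del: "j < length c \<Longrightarrow> k < length c - 1 \<Longrightarrow> del j c ! k = (if k < j then c ! k else c ! Suc k)"
  by (auto simp: del_def nth_append)

lemma sorted_wrt_del:
  assumes "sorted_wrt P c"
  shows "sorted_wrt P (del j c)"
proof (cases "j < length c")
  case True
  have "sorted_wrt P (take j c @ c ! j # drop (Suc j) c)"
    using assms by (simp only: id_take_nth_drop[OF True, symmetric])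
  then show ?thesis by (auto simp: del_def sorted_wrt_append)
qed (use assms in \<open>simp add: del_def\<close>)

lemma take_del_drop: "j < length c \<Longrightarrow> take j (del j c) @ c ! j # drop j (del j c) = c"
  using id_take_nth_drop[of j c] by (simp add: del_def min_def)

lemma del_insert: "j \<le> length d \<Longrightarrow> del j (take j d @ x # drop j d) = d"
  by (simp add: del_def min_def)

lemma finite_poset_chains:
  assumes "finite P"
  shows "finite (poset_chains P leq r)"
proof -
  have "poset_chains P leq r \<subseteq> {c. set c \<subseteq> P \<and> length c \<le> nat (r + 1)}"
    by (auto simp: poset_chains_def)
  then show ?thesis using finite_lists_length_le[OF assms] finite_subset by blast
qed

lemma del_in_poset_chains:
  assumes "c \<in> poset_chains P leq r" "j < length c"
  shows "del j c \<in> poset_chains P leq (r - 1)"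
  using assms set_del[of j c] by (auto simp: poset_chains_def sorted_wrt_del length_del)

lemma nth_in_gap_del:
  assumes "c \<in> poset_chains P leq r" "j < length c"
  shows "c ! j \<in> gap P leq (del j c) j"
proof -
  have 1: "j > 0 \<Longrightarrow> del j c ! (j - 1) = c ! (j - 1)" using assms by (subst nth_del) auto
  have 2: "j < length (del j c) \<Longrightarrow> del j c ! j = c ! Suc j"
    using assms length_del[of j c] by (subst nth_del) auto
  have s: "\<And>a b. a < b \<Longrightarrow> b < length c \<Longrightarrow> leq (c ! a) (c ! b) \<and> c ! a \<noteq> c ! b"
    using assms(1) unfolding poset_chains_def by (auto simp: sorted_wrt_iff_nth_less)
  show ?thesis
    using assms 1 2 s[of "j - 1" j] s[of j "Suc j"] length_del[of j c]
    by (auto simp: gap_def poset_chains_def subset_iff)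
qed

text \<open>The definition sums over source chains and insertions. Seen from a target
  \<open>c\<close>, an insertion at position \<open>i\<close> yields \<open>c\<close> only if the
  source is \<open>del i c\<close> and the inserted element is \<open>c ! i\<close>, so the triple
  sum collapses to the faces of \<open>c\<close>.\<close>

lemma coboundary_apply:
  assumes P: "finite P" and c: "c \<in> poset_chains P leq (r + 1)"
  shows "coboundary P leq r f c = (\<Sum>j<length c. (- 1) ^ j * f (del j c))"
proof -
  let ?D = "poset_chains P leq r"
  have fD: "finite ?D" by (rule finite_poset_chains[OF P])
  have lenc: "int (length c) = r + 2" using c by (simp add: poset_chains_def)
  have inner: "(\<Sum>x\<in>gap P leq d i. if c = take i d @ x # drop i d then 1 else 0) =
      (if d = del i c then 1 else (0::'b))" if d: "d \<in> ?D" and i: "i \<le> length d" for d i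
  proof -
    have fin: "finite (gap P leq d i)" using P by (simp add: gap_def)
    have il: "i < length c" using d i lenc by (simp add: poset_chains_def)
    have "(c = take i d @ x # drop i d) \<longleftrightarrow> (d = del i c \<and> x = c ! i)" for x
    proof
      assume a: "c = take i d @ x # drop i d"
      have "c ! i = x" unfolding a using i by (simp add: nth_append min_def)
      moreover have "del i c = d" unfolding a by (rule del_insert[OF i])
      ultimately show "d = del i c \<and> x = c ! i" by blast
    next
      assume "d = del i c \<and> x = c ! i"
      then show "c = take i d @ x # drop i d" using take_del_drop[OF il] by simp
    qed
    then have "(\<Sum>x\<in>gap P leq d i. if c = take i d @ x # drop i d then 1 else 0) =
        (\<Sum>x\<in>gap P leq d i. if d = del i c \<and> x = c ! i then 1 else (0::'b))"
      by (simp only:)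
    also have "\<dots> = (\<Sum>x\<in>gap P leq d i. if x = c ! i then (if d = del i c then 1 else 0) else (0::'b))"
      by (intro sum.cong[OF refl]) simp
    also have "\<dots> = (if c ! i \<in> gap P leq d i then (if d = del i c then 1 else 0) else 0)"
      by (simp add: sum.delta[OF fin])
    also have "\<dots> = (if d = del i c then 1 else 0)"
      using nth_in_gap_del[OF c il] by (cases "d = del i c") simp_all
    finally show ?thesis .
  qed
  have "coboundary P leq r f c = (\<Sum>d\<in>?D. f d * (\<Sum>i\<le>length d. (- 1) ^ i * (if d = del i c then 1 else 0)))"
  proof -
    have "(\<Sum>i\<le>length d. (- 1) ^ i * (\<Sum>x\<in>gap P leq d i. if c = take i d @ x # drop i d then 1 else 0)) =
        (\<Sum>i\<le>length d. (- 1) ^ i * (if d = del i c then 1 else (0::'b)))" if "d \<in> ?D" for d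
    proof (rule sum.cong[OF refl])
      fix i assume "i \<in> {..length d}"
      then show "(- 1) ^ i * (\<Sum>x\<in>gap P leq d i. if c = take i d @ x # drop i d then 1 else 0) =
          (- 1) ^ i * (if d = del i c then 1 else (0::'b))"
        using inner[OF that, of i] by (simp only: atMost_iff)
    qed
    then show ?thesis
      unfolding coboundary_def restrict_apply'[OF c] by (intro sum.cong[OF refl]) (simp only:)
  qed
  also have "\<dots> = (\<Sum>d\<in>?D. \<Sum>i<length c. if d = del i c then (- 1) ^ i * f d else 0)"
  proof (rule sum.cong[OF refl])
    fix d assume "d \<in> ?D"
    then have "{..length d} = {..<length c}" using lenc by (auto simp: poset_chains_def)
    then show "f d * (\<Sum>i\<le>length d. (- 1) ^ i * (if d = del i c then 1 else 0)) =
        (\<Sum>i<length c. if d = del i c then (- 1) ^ i * f d else 0)"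
      by (simp add: sum_distrib_left if_distrib mult.commute cong: if_cong)
  qed
  also have "\<dots> = (\<Sum>i<length c. \<Sum>d\<in>?D. if d = del i c then (- 1) ^ i * f d else 0)"
    by (rule sum.swap)
  also have "\<dots> = (\<Sum>i<length c. (- 1) ^ i * f (del i c))"
    using del_in_poset_chains[OF c] fD by (intro sum.cong[OF refl]) (simp add: sum.delta)
  finally show ?thesis .
qed

text \<open>The alternating face sum of an unrestricted function; on a chain of the right length it
  is the coboundary.\<close>

definition face_sum :: "('a list \<Rightarrow> 'k::comm_ring_1) \<Rightarrow> 'a list \<Rightarrow> 'k" where
  "face_sum g c = (\<Sum>j<length c. (- 1) ^ j * g (del j c))"

definition exact_on :: "'a list set \<Rightarrow> ('a list \<Rightarrow> 'k::comm_ring_1) \<Rightarrow> bool" where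
  "exact_on X f \<longleftrightarrow> (\<exists>g. \<forall>c\<in>X. f c = face_sum g c)"

section \<open>Linearity of face sums and of exactness\<close>

lemma face_sum_add: "face_sum (\<lambda>d. g d + h d) c = face_sum g c + face_sum h c"
  by (simp add: face_sum_def distrib_left sum.distrib)

lemma face_sum_scale: "face_sum (\<lambda>d. k * g d) c = k * face_sum g c"
  by (simp add: face_sum_def sum_distrib_left mult.left_commute)

lemma face_sum_sum: "face_sum (\<lambda>d. \<Sum>i\<in>I. g i d) c = (\<Sum>i\<in>I. face_sum (g i) c)"
  unfolding face_sum_def sum_distrib_left by (rule sum.swap)

lemma exact_on_add: "exact_on X f \<Longrightarrow> exact_on X f' \<Longrightarrow> exact_on X (\<lambda>c. f c + f' c)"
  unfolding exact_on_def
proof (elim exE)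
  fix g h assume "\<forall>c\<in>X. f c = face_sum g c" "\<forall>c\<in>X. f' c = face_sum h c"
  then show "\<exists>g. \<forall>c\<in>X. f c + f' c = face_sum g c"
    by (intro exI[of _ "\<lambda>d. g d + h d"]) (simp add: face_sum_add)
qed

lemma exact_on_scale: "exact_on X f \<Longrightarrow> exact_on X (\<lambda>c. k * f c)"
  unfolding exact_on_def by (metis face_sum_scale)

lemma exact_on_sum:
  assumes "\<And>i. i \<in> I \<Longrightarrow> exact_on X (f i)"
  shows "exact_on X (\<lambda>c. \<Sum>i\<in>I. f i c)"
proof -
  obtain g where g: "\<And>i c. i \<in> I \<Longrightarrow> c \<in> X \<Longrightarrow> f i c = face_sum (g i) c"
    using assms unfolding exact_on_def by metis
  show ?thesis unfolding exact_on_def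
    by (rule exI[of _ "\<lambda>d. \<Sum>i\<in>I. g i d"]) (simp add: face_sum_sum g)
qed

lemma exact_on_cong: "(\<And>c. c \<in> X \<Longrightarrow> f c = f' c) \<Longrightarrow> exact_on X f \<longleftrightarrow> exact_on X f'"
  by (simp add: exact_on_def)

lemmas func_space_class_ring =
  ring.func_space_def[of "class_ring :: 'k::comm_ring_1 ring", OF class_ring.ring_axioms]

text \<open>A face sum on \<open>X\<close> evaluates its argument only at faces of chains in
  \<open>X\<close>, so cutting a primitive down to the chains of the lower degree changes nothing.
  This is why \<open>exact_on\<close> imposes no support condition.\<close>

lemma coboundaries_eq:
  assumes P: "finite P"
  shows "coboundaries P leq r =
    {f \<in> extensional (poset_chains P leq r). exact_on (poset_chains P leq r) (f :: _ \<Rightarrow> 'k::comm_ring_1)}"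
    (is "_ = ?rhs")
proof
  show "coboundaries P leq r \<subseteq> ?rhs"
  proof
    fix f :: "'a list \<Rightarrow> 'k" assume "f \<in> coboundaries P leq r"
    then obtain g where g: "f = coboundary P leq (r - 1) g" by (auto simp: coboundaries_def)
    have "f \<in> extensional (poset_chains P leq r)" by (simp add: g coboundary_def)
    moreover have "\<forall>c\<in>poset_chains P leq r. f c = face_sum g c"
      using coboundary_apply[OF P, of _ leq "r - 1" g] by (simp add: g face_sum_def)
    ultimately show "f \<in> ?rhs" by (auto simp: exact_on_def)
  qed
  show "?rhs \<subseteq> coboundaries P leq r"
  proof
    fix f :: "'a list \<Rightarrow> 'k" assume f: "f \<in> ?rhs"
    then obtain g where g: "\<forall>c\<in>poset_chains P leq r. f c = face_sum g c" by (auto simp: exact_on_def)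
    let ?g = "restrict g (poset_chains P leq (r - 1))"
    have "f c = coboundary P leq (r - 1) ?g c" for c
    proof (cases "c \<in> poset_chains P leq r")
      case True
      have "coboundary P leq (r - 1) ?g c = face_sum ?g c"
        using coboundary_apply[OF P, of c leq "r - 1" ?g] True by (simp add: face_sum_def)
      also have "\<dots> = face_sum g c"
        unfolding face_sum_def using del_in_poset_chains[OF True] by (intro sum.cong) auto
      finally show ?thesis using g True by simp
    next
      case False
      then show ?thesis using f by (simp add: coboundary_def extensional_def)
    qed
    then have "f = coboundary P leq (r - 1) ?g" by (rule ext)
    moreover have "?g \<in> carrier (cochains P leq (r - 1))"
      unfolding cochains_def func_space_class_ring by simp
    ultimately show "f \<in> coboundaries P leq r" unfolding coboundaries_def by blast
  qed
qed

text \<open>The coset of \<open>f\<close> modulo coboundaries, also for \<open>f\<close> that is not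
  extensional: only the values on \<open>X\<close> matter, so representatives can be written as
  plain functions.\<close>

definition chain_coset :: "'a list set \<Rightarrow> ('a list \<Rightarrow> 'k::comm_ring_1) \<Rightarrow> ('a list \<Rightarrow> 'k) set" where
  "chain_coset X f = {h \<in> extensional X. exact_on X (\<lambda>c. h c - f c)}"

lemma exact_on_zero: "exact_on X (\<lambda>_. 0)"
  unfolding exact_on_def by (rule exI[of _ "\<lambda>_. 0"]) (simp add: face_sum_def)

lemma exact_on_diff:
  assumes "exact_on X f" "exact_on X f'"
  shows "exact_on X (\<lambda>c. f c - f' c)"
proof -
  have "exact_on X (\<lambda>c. f c + - 1 * f' c)"
    by (intro exact_on_add exact_on_scale assms)
  then show ?thesis by simp
qed

lemma exact_onI_zero: "(\<And>c. c \<in> X \<Longrightarrow> f c = 0) \<Longrightarrow> exact_on X f"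
  using exact_on_zero exact_on_cong by metis

lemma restrict_in_chain_coset: "restrict f X \<in> chain_coset X f"
  by (auto simp: chain_coset_def intro: exact_onI_zero)

lemma chain_coset_eq_iff:
  "chain_coset X f = chain_coset X g \<longleftrightarrow> exact_on X (\<lambda>c. f c - g c)"
proof
  assume "chain_coset X f = chain_coset X g"
  then have "exact_on X (\<lambda>c. restrict f X c - g c)"
    using restrict_in_chain_coset[of f X] by (simp add: chain_coset_def)
  then show "exact_on X (\<lambda>c. f c - g c)"
    by (rule exact_on_cong[THEN iffD1, rotated]) simp
next
  assume e: "exact_on X (\<lambda>c. f c - g c)"
  have "exact_on X (\<lambda>c. h c - f c) \<longleftrightarrow> exact_on X (\<lambda>c. h c - g c)" for h
  proof
    assume "exact_on X (\<lambda>c. h c - f c)"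
    from exact_on_add[OF this e] show "exact_on X (\<lambda>c. h c - g c)" by simp
  next
    assume "exact_on X (\<lambda>c. h c - g c)"
    from exact_on_diff[OF this e] show "exact_on X (\<lambda>c. h c - f c)" by simp
  qed
  then show "chain_coset X f = chain_coset X g" by (simp add: chain_coset_def)
qed

section \<open>The top cohomology module as functions modulo exact functions\<close>

context
  fixes P :: "'a set" and leq :: "'a \<Rightarrow> 'a \<Rightarrow> bool" and r :: int and K :: "'k::comm_ring_1 itself"
    and X :: "'a list set" and Q :: "('k, ('a list \<Rightarrow> 'k) set) module"
  defines "X \<equiv> poset_chains P leq r" and "Q \<equiv> cohomology P leq r"
  assumes fin: "finite P" and top: "poset_chains P leq (r + 1) = {}"
begin

lemma cochains_simps:
  "carrier (cochains P leq r :: ('k, _) module) = extensional X"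
  "f \<oplus>\<^bsub>cochains P leq r\<^esub> g = (\<lambda>c\<in>X. f c + (g c :: 'k))"
  "k \<odot>\<^bsub>cochains P leq r\<^esub> g = (\<lambda>c\<in>X. k * (g c :: 'k))"
  by (simp_all add: cochains_def func_space_class_ring X_def PiE_def)

lemma cocycles_top: "cocycles P leq r = (extensional X :: ('a list \<Rightarrow> 'k) set)"
proof -
  have "coboundary P leq r f = \<zero>\<^bsub>cochains P leq (r + 1)\<^esub>" for f :: "'a list \<Rightarrow> 'k"
    by (auto simp: coboundary_def cochains_def func_space_class_ring top restrict_def)
  then show ?thesis by (simp add: cocycles_def a_kernel_def' cochains_simps)
qed

lemma coboundary_coset:
  "coboundaries P leq r +>\<^bsub>cochains P leq r\<^esub> f = chain_coset X (f :: 'a list \<Rightarrow> 'k)"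
proof -
  have "h \<in> chain_coset X f \<longleftrightarrow> (\<exists>g\<in>coboundaries P leq r. h = (\<lambda>c\<in>X. g c + f c))" (is "?l \<longleftrightarrow> ?r") for h
  proof
    assume h: ?l
    have "(\<lambda>c\<in>X. h c - f c) \<in> coboundaries P leq r"
      using h by (auto simp: coboundaries_eq[OF fin] chain_coset_def X_def elim!: exact_on_cong[THEN iffD1, rotated])
    moreover have "h = (\<lambda>c\<in>X. (\<lambda>c\<in>X. h c - f c) c + f c)"
      using h by (auto simp: chain_coset_def extensional_def fun_eq_iff)
    ultimately show ?r by blast
  next
    assume ?r
    then obtain g where g: "g \<in> coboundaries P leq r" "h = (\<lambda>c\<in>X. g c + f c)" by blast
    then show ?l
      by (auto simp: coboundaries_eq[OF fin] chain_coset_def X_def elim!: exact_on_cong[THEN iffD1, rotated])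
  qed
  then show ?thesis unfolding a_r_coset_def' cochains_simps by (simp only: set_eq_iff UN_iff singleton_iff) blast
qed

lemma chain_class_eq: "chain_class P leq r c = chain_coset X (\<lambda>d. if d = c then 1 else 0 :: 'k)"
  unfolding chain_class_def coboundary_coset chain_coset_eq_iff
  by (rule exact_on_cong[THEN iffD2, OF _ exact_on_zero]) (simp add: single_cochain_def X_def)

lemma coset_carrier_update:
  "N +>\<^bsub>M\<lparr>carrier := C\<rparr>\<^esub> x = N +>\<^bsub>M\<^esub> x"
  by (simp add: a_r_coset_def')

lemma coset_restrict: "chain_coset X (restrict f X) = chain_coset X f"
  unfolding chain_coset_eq_iff by (rule exact_on_cong[THEN iffD2, OF _ exact_on_zero]) simp

lemma carrier_Q: "carrier Q = range (chain_coset X)"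
proof -
  have "carrier Q = chain_coset X ` extensional X"
    by (simp add: Q_def cohomology_def quotient_module_def A_RCOSETS_def' coset_carrier_update
        coboundary_coset cocycles_top UNION_singleton_eq_range)
  also have "\<dots> = range (chain_coset X)"
  proof -
    have "chain_coset X f \<in> chain_coset X ` extensional X" for f :: "'a list \<Rightarrow> 'k"
      by (rule image_eqI[where f = "chain_coset X" and x = "restrict f X"]) (simp_all add: coset_restrict)
    then show ?thesis by auto
  qed
  finally show ?thesis .
qed

lemma zero_Q: "\<zero>\<^bsub>Q\<^esub> = chain_coset X (\<lambda>_. 0)"
  by (auto simp: Q_def cohomology_def quotient_module_def coboundaries_eq[OF fin] chain_coset_def X_def)

lemma add_Q: "chain_coset X f \<oplus>\<^bsub>Q\<^esub> chain_coset X g = chain_coset X (\<lambda>c. f c + g c)"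
proof -
  have "h \<in> chain_coset X (\<lambda>c. f c + g c) \<longleftrightarrow>
    (\<exists>a\<in>chain_coset X f. \<exists>b\<in>chain_coset X g. h = (\<lambda>c\<in>X. a c + b c))" (is "?l \<longleftrightarrow> ?r") for h
  proof
    assume h: ?l
    have "restrict f X \<in> chain_coset X f"
      by (rule restrict_in_chain_coset)
    moreover have "(\<lambda>c\<in>X. h c - f c) \<in> chain_coset X g"
      using h by (auto simp: chain_coset_def algebra_simps elim!: exact_on_cong[THEN iffD1, rotated])
    moreover have "h = (\<lambda>c\<in>X. restrict f X c + (\<lambda>c\<in>X. h c - f c) c)"
      using h by (auto simp: chain_coset_def extensional_def fun_eq_iff)
    ultimately show ?r by blast
  next
    assume ?r
    then obtain a b where ab: "a \<in> chain_coset X f" "b \<in> chain_coset X g" "h = (\<lambda>c\<in>X. a c + b c)" by blast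
    have "exact_on X (\<lambda>c. (a c - f c) + (b c - g c))"
      using ab by (intro exact_on_add) (auto simp: chain_coset_def)
    then show ?l using ab by (auto simp: chain_coset_def algebra_simps elim!: exact_on_cong[THEN iffD1, rotated])
  qed
  then show ?thesis
    by (auto simp: Q_def cohomology_def quotient_module_def set_add_def' cochains_simps)
qed

lemma smult_Q: "k \<odot>\<^bsub>Q\<^esub> chain_coset X f = chain_coset X (\<lambda>c. k * f c)"
proof -
  have "chain_coset X (\<lambda>c\<in>X. k * x c) = chain_coset X (\<lambda>c. k * f c)" if "x \<in> chain_coset X f" for x
  proof -
    have "exact_on X (\<lambda>c. k * (x c - f c))"
      using that by (intro exact_on_scale) (simp add: chain_coset_def)
    then show ?thesis by (simp add: coset_restrict chain_coset_eq_iff algebra_simps)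
  qed
  moreover have "restrict f X \<in> chain_coset X f"
    by (rule restrict_in_chain_coset)
  ultimately have "(\<Union>x\<in>chain_coset X f. chain_coset X (\<lambda>c\<in>X. k * x c)) = chain_coset X (\<lambda>c. k * f c)"
    by auto
  then show ?thesis
    by (simp add: Q_def cohomology_def quotient_module_def coset_carrier_update coboundary_coset cochains_simps)
qed

lemma module_Q: "Module.module class_ring Q"
proof -
  have "\<exists>g. chain_coset X (\<lambda>c. f c + g c) = chain_coset X (\<lambda>_. 0)" for f :: "'a list \<Rightarrow> 'k"
    by (rule exI[of _ "\<lambda>c. - f c"]) simp
  then show ?thesis
    by (intro module_criteria)
       (auto simp: carrier_Q zero_Q add_Q smult_Q add_ac distrib_left distrib_right mult.assoc
         intro: class_cring.cring_axioms)
qed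

text \<open>Coefficients of \<open>lincomb\<close> are attached to classes. Injectivity on
  \<open>A\<close> lets them be read as coefficients of chains, which turns a linear combination
  into a single function.\<close>

lemma lincomb_Q:
  assumes "finite A" "inj_on (chain_class P leq r :: _ \<Rightarrow> ('a list \<Rightarrow> 'k) set) A"
  shows "LinearCombinations.module.lincomb Q a (chain_class P leq r ` A) =
    chain_coset X (\<lambda>d. if d \<in> A then a (chain_class P leq r d) else (0::'k))"
proof -
  interpret Q: Module.module class_ring Q by (rule module_Q)
  from assms have "(\<Oplus>\<^bsub>Q\<^esub>v\<in>chain_class P leq r ` A. a v \<odot>\<^bsub>Q\<^esub> v) =
      chain_coset X (\<lambda>d. if d \<in> A then a (chain_class P leq r d) else 0)"
  proof (induction A rule: finite_induct)
    case empty
    then show ?case by (simp add: zero_Q)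
  next
    case (insert c A)
    have notin: "chain_class P leq r c \<notin> (chain_class P leq r ` A :: ('a list \<Rightarrow> 'k) set set)"
      using insert by auto
    have sm: "k \<odot>\<^bsub>Q\<^esub> chain_class P leq r c' \<in> carrier Q" for k c'
      by (simp add: chain_class_eq smult_Q carrier_Q)
    have "(\<Oplus>\<^bsub>Q\<^esub>v\<in>chain_class P leq r ` insert c A. a v \<odot>\<^bsub>Q\<^esub> v) =
        a (chain_class P leq r c) \<odot>\<^bsub>Q\<^esub> chain_class P leq r c \<oplus>\<^bsub>Q\<^esub>
        (\<Oplus>\<^bsub>Q\<^esub>v\<in>chain_class P leq r ` A. a v \<odot>\<^bsub>Q\<^esub> v)"
      unfolding image_insert using insert.hyps notin sm by (intro Q.finsum_insert) auto
    also have "\<dots> = a (chain_class P leq r c) \<odot>\<^bsub>Q\<^esub> chain_coset X (\<lambda>d. if d = c then 1 else 0) \<oplus>\<^bsub>Q\<^esub>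
        chain_coset X (\<lambda>d. if d \<in> A then a (chain_class P leq r d) else 0)"
      using insert by (simp add: chain_class_eq[of c])
    also have "\<dots> = chain_coset X (\<lambda>d. if d \<in> insert c A then a (chain_class P leq r d) else 0)"
      unfolding smult_Q add_Q
      by (rule arg_cong[of _ _ "chain_coset X"]) (use insert.hyps in \<open>auto simp: fun_eq_iff\<close>)
    finally show ?case .
  qed
  then show ?thesis by (simp add: Q.lincomb_def)
qed

text \<open>Distinctness of the classes is not a separate task: two chains with equal classes would
  give a relation with coefficients 1 and -1, contradicting \<open>indep\<close>.\<close>

lemma cohomology_basisI:
  assumes S: "S \<subseteq> X"
    and span: "\<And>f :: 'a list \<Rightarrow> 'k. \<exists>a. exact_on X (\<lambda>d. f d - (if d \<in> S then a d else 0))"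
    and indep: "\<And>a :: 'a list \<Rightarrow> 'k. exact_on X (\<lambda>d. if d \<in> S then a d else 0) \<Longrightarrow> \<forall>d\<in>S. a d = 0"
  shows "cohomology_basis K P leq r S"
proof -
  interpret Q: Module.module class_ring Q by (rule module_Q)
  let ?c = "chain_class P leq r :: 'a list \<Rightarrow> ('a list \<Rightarrow> 'k) set"
  have finS: "finite S" using S finite_poset_chains[OF fin] unfolding X_def by (rule finite_subset)
  have inj: "inj_on ?c S"
  proof
    fix c c' assume c: "c \<in> S" "c' \<in> S" "?c c = ?c c'"
    have "exact_on X (\<lambda>d. (if d = c then 1 else 0) - (if d = c' then 1 else 0) :: 'k)"
      using c by (simp add: chain_class_eq chain_coset_eq_iff)
    then have "exact_on X (\<lambda>d. if d \<in> S then (if d = c then 1 else 0) - (if d = c' then 1 else 0) else 0 :: 'k)"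
      by (rule exact_on_cong[THEN iffD1, rotated]) (use c in auto)
    from indep[OF this] c(1) show "c = c'" by (auto split: if_splits)
  qed
  have li: "\<not> LinearCombinations.module.lin_dep class_ring Q (?c ` S)"
  proof
    assume "LinearCombinations.module.lin_dep class_ring Q (?c ` S)"
    then obtain A a v where A: "finite A" "A \<subseteq> ?c ` S" "Q.lincomb a A = \<zero>\<^bsub>Q\<^esub>" "v \<in> A" "a v \<noteq> 0"
      by (auto simp: Q.lin_dep_def)
    then obtain B where B: "B \<subseteq> S" "A = ?c ` B" by (meson subset_imageE)
    then have "finite B" "inj_on ?c B" using finS inj by (auto intro: finite_subset inj_on_subset)
    from lincomb_Q[OF this, of a] A(3) B
    have "exact_on X (\<lambda>d. if d \<in> B then a (?c d) else 0)"
      by (simp add: zero_Q chain_coset_eq_iff)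
    then have "exact_on X (\<lambda>d. if d \<in> S then (if d \<in> B then a (?c d) else 0) else 0)"
      by (rule exact_on_cong[THEN iffD1, rotated]) (use B in auto)
    from indep[OF this] have "a (?c d) = 0" if "d \<in> B" for d using B that by (auto dest!: bspec[of S _ d])
    then show False using A B by auto
  qed
  have sub: "?c ` S \<subseteq> carrier Q" by (auto simp: chain_class_eq carrier_Q)
  have "v \<in> Q.span (?c ` S)" if v: "v \<in> carrier Q" for v
  proof -
    obtain f where f: "v = chain_coset X f" using v by (auto simp: carrier_Q)
    obtain a where a: "exact_on X (\<lambda>d. f d - (if d \<in> S then a d else 0))" using span by blast
    \<comment> \<open>The coefficient of a class is looked up at the unique chain of
      \<open>S\<close> representing it.\<close>
    let ?a = "\<lambda>u. a (inv_into S ?c u)"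
    have "Q.lincomb ?a (?c ` S) = chain_coset X (\<lambda>d. if d \<in> S then a d else 0)"
      unfolding lincomb_Q[OF finS inj] by (rule arg_cong[of _ _ "chain_coset X"]) (auto simp: inj)
    also have "\<dots> = v" using a by (simp add: f chain_coset_eq_iff[symmetric])
    finally show ?thesis unfolding Q.span_def using finS by (intro CollectI exI conjI) auto
  qed
  moreover have "Q.span (?c ` S) \<subseteq> carrier Q"
    using sub by (auto simp: Q.span_def intro!: Q.lincomb_closed)
  ultimately show ?thesis
    using S inj li sub unfolding cohomology_basis_def module_basis_def X_def Q_def by blast
qed

end

section \<open>Chains without leading positions\<close>

text \<open>A linear combination of chains in \<open>S\<close> is represented by a function cut off
  outside \<open>S\<close>. Spanning and independence then need neither finite sums nor a module
  structure.\<close>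

definition coset_basis :: "'k::comm_ring_1 itself \<Rightarrow> 'a list set \<Rightarrow> 'a list set \<Rightarrow> bool" where
  "coset_basis K X S \<longleftrightarrow> S \<subseteq> X \<and>
    (\<forall>f :: 'a list \<Rightarrow> 'k. \<exists>a. exact_on X (\<lambda>d. f d - (if d \<in> S then a d else 0))) \<and>
    (\<forall>a :: 'a list \<Rightarrow> 'k. exact_on X (\<lambda>d. if d \<in> S then a d else 0) \<longrightarrow> (\<forall>d\<in>S. a d = 0))"

lemma coset_basis_imp_cohomology_basis:
  assumes "finite P" "poset_chains P leq (r + 1) = {}" "coset_basis K (poset_chains P leq r) S"
  shows "cohomology_basis K P leq r S"
  using assms(3) unfolding coset_basis_def by (intro cohomology_basisI[OF assms(1,2)]) auto

lemma sign_sign_mult: "(- 1) ^ k * ((- 1) ^ k * x) = (x :: 'k::comm_ring_1)"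
  by (simp flip: mult.assoc power_add)

lemma if_in_image_sum:
  assumes "finite S" "inj_on \<phi> S"
  shows "(if d \<in> \<phi> ` S then b d else 0) = (\<Sum>s\<in>S. b (\<phi> s) * (if d = \<phi> s then 1 else (0::'k::comm_ring_1)))"
proof (cases "d \<in> \<phi> ` S")
  case True
  then obtain s where s: "s \<in> S" "d = \<phi> s" by blast
  have "(\<Sum>t\<in>S. b (\<phi> t) * (if d = \<phi> t then 1 else 0)) = (\<Sum>t\<in>S. if t = s then b d else 0)"
    using s assms(2) by (intro sum.cong[OF refl]) (auto dest: inj_onD)
  then show ?thesis using s assms(1) by simp
next
  case False
  then have "(\<Sum>t\<in>S. b (\<phi> t) * (if d = \<phi> t then 1 else 0)) = 0"
    by (intro sum.neutral) auto
  then show ?thesis using False by simp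
qed

text \<open>The class of \<open>\<phi> s\<close> is plus or minus the class of \<open>s\<close>, and
  such a change of basis is invertible over any ring: coefficients pass in both directions by
  multiplication with \<open>\<epsilon> s\<close>.\<close>

lemma coset_basis_transfer:
  fixes K :: "'k::comm_ring_1 itself"
  assumes fin: "finite S" and basis: "coset_basis K X S"
    and inj: "inj_on \<phi> S" and im: "\<phi> ` S \<subseteq> X"
    and equiv: "\<And>s. s \<in> S \<Longrightarrow> \<epsilon> s \<in> {1, - 1} \<and>
      exact_on X (\<lambda>d. (if d = \<phi> s then 1 else 0) - \<epsilon> s * (if d = s then 1 else 0 :: 'k))"
  shows "coset_basis K X (\<phi> ` S)"
proof -
  have ex: "exact_on X (\<lambda>d. \<Sum>s\<in>S. b s * ((if d = \<phi> s then 1 else 0) - \<epsilon> s * (if d = s then 1 else 0)))" for b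
    using equiv by (intro exact_on_sum exact_on_scale) blast
  have id: "(if d \<in> S then a d else 0) = (\<Sum>s\<in>S. a s * (if d = s then 1 else (0::'k)))" for a d
    using if_in_image_sum[OF fin inj_on_id, of d a] by simp
  have ee: "\<epsilon> s * \<epsilon> s = 1" if "s \<in> S" for s
  proof -
    have "\<epsilon> s = 1 \<or> \<epsilon> s = - 1" using equiv[OF that] by blast
    then show ?thesis by auto
  qed
  have "\<exists>a. exact_on X (\<lambda>d. f d - (if d \<in> \<phi> ` S then a d else 0))" for f :: "'a list \<Rightarrow> 'k"
  proof -
    obtain a where a: "exact_on X (\<lambda>d. f d - (if d \<in> S then a d else 0))"
      using basis unfolding coset_basis_def by blast
    \<comment> \<open>The coefficient of \<open>s\<close> moves to \<open>\<phi> s\<close>; the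
      factor \<open>\<epsilon>\<close> is its own inverse.\<close>
    define b where "b d = a (inv_into S \<phi> d) * \<epsilon> (inv_into S \<phi> d)" for d
    have b: "s \<in> S \<Longrightarrow> b (\<phi> s) = a s * \<epsilon> s" for s using inj by (simp add: b_def)
    have "f d - (if d \<in> \<phi> ` S then b d else 0) = (f d - (if d \<in> S then a d else 0)) -
        (\<Sum>s\<in>S. b (\<phi> s) * ((if d = \<phi> s then 1 else 0) - \<epsilon> s * (if d = s then 1 else 0)))" for d
    proof -
      have "(\<Sum>s\<in>S. b (\<phi> s) * (\<epsilon> s * (if d = s then 1 else 0))) = (\<Sum>s\<in>S. a s * (if d = s then 1 else 0))"
        by (intro sum.cong[OF refl]) (simp add: b mult.assoc ee)
      then show ?thesis
        unfolding if_in_image_sum[OF fin inj] id by (simp add: right_diff_distrib sum_subtractf)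
    qed
    then have "exact_on X (\<lambda>d. f d - (if d \<in> \<phi> ` S then b d else 0))"
      using exact_on_diff[OF a ex[of "\<lambda>s. b (\<phi> s)"]] by (simp only:)
    then show ?thesis by blast
  qed
  moreover have "b d = 0"
    if b: "exact_on X (\<lambda>d. if d \<in> \<phi> ` S then b d else 0)" and d: "d \<in> \<phi> ` S" for b :: "'a list \<Rightarrow> 'k" and d
  proof -
    have "(if d \<in> \<phi> ` S then b d else 0) -
        (\<Sum>s\<in>S. b (\<phi> s) * ((if d = \<phi> s then 1 else 0) - \<epsilon> s * (if d = s then 1 else 0))) =
        (if d \<in> S then b (\<phi> d) * \<epsilon> d else 0)" for d
      unfolding if_in_image_sum[OF fin inj] id[of d "\<lambda>d. b (\<phi> d) * \<epsilon> d"]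
      by (simp add: right_diff_distrib sum_subtractf mult.assoc)
    then have "exact_on X (\<lambda>d. if d \<in> S then b (\<phi> d) * \<epsilon> d else 0)"
      using exact_on_diff[OF b ex[of "\<lambda>s. b (\<phi> s)"]] by (simp only:)
    then have 0: "\<forall>s\<in>S. b (\<phi> s) * \<epsilon> s = 0"
      using conjunct2[OF conjunct2[OF basis[unfolded coset_basis_def]]]
      by (elim allE[of _ "\<lambda>d. b (\<phi> d) * \<epsilon> d"]) simp
    have "b (\<phi> s) = 0" if "s \<in> S" for s
      using bspec[OF 0 that] ee[OF that] by (metis mult.assoc mult.right_neutral mult_zero_left)
    then show ?thesis using d by blast
  qed
  ultimately show ?thesis using im by (auto simp: coset_basis_def)
qed

text \<open>\<open>level\<close> ties an entry to its position, so faces omitting different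
  positions never coincide. \<open>lead_ex\<close> provides a leading completion for every face.
  \<open>lead_max\<close> allows any set of differing positions: for one position it says that the
  leading completion is the largest one, for two it is the confluence condition needed for
  overlapping relations.\<close>

locale leading_positions =
  fixes X :: "'a list set" and N :: nat and level :: "'a \<Rightarrow> nat"
    and lead :: "'a list \<Rightarrow> nat \<Rightarrow> bool" and prec :: "'a list \<Rightarrow> 'a list \<Rightarrow> bool"
  assumes finX: "finite X"
    and len: "c \<in> X \<Longrightarrow> length c = N"
    and level: "c \<in> X \<Longrightarrow> i < N \<Longrightarrow> level (c ! i) = i"
    and lead_ex: "c \<in> X \<Longrightarrow> i < N \<Longrightarrow> \<exists>x. c[i := x] \<in> X \<and> lead (c[i := x]) i"
    and lead_max: "\<lbrakk>c \<in> X; c' \<in> X; c \<noteq> c'; \<And>i. i < N \<Longrightarrow> c ! i \<noteq> c' ! i \<Longrightarrow> lead c i\<rbrakk> \<Longrightarrow> prec c' c"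
    and prec_trans: "prec a b \<Longrightarrow> prec b c \<Longrightarrow> prec a c"
    and prec_irrefl: "\<not> prec c c"
begin

definition agree_off :: "nat set \<Rightarrow> 'a list \<Rightarrow> 'a list \<Rightarrow> bool" where
  "agree_off I c c' \<longleftrightarrow> (\<forall>i<N. i \<notin> I \<longrightarrow> c ! i = c' ! i)"

text \<open>Turns the strict order \<open>prec\<close> on the finite set \<open>X\<close> into a
  measure on which to induct. Incomparable chains may have equal \<open>rk\<close>, which does no
  harm because comparisons are made between completions only.\<close>

definition rk :: "'a list \<Rightarrow> nat" where
  "rk c = card {c' \<in> X. prec c' c}"

definition normal_chains :: "'a list set" where
  "normal_chains = {c \<in> X. \<forall>i<N. \<not> lead c i}"

lemma normal_sub: "normal_chains \<subseteq> X"
  by (auto simp: normal_chains_def)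

lemma rk_less:
  assumes "prec c' c" "c' \<in> X"
  shows "rk c' < rk c"
  unfolding rk_def
proof (rule psubset_card_mono)
  show "finite {a \<in> X. prec a c}" using finX by simp
  show "{a \<in> X. prec a c'} \<subset> {a \<in> X. prec a c}"
    using assms prec_trans prec_irrefl[of c'] by blast
qed

lemma rk_le: "rk c \<le> card X"
  unfolding rk_def using finX by (auto intro: card_mono)

lemma lead_rk:
  assumes "c \<in> X" "c' \<in> X" "agree_off I c c'" "\<And>i. i \<in> I \<Longrightarrow> lead c i" "rk c \<le> rk c'"
  shows "c = c'"
proof (rule ccontr)
  assume "c \<noteq> c'"
  then have "prec c' c" using assms by (intro lead_max) (auto simp: agree_off_def)
  then show False using rk_less assms by fastforce
qed

text \<open>A face remembers the omitted position, since otherwise one entry would sit at two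
  different levels.\<close>

lemma del_eqD:
  assumes c: "c \<in> X" "i < N" and c': "c' \<in> X" "j < N" and eq: "del i c = del j c'"
  shows "i = j" "agree_off {i} c c'"
proof -
  have *: "\<not> i < j" if "c \<in> X" "c' \<in> X" "i < N" "j < N" "del i c = del j c'" for c c' i j
  proof
    assume "i < j"
    then have "c ! Suc i = c' ! i"
      using nth_del[of i c i] nth_del[of j c' i] that by (simp add: len)
    then show False using level[of c "Suc i"] level[of c' i] that \<open>i < j\<close> by simp
  qed
  show ij: "i = j" using *[OF c(1) c'(1) c(2) c'(2) eq] *[OF c'(1) c(1) c'(2) c(2) eq[symmetric]] by simp
  show "agree_off {i} c c'" unfolding agree_off_def
  proof (intro allI impI)
    fix k assume k: "k < N" "k \<notin> {i}"
    show "c ! k = c' ! k"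
    proof (cases "k < i")
      case True
      then show ?thesis using nth_del[of i c k] nth_del[of i c' k] c c' eq ij by (simp add: len)
    next
      case False
      then show ?thesis
        using nth_del[of i c "k - 1"] nth_del[of i c' "k - 1"] c c' eq ij k
        by (cases k) (auto simp: len less_Suc_eq split: if_splits)
    qed
  qed
qed

lemma del_lead_ex:
  assumes "c \<in> X" "i < N"
  obtains m where "m \<in> X" "lead m i" "del i m = del i c" "agree_off {i} m c"
proof -
  obtain x where x: "c[i := x] \<in> X" "lead (c[i := x]) i" using lead_ex[OF assms] by blast
  moreover have "del i (c[i := x]) = del i c" by (simp add: del_def)
  moreover have "agree_off {i} (c[i := x]) c" by (simp add: agree_off_def)
  ultimately show ?thesis by (rule that)
qed

text \<open>With one leading position \<open>pos m\<close> chosen for each nonnormal chain, the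
  system is triangular with entries 1 and -1 on the diagonal: the unknown at
  \<open>del (pos m) m\<close> occurs in the equation of \<open>m\<close> and otherwise only in
  equations of chains of smaller \<open>rk\<close>. It is solved from the largest \<open>rk\<close>
  downward.\<close>

lemma span_nonnormal:
  fixes f :: "'a list \<Rightarrow> 'k::comm_ring_1"
  shows "\<exists>g. \<forall>c\<in>X - normal_chains. f c = face_sum g c"
proof -
  define pos where "pos m = (SOME i. i < N \<and> lead m i)" for m
  have pos: "pos m < N" "lead m (pos m)" if "m \<in> X - normal_chains" for m
    using that someI_ex[of "\<lambda>i. i < N \<and> lead m i"] by (auto simp: normal_chains_def pos_def)
  have pos_eq: "c = m" "j = pos m"
    if "m \<in> X - normal_chains" "c \<in> X" "j < N" "rk m \<le> rk c" "del j c = del (pos m) m" for m c j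
    using del_eqD[of m "pos m" c j] that pos[of m] lead_rk[of m c "{pos m}"] by auto
  \<comment> \<open>The equations of \<open>rk\<close> above \<open>card X - k\<close> are already
    solved. For \<open>k = 0\<close> there are none because \<open>rk c\<close> is at most
    \<open>card X\<close>, and \<open>k = card X + 1\<close> covers all chains.\<close>
  have "\<exists>g. \<forall>c\<in>X - normal_chains. card X + 1 \<le> rk c + k \<longrightarrow> f c = face_sum g c" for k
  proof (induction k)
    case 0
    have "\<not> card X + 1 \<le> rk c" for c using rk_le[of c] by simp
    then show ?case by simp
  next
    case (Suc k)
    then obtain g where g: "\<And>c. c \<in> X - normal_chains \<Longrightarrow> card X + 1 \<le> rk c + k \<Longrightarrow> f c = face_sum g c"
      by blast
    \<comment> \<open>The correction is supported on the chosen faces of the chains of the current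
      \<open>rk\<close>. It repairs their equations and leaves those of equal or larger
      \<open>rk\<close> otherwise untouched.\<close>
    define h where "h d = (\<Sum>m\<in>{m \<in> X - normal_chains. card X = rk m + k}.
        (- 1) ^ pos m * (f m - face_sum g m) * (if d = del (pos m) m then 1 else 0))" for d
    have "f c = face_sum (\<lambda>d. g d + h d) c" if c: "c \<in> X - normal_chains" "card X \<le> rk c + k" for c
    proof -
      have h: "h (del j c) = (if j = pos c \<and> card X = rk c + k then (- 1) ^ pos c * (f c - face_sum g c) else 0)"
        if j: "j < N" for j
      proof -
        have iff: "(del j c = del (pos m) m) \<longleftrightarrow> m = c \<and> j = pos c"
          if "m \<in> X - normal_chains" "card X = rk m + k" for m
          using pos_eq[of m c j] that c j by auto
        have "h (del j c) = (\<Sum>m\<in>{m \<in> X - normal_chains. card X = rk m + k}.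
            if m = c then (if j = pos c then (- 1) ^ pos c * (f c - face_sum g c) else 0) else 0)"
          unfolding h_def by (intro sum.cong[OF refl]) (auto simp: iff)
        then show ?thesis using c finX by (auto simp: sum.delta)
      qed
      have "face_sum h c = (\<Sum>j<N. if j = pos c then
          (if card X = rk c + k then (- 1) ^ j * ((- 1) ^ j * (f c - face_sum g c)) else 0) else 0)"
        unfolding face_sum_def[of h] using c by (intro sum.cong) (auto simp: h len)
      also have "\<dots> = (if card X = rk c + k then f c - face_sum g c else 0)"
        using pos(1)[OF c(1)] by (simp add: sign_sign_mult)
      finally show ?thesis using g[OF c(1)] c(2) by (auto simp: face_sum_add)
    qed
    then show ?case by (intro exI[of _ "\<lambda>d. g d + h d"]) auto
  qed
  from this[of "card X + 1"] show ?thesis by auto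
qed

text \<open>The coboundary of a chain that misses the levels \<open>i\<close> and \<open>j\<close>; its own coboundary vanishes.\<close>

definition syzygy :: "'a list \<Rightarrow> nat \<Rightarrow> nat \<Rightarrow> 'a list \<Rightarrow> 'k::comm_ring_1" where
  "syzygy c i j d =
    (if \<exists>c'\<in>X. agree_off {i, j} c c' \<and> d = del j c' then 1
     else if \<exists>c'\<in>X. agree_off {i, j} c c' \<and> d = del i c' then - ((- 1) ^ (i + j)) else 0)"

lemma syzygy_nonzero:
  assumes "syzygy c i j (del l c') \<noteq> (0::'k::comm_ring_1)" "c' \<in> X" "l < N" "i < N" "j < N"
  shows "l \<in> {i, j} \<and> agree_off {i, j} c c'"
proof -
  obtain c'' l' where c'': "c'' \<in> X" "agree_off {i, j} c c''" "l' \<in> {i, j}" "del l c' = del l' c''"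
    using assms(1) by (auto simp: syzygy_def split: if_splits)
  have "l = l'" "agree_off {l} c' c''" using del_eqD[OF assms(2,3) c''(1) _ c''(4)] c''(3) assms by auto
  then show ?thesis using c'' by (auto simp: agree_off_def)
qed

text \<open>Only the faces omitting \<open>i\<close> or \<open>j\<close> contribute. The coefficient
  at the faces omitting \<open>j\<close> is normalised to 1, which forces
  \<open>- ((- 1) ^ (i + j))\<close> at those omitting \<open>i\<close> for the two terms to
  cancel.\<close>

lemma face_sum_syzygy:
  assumes "c \<in> X" "c' \<in> X" "i < N" "j < N" "i \<noteq> j"
  shows "face_sum (syzygy c i j) c' = (0::'k::comm_ring_1)"
proof (cases "agree_off {i, j} c c'")
  case True
  have j: "syzygy c i j (del j c') = (1::'k)" using True assms by (auto simp: syzygy_def)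
  have "\<not> (\<exists>c''\<in>X. agree_off {i, j} c c'' \<and> del i c' = del j c'')"
    using del_eqD(1)[OF assms(2,3) _ assms(4)] assms(5) by blast
  then have i: "syzygy c i j (del i c') = (- ((- 1) ^ (i + j)) :: 'k)" using True assms by (auto simp: syzygy_def)
  have "face_sum (syzygy c i j) c' = (\<Sum>l<N. (- 1) ^ l * (syzygy c i j (del l c') :: 'k))"
    using assms by (simp add: face_sum_def len)
  also have "\<dots> = (\<Sum>l\<in>{i, j}. (- 1) ^ l * syzygy c i j (del l c'))"
  proof (rule sum.mono_neutral_right)
    show "\<forall>l\<in>{..<N} - {i, j}. (- 1) ^ l * (syzygy c i j (del l c') :: 'k) = 0"
      using syzygy_nonzero[where 'k = 'k, OF _ assms(2) _ assms(3,4)] by (metis DiffD1 DiffD2 lessThan_iff mult_zero_right)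
  qed (use assms in auto)
  also have "\<dots> = 0" using assms(5) i j by (simp add: power_add flip: mult.assoc power_mult_distrib)
  finally show ?thesis .
next
  case False
  have "syzygy c i j (del l c') = (0::'k)" if "l < N" for l
    using syzygy_nonzero[where 'k = 'k, OF _ assms(2) that assms(3,4)] False by blast
  then show ?thesis using assms by (simp add: face_sum_def len)
qed

text \<open>A relation that could be used to rewrite a chain at a second leading position is traded, by
  means of a syzygy, for the relation at a chosen leading position and relations with smaller
  leading chains. This is the diamond lemma.\<close>

lemma face_sum_zero:
  fixes g :: "'a list \<Rightarrow> 'k::comm_ring_1"
  assumes g: "\<And>c. c \<in> X - normal_chains \<Longrightarrow> face_sum g c = 0" and "c \<in> X"
  shows "face_sum g c = 0"
proof -
  define pos where "pos m = (SOME i. i < N \<and> lead m i)" for m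
  have pos: "pos m < N" "lead m (pos m)" if "m \<in> X - normal_chains" for m
    using that someI_ex[of "\<lambda>i. i < N \<and> lead m i"] by (auto simp: normal_chains_def pos_def)
  \<comment> \<open>The redundant relations: faces whose leading completion \<open>m\<close> has
    been assigned another face, the one at \<open>pos m\<close>.\<close>
  define bad where "bad = {(m, j). m \<in> X \<and> j < N \<and> lead m j \<and> j \<noteq> pos m}"
  have finbad: "finite bad"
    by (rule finite_subset[of _ "X \<times> {..<N}"]) (auto simp: bad_def finX)
  have nonnormal: "m \<in> X - normal_chains" if "m \<in> X" "j < N" "lead m j" for m j
    using that by (auto simp: normal_chains_def)
  \<comment> \<open>Syzygies have zero face sum on \<open>X\<close>, so they can be added freely to
    make \<open>g\<close> vanish on the redundant faces. This is done downward in \<open>rk\<close>,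
    with the same counter \<open>k\<close> as in the spanning argument.\<close>
  have "\<exists>g'. (\<forall>c\<in>X. face_sum g' c = face_sum g c) \<and>
      (\<forall>(m, j)\<in>bad. card X + 1 \<le> rk m + k \<longrightarrow> g' (del j m) = 0)" for k
  proof (induction k)
    case 0
    have "\<not> card X + 1 \<le> rk c" for c using rk_le[of c] by simp
    then show ?case by (intro exI[of _ g]) simp
  next
    case (Suc k)
    then obtain g' where g': "\<And>c. c \<in> X \<Longrightarrow> face_sum g' c = face_sum g c"
      "\<And>m j. (m, j) \<in> bad \<Longrightarrow> card X + 1 \<le> rk m + k \<Longrightarrow> g' (del j m) = 0" by fast
    let ?B = "{(m, j) \<in> bad. card X = rk m + k}"
    define h where "h d = (\<Sum>(m, j)\<in>?B. - g' (del j m) * syzygy m (pos m) j d)" for d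
    have "face_sum (\<lambda>d. g' d + h d) c = face_sum g c" if c: "c \<in> X" for c
    proof -
      have "face_sum (\<lambda>d. - g' (del j m) * syzygy m (pos m) j d) c = 0" if "(m, j) \<in> bad" for m j
        unfolding face_sum_scale using that c pos[OF nonnormal] face_sum_syzygy[of m c "pos m" j, where 'k = 'k]
        by (auto simp: bad_def)
      then have "face_sum h c = 0"
        unfolding h_def face_sum_sum by (intro sum.neutral) auto
      then show ?thesis using g'(1)[OF c] by (simp add: face_sum_add)
    qed
    moreover have "g' (del j m) + h (del j m) = 0" if mj: "(m, j) \<in> bad" "card X \<le> rk m + k" for m j
    proof -
      \<comment> \<open>A syzygy at \<open>m'\<close> meets only faces of chains that agree with
        \<open>m'\<close> off \<open>pos m'\<close> and \<open>j'\<close>. Since \<open>m'\<close>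
        leads at both positions, those chains have smaller \<open>rk\<close>, so among the redundant
        faces already treated or being treated it meets only its own.\<close>
      have "syzygy m' (pos m') j' (del j m) = (if (m', j') = (m, j) then 1 else 0 :: 'k)" if "(m', j') \<in> ?B" for m' j'
      proof (cases "(m', j') = (m, j)")
        case True
        then show ?thesis using mj by (auto simp: syzygy_def bad_def agree_off_def)
      next
        case False
        show ?thesis
        proof (rule ccontr)
          assume "\<not> ?thesis"
          then have "syzygy m' (pos m') j' (del j m) \<noteq> (0::'k)" using False by auto
          then have *: "j \<in> {pos m', j'}" "agree_off {pos m', j'} m' m"
            using syzygy_nonzero[of m' "pos m'" j' j m] mj that pos(1)[OF nonnormal, of m' j'] by (auto simp: bad_def)
          have "m' = m"
            using mj that pos(2)[OF nonnormal, of m' j'] by (intro lead_rk[OF _ _ *(2)]) (auto simp: bad_def)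
          then show False using * False mj by (auto simp: bad_def)
        qed
      qed
      note syz = this
      have "h (del j m) = (\<Sum>p\<in>?B. if p = (m, j) then - g' (del j m) else 0)"
        unfolding h_def
      proof (rule sum.cong[OF refl])
        fix p assume p: "p \<in> ?B"
        show "(case p of (m', j') \<Rightarrow> - g' (del j' m') * syzygy m' (pos m') j' (del j m)) =
            (if p = (m, j) then - g' (del j m) else 0)"
          using syz[of "fst p" "snd p"] p by (cases "p = (m, j)") (simp_all add: case_prod_beta)
      qed
      also have "\<dots> = (if (m, j) \<in> ?B then - g' (del j m) else 0)"
        using finbad by (subst sum.delta) (auto intro: finite_subset)
      finally show ?thesis using mj g'(2)[of m j] by auto
    qed
    ultimately show ?case by (intro exI[of _ "\<lambda>d. g' d + h d"]) auto
  qed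
  from this[of "card X + 1"] obtain g' where "\<forall>c\<in>X. face_sum g' c = face_sum g c"
    "\<forall>(m, j)\<in>bad. card X + 1 \<le> rk m + (card X + 1) \<longrightarrow> g' (del j m) = 0" by blast
  then have g': "\<And>c. c \<in> X \<Longrightarrow> face_sum g' c = face_sum g c"
    "\<And>m j. (m, j) \<in> bad \<Longrightarrow> g' (del j m) = 0" by auto
  \<comment> \<open>Now only chosen faces can carry a nonzero value. In the equation of
    \<open>m\<close> every other face is either redundant or the chosen face of a chain of larger
    \<open>rk\<close>, so one unknown is left and it must vanish.\<close>
  have main: "g' (del (pos m) m) = 0" if "m \<in> X - normal_chains" for m
    using that
  proof (induction "card X - rk m" arbitrary: m rule: less_induct)
    case less
    have "g' (del j m) = 0" if j: "j < N" "j \<noteq> pos m" for j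
    proof -
      obtain m' where m': "m' \<in> X" "lead m' j" "del j m' = del j m" "agree_off {j} m' m"
        using del_lead_ex[OF DiffD1[OF less.prems] j(1)] .
      show ?thesis
      proof (cases "j = pos m'")
        case True
        then have "m' \<noteq> m" using j(2) by blast
        have "rk m < rk m'"
        proof (rule ccontr)
          assume "\<not> rk m < rk m'"
          then have "m' = m" using m' less.prems by (intro lead_rk[OF m'(1) _ m'(4)]) simp_all
          then show False using \<open>m' \<noteq> m\<close> by simp
        qed
        then have "card X - rk m' < card X - rk m" using rk_le[of m'] by linarith
        from less.hyps[OF this nonnormal[OF m'(1) j(1) m'(2)]] show ?thesis
          by (simp only: True[symmetric] m'(3))
      next
        case False
        then have "(m', j) \<in> bad" using m' j by (simp add: bad_def)
        from g'(2)[OF this] show ?thesis by (simp only: m'(3))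
      qed
    qed
    note z = this
    have mX: "m \<in> X" using less.prems by blast
    have "face_sum g' m = (\<Sum>j<N. if j = pos m then (- 1) ^ j * g' (del j m) else 0)"
      unfolding face_sum_def len[OF mX]
    proof (rule sum.cong[OF refl])
      fix j assume "j \<in> {..<N}"
      then show "(- 1) ^ j * g' (del j m) = (if j = pos m then (- 1) ^ j * g' (del j m) else 0)"
        using z[of j] by (cases "j = pos m") simp_all
    qed
    also have "\<dots> = (- 1) ^ pos m * g' (del (pos m) m)" using pos(1)[OF less.prems] by simp
    finally have "(- 1) ^ pos m * ((- 1) ^ pos m * g' (del (pos m) m)) = 0"
      using g[OF less.prems] g'(1)[OF mX] by (simp only: mult_zero_right)
    then show ?case by (simp only: sign_sign_mult)
  qed
  have "g' (del j c) = 0" if j: "j < N" for j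
  proof -
    obtain m' where m': "m' \<in> X" "lead m' j" "del j m' = del j c"
      using del_lead_ex[of c j] assms(2) j by blast
    show ?thesis
    proof (cases "j = pos m'")
      case True
      have "g' (del j m') = 0" using main[OF nonnormal[OF m'(1) j m'(2)]] unfolding True .
      then show ?thesis by (simp only: m'(3))
    next
      case False
      then have "(m', j) \<in> bad" using m' j by (simp add: bad_def)
      from g'(2)[OF this] show ?thesis by (simp only: m'(3))
    qed
  qed
  then have "face_sum g' c = 0" unfolding face_sum_def len[OF assms(2)] by (intro sum.neutral) simp
  then show ?thesis using g'(1)[OF assms(2)] by simp
qed

text \<open>Spanning: after matching \<open>f\<close> on the nonnormal chains by a face sum, the
  remainder lives on \<open>normal_chains\<close>. Independence: a primitive of a combination of
  normal chains has zero face sums on the nonnormal chains, hence on all of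
  \<open>X\<close>.\<close>

theorem coset_basis_normal_chains: "coset_basis (K :: 'k::comm_ring_1 itself) X normal_chains"
proof -
  have "\<exists>a. exact_on X (\<lambda>d. f d - (if d \<in> normal_chains then a d else 0))" for f :: "'a list \<Rightarrow> 'k"
  proof -
    obtain g where g: "\<forall>c\<in>X - normal_chains. f c = face_sum g c"
      using span_nonnormal[of f] by (elim exE)
    have "\<forall>c\<in>X. f c - (if c \<in> normal_chains then f c - face_sum g c else 0) = face_sum g c"
    proof
      fix c assume "c \<in> X"
      then show "f c - (if c \<in> normal_chains then f c - face_sum g c else 0) = face_sum g c"
        using bspec[OF g, of c] by (cases "c \<in> normal_chains") simp_all
    qed
    then have "exact_on X (\<lambda>d. f d - (if d \<in> normal_chains then f d - face_sum g d else 0))"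
      unfolding exact_on_def by (rule exI[of _ g])
    then show ?thesis by (rule exI[of _ "\<lambda>d. f d - face_sum g d"])
  qed
  moreover have "\<forall>d\<in>normal_chains. a d = 0"
    if "exact_on X (\<lambda>d. if d \<in> normal_chains then a d else 0)" for a :: "'a list \<Rightarrow> 'k"
  proof -
    from that obtain g where "\<forall>c\<in>X. (if c \<in> normal_chains then a c else 0) = face_sum g c"
      unfolding exact_on_def by (elim exE)
    then have g: "\<And>c. c \<in> X \<Longrightarrow> (if c \<in> normal_chains then a c else 0) = face_sum g c"
      by (rule bspec)
    have z: "face_sum g c = 0" if "c \<in> X - normal_chains" for c
    proof -
      have c: "c \<in> X" "c \<notin> normal_chains" using that by blast+
      show ?thesis using g[OF c(1)] c(2) by (simp only: if_False)
    qed
    have z': "face_sum g c = 0" if "c \<in> X" for c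
      using z that by (rule face_sum_zero)
    show ?thesis
    proof
      fix d assume d: "d \<in> normal_chains"
      then have "d \<in> X" using normal_sub by blast
      then show "a d = 0" using g[of d] z'[of d] d by (simp only: if_True)
    qed
  qed
  ultimately show ?thesis using normal_sub unfolding coset_basis_def by (intro conjI allI impI)
qed

end

section \<open>The order on weighted partitions\<close>

definition below :: "wpartition \<Rightarrow> nat set \<Rightarrow> wpartition" where
  "below \<alpha> B = {p \<in> \<alpha>. fst p \<subseteq> B}"

definition wsum :: "wpartition \<Rightarrow> nat set \<Rightarrow> nat" where
  "wsum \<alpha> B = (\<Sum>p\<in>below \<alpha> B. snd p)"

lemma weighted_partitions_iff:
  "\<alpha> \<in> weighted_partitions n \<longleftrightarrow>
    (\<forall>p\<in>\<alpha>. fst p \<noteq> {} \<and> fst p \<subseteq> {1..n} \<and> snd p < card (fst p)) \<and>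
    (\<forall>p\<in>\<alpha>. \<forall>q\<in>\<alpha>. p \<noteq> q \<longrightarrow> fst p \<inter> fst q = {}) \<and>
    {1..n} \<subseteq> (\<Union>p\<in>\<alpha>. fst p)" (is "?l \<longleftrightarrow> ?r")
proof
  assume l: ?l
  then have part: "partition_on {1..n} (fst ` \<alpha>)" and inj: "inj_on fst \<alpha>"
    and w: "\<And>p. p \<in> \<alpha> \<Longrightarrow> snd p \<le> card (fst p) - 1"
    by (auto simp: weighted_partitions_def)
  have 1: "fst p \<noteq> {}" "fst p \<subseteq> {1..n}" if "p \<in> \<alpha>" for p
  proof -
    have f: "fst p \<in> fst ` \<alpha>" using that by simp
    show "fst p \<noteq> {}" using f partition_onD3[OF part] by metis
    show "fst p \<subseteq> {1..n}" unfolding partition_onD1[OF part] using f by (rule Union_upper)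
  qed
  have 2: "snd p < card (fst p)" if "p \<in> \<alpha>" for p
    using w[OF that] 1[OF that] finite_subset[OF 1(2)[OF that]] card_gt_0_iff[of "fst p"] by auto
  have 3: "fst p \<inter> fst q = {}" if "p \<in> \<alpha>" "q \<in> \<alpha>" "p \<noteq> q" for p q
  proof -
    have "fst p \<noteq> fst q" using inj_onD[OF inj] that by blast
    then show ?thesis using partition_onD2[OF part] that by (simp add: disjointD)
  qed
  have 4: "{1..n} \<subseteq> (\<Union>p\<in>\<alpha>. fst p)" unfolding partition_onD1[OF part] by (rule order_refl)
  show ?r using 1 2 3 4 by (intro conjI ballI impI)
next
  assume r: ?r
  have "inj_on fst \<alpha>"
  proof (rule inj_onI)
    fix p q assume "p \<in> \<alpha>" "q \<in> \<alpha>" "fst p = fst q"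
    then show "p = q" using r by (metis Int_absorb)
  qed
  moreover have "partition_on {1..n} (fst ` \<alpha>)"
  proof (rule partition_onI)
    show "\<Union> (fst ` \<alpha>) = {1..n}" using r by blast
    show "disjnt A B" if AB: "A \<in> fst ` \<alpha>" "B \<in> fst ` \<alpha>" "A \<noteq> B" for A B
    proof -
      obtain p q where "p \<in> \<alpha>" "q \<in> \<alpha>" "A = fst p" "B = fst q" using AB by blast
      then show ?thesis using r AB(3) unfolding disjnt_def by metis
    qed
    show "{} \<notin> fst ` \<alpha>" using r by auto
  qed
  moreover have "\<forall>(B, v)\<in>\<alpha>. v \<in> {0..card B - 1}" using r by fastforce
  ultimately show ?l by (simp add: weighted_partitions_def)
qed

lemma wp_block:
  assumes "\<alpha> \<in> weighted_partitions n" "p \<in> \<alpha>"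
  shows "fst p \<noteq> {}" "fst p \<subseteq> {1..n}" "finite (fst p)" "snd p < card (fst p)"
  using assms unfolding weighted_partitions_iff by (auto intro: finite_subset)

lemma wp_disjoint:
  assumes "\<alpha> \<in> weighted_partitions n" "p \<in> \<alpha>" "q \<in> \<alpha>" "x \<in> fst p" "x \<in> fst q"
  shows "p = q"
  using assms unfolding weighted_partitions_iff by blast

lemma wp_cover:
  assumes "\<alpha> \<in> weighted_partitions n" "x \<in> {1..n}"
  obtains p where "p \<in> \<alpha>" "x \<in> fst p"
  using assms unfolding weighted_partitions_iff by blast

lemma finite_wp:
  assumes "\<alpha> \<in> weighted_partitions n"
  shows "finite \<alpha>"
proof -
  have "inj_on fst \<alpha>" using assms by (simp add: weighted_partitions_def)
  moreover have "fst ` \<alpha> \<subseteq> Pow {1..n}" using wp_block(2)[OF assms] by blast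
  ultimately show ?thesis by (meson finite_Pow_iff finite_atLeastAtMost finite_imageD finite_subset)
qed

lemma finite_weighted_partitions: "finite (weighted_partitions n)"
proof (rule finite_subset)
  show "weighted_partitions n \<subseteq> Pow (Pow {1..n} \<times> {..n})"
  proof
    fix \<alpha> assume \<alpha>: "\<alpha> \<in> weighted_partitions n"
    have "p \<in> Pow {1..n} \<times> {..n}" if "p \<in> \<alpha>" for p
    proof -
      have "card (fst p) \<le> n" using card_mono[OF _ wp_block(2)[OF \<alpha> that]] by simp
      then show ?thesis using wp_block[OF \<alpha> that] by (simp add: mem_Times_iff)
    qed
    then show "\<alpha> \<in> Pow (Pow {1..n} \<times> {..n})" by blast
  qed
qed simp

text \<open>The weights admissible for a block above \<open>\<alpha>\<close> form a half-open
  interval. Its lower end \<open>wsum\<close> and its length \<open>card (below ...)\<close> are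
  both additive over unions of blocks, which is what the later arguments exploit.\<close>

lemma wp_le_iff:
  assumes \<alpha>: "\<alpha> \<in> weighted_partitions n" and \<beta>: "\<beta> \<in> weighted_partitions n"
  shows "wp_le n \<alpha> \<beta> \<longleftrightarrow> (\<forall>p\<in>\<alpha>. \<exists>q\<in>\<beta>. fst p \<subseteq> fst q) \<and>
    (\<forall>q\<in>\<beta>. wsum \<alpha> (fst q) \<le> snd q \<and> snd q < wsum \<alpha> (fst q) + card (below \<alpha> (fst q)))"
proof -
  have "refines {1..n} (fst ` \<alpha>) (fst ` \<beta>) \<longleftrightarrow> (\<forall>p\<in>\<alpha>. \<exists>q\<in>\<beta>. fst p \<subseteq> fst q)"
    using assms by (auto simp: refines_def weighted_partitions_def)
  moreover have "(int v - (\<Sum>(A, w)\<in>{p \<in> \<alpha>. fst p \<subseteq> B}. int w) \<in> {0..int (card {p \<in> \<alpha>. fst p \<subseteq> B}) - 1})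
     \<longleftrightarrow> wsum \<alpha> B \<le> v \<and> v < wsum \<alpha> B + card (below \<alpha> B)" for B v
    by (auto simp: wsum_def below_def case_prod_beta simp flip: of_nat_sum of_nat_add)
  ultimately show ?thesis unfolding wp_le_def by (simp add: case_prod_beta)
qed

lemma below_self:
  assumes "\<alpha> \<in> weighted_partitions n" "p \<in> \<alpha>"
  shows "below \<alpha> (fst p) = {p}" "wsum \<alpha> (fst p) = snd p"
proof -
  have "q = p" if q: "q \<in> \<alpha>" "fst q \<subseteq> fst p" for q
  proof -
    obtain x where "x \<in> fst q" using wp_block(1)[OF assms(1) q(1)] by blast
    then show ?thesis using wp_disjoint[OF assms(1) q(1) assms(2)] q(2) by blast
  qed
  then show "below \<alpha> (fst p) = {p}" using assms(2) by (auto simp: below_def)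
  then show "wsum \<alpha> (fst p) = snd p" by (simp add: wsum_def)
qed

lemma wp_le_refl:
  assumes "\<alpha> \<in> weighted_partitions n"
  shows "wp_le n \<alpha> \<alpha>"
  using assms by (auto simp: wp_le_iff below_self)

lemma below_block:
  assumes "\<alpha> \<in> weighted_partitions n" "\<beta> \<in> weighted_partitions n" "wp_le n \<alpha> \<beta>" "p \<in> \<alpha>" "q \<in> \<beta>"
    "x \<in> fst p" "x \<in> fst q"
  shows "fst p \<subseteq> fst q"
proof -
  obtain q' where "q' \<in> \<beta>" "fst p \<subseteq> fst q'" using assms wp_le_iff by blast
  moreover then have "q' = q" using wp_disjoint[OF assms(2)] assms by blast
  ultimately show ?thesis by simp
qed

lemma Union_below:
  assumes "\<alpha> \<in> weighted_partitions n" "\<beta> \<in> weighted_partitions n" "wp_le n \<alpha> \<beta>" "q \<in> \<beta>"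
  shows "(\<Union>p\<in>below \<alpha> (fst q). fst p) = fst q"
proof
  show "fst q \<subseteq> (\<Union>p\<in>below \<alpha> (fst q). fst p)"
  proof
    fix x assume x: "x \<in> fst q"
    then obtain p where p: "p \<in> \<alpha>" "x \<in> fst p" using wp_cover[OF assms(1)] wp_block(2)[OF assms(2,4)] by blast
    then have "p \<in> below \<alpha> (fst q)" using below_block[OF assms(1-3) p(1) assms(4) p(2) x] by (simp add: below_def)
    then show "x \<in> (\<Union>p\<in>below \<alpha> (fst q). fst p)" using p by blast
  qed
qed (auto simp: below_def)

lemma below_Union:
  assumes "\<alpha> \<in> weighted_partitions n" "finite I"
    and "\<And>p. p \<in> \<alpha> \<Longrightarrow> fst p \<subseteq> C \<Longrightarrow> \<exists>i\<in>I. fst p \<subseteq> B i"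
    and "\<And>i. i \<in> I \<Longrightarrow> B i \<subseteq> C"
    and "\<And>i j. i \<in> I \<Longrightarrow> j \<in> I \<Longrightarrow> i \<noteq> j \<Longrightarrow> B i \<inter> B j = {}"
  shows "wsum \<alpha> C = (\<Sum>i\<in>I. wsum \<alpha> (B i))" "card (below \<alpha> C) = (\<Sum>i\<in>I. card (below \<alpha> (B i)))"
proof -
  have eq: "below \<alpha> C = (\<Union>i\<in>I. below \<alpha> (B i))"
    using assms(3,4) by (fastforce simp: below_def)
  have fin: "\<forall>i\<in>I. finite (below \<alpha> (B i))" using finite_wp[OF assms(1)] by (simp add: below_def)
  have disj: "below \<alpha> (B i) \<inter> below \<alpha> (B j) = {}" if "i \<in> I" "j \<in> I" "i \<noteq> j" for i j
    using assms(5)[OF that] wp_block(1)[OF assms(1)] by (fastforce simp: below_def)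
  show "wsum \<alpha> C = (\<Sum>i\<in>I. wsum \<alpha> (B i))"
    unfolding wsum_def eq using assms(2) fin disj by (intro sum.UNION_disjoint) blast+
  show "card (below \<alpha> C) = (\<Sum>i\<in>I. card (below \<alpha> (B i)))"
    unfolding eq using assms(2) fin disj by (intro card_UN_disjoint) blast+
qed

lemma below_Un:
  assumes "\<alpha> \<in> weighted_partitions n" "L \<inter> R = {}" "L \<noteq> {}"
    and "\<And>p. p \<in> \<alpha> \<Longrightarrow> fst p \<subseteq> L \<union> R \<Longrightarrow> fst p \<subseteq> L \<or> fst p \<subseteq> R"
  shows "wsum \<alpha> (L \<union> R) = wsum \<alpha> L + wsum \<alpha> R"
    "card (below \<alpha> (L \<union> R)) = card (below \<alpha> L) + card (below \<alpha> R)"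
proof -
  have "L \<noteq> R" using assms by blast
  then show "wsum \<alpha> (L \<union> R) = wsum \<alpha> L + wsum \<alpha> R"
    "card (below \<alpha> (L \<union> R)) = card (below \<alpha> L) + card (below \<alpha> R)"
    using below_Union[OF assms(1), of "{L, R}" "L \<union> R" "\<lambda>x. x"] assms by auto
qed

lemma below_refine:
  assumes "\<alpha> \<in> weighted_partitions n" "\<beta> \<in> weighted_partitions n" "wp_le n \<alpha> \<beta>"
    and "\<And>q x. q \<in> \<beta> \<Longrightarrow> x \<in> fst q \<Longrightarrow> x \<in> C \<Longrightarrow> fst q \<subseteq> C"
  shows "wsum \<alpha> C = (\<Sum>q\<in>below \<beta> C. wsum \<alpha> (fst q))"
    "card (below \<alpha> C) = (\<Sum>q\<in>below \<beta> C. card (below \<alpha> (fst q)))"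
proof -
  have 1: "\<exists>q\<in>below \<beta> C. fst p \<subseteq> fst q" if p: "p \<in> \<alpha>" "fst p \<subseteq> C" for p
  proof -
    obtain q where q: "q \<in> \<beta>" "fst p \<subseteq> fst q" using assms(1-3) wp_le_iff p by blast
    obtain x where "x \<in> fst p" using wp_block(1)[OF assms(1) p(1)] by blast
    then have "fst q \<subseteq> C" using assms(4)[OF q(1), of x] q p by blast
    then have "q \<in> below \<beta> C" using q by (simp add: below_def)
    then show ?thesis using q by blast
  qed
  have 2: "fst q \<inter> fst q' = {}" if "q \<in> below \<beta> C" "q' \<in> below \<beta> C" "q \<noteq> q'" for q q'
    using wp_disjoint[OF assms(2), of q q'] that unfolding below_def by blast
  have 3: "finite (below \<beta> C)" using finite_wp[OF assms(2)] by (simp add: below_def)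
  show "wsum \<alpha> C = (\<Sum>q\<in>below \<beta> C. wsum \<alpha> (fst q))"
    "card (below \<alpha> C) = (\<Sum>q\<in>below \<beta> C. card (below \<alpha> (fst q)))"
  proof -
    have 4: "fst q \<subseteq> C" if "q \<in> below \<beta> C" for q using that by (simp add: below_def)
    show "wsum \<alpha> C = (\<Sum>q\<in>below \<beta> C. wsum \<alpha> (fst q))"
      by (rule below_Union(1)[OF assms(1) 3 1 4 2])
    show "card (below \<alpha> C) = (\<Sum>q\<in>below \<beta> C. card (below \<alpha> (fst q)))"
      by (rule below_Union(2)[OF assms(1) 3 1 4 2])
  qed
qed

text \<open>Inside a fixed block of \<open>\<gamma>\<close>, the total weight can only grow on
  passing from \<open>\<alpha>\<close> to \<open>\<beta>\<close>, while total weight plus number of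
  blocks can only shrink. The interval of admissible weights computed from \<open>\<beta>\<close>
  therefore lies inside the one computed from \<open>\<alpha>\<close>.\<close>

lemma wp_le_trans:
  assumes W: "\<alpha> \<in> weighted_partitions n" "\<beta> \<in> weighted_partitions n" "\<gamma> \<in> weighted_partitions n"
    and le: "wp_le n \<alpha> \<beta>" "wp_le n \<beta> \<gamma>"
  shows "wp_le n \<alpha> \<gamma>"
  unfolding wp_le_iff[OF W(1,3)]
proof (intro conjI ballI)
  fix p assume "p \<in> \<alpha>"
  then obtain q where "q \<in> \<beta>" "fst p \<subseteq> fst q" using le(1) W wp_le_iff by blast
  moreover then obtain r where "r \<in> \<gamma>" "fst q \<subseteq> fst r" using le(2) W wp_le_iff by blast
  ultimately show "\<exists>q\<in>\<gamma>. fst p \<subseteq> fst q" by blast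
next
  fix r assume r: "r \<in> \<gamma>"
  let ?C = "fst r"
  have sub: "fst q \<subseteq> ?C" if "q \<in> \<beta>" "x \<in> fst q" "x \<in> ?C" for q x
    using below_block[OF W(2,3) le(2) that(1) r that(2,3)] .
  have eqs: "wsum \<alpha> ?C = (\<Sum>q\<in>below \<beta> ?C. wsum \<alpha> (fst q))"
    "card (below \<alpha> ?C) = (\<Sum>q\<in>below \<beta> ?C. card (below \<alpha> (fst q)))"
    by (rule below_refine(1)[OF W(1,2) le(1)], erule (2) sub)
       (rule below_refine(2)[OF W(1,2) le(1)], erule (2) sub)
  have fin: "finite (below \<beta> ?C)" using finite_wp[OF W(2)] by (simp add: below_def)
  have q: "wsum \<alpha> (fst q) \<le> snd q \<and> snd q < wsum \<alpha> (fst q) + card (below \<alpha> (fst q))" if "q \<in> below \<beta> ?C" for q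
    using le(1) wp_le_iff[OF W(1,2)] that by (simp add: below_def)
  have "wsum \<alpha> ?C \<le> wsum \<beta> ?C" unfolding eqs wsum_def[of \<beta>] by (intro sum_mono) (use q in blast)
  moreover have "wsum \<beta> ?C + card (below \<beta> ?C) \<le> wsum \<alpha> ?C + card (below \<alpha> ?C)"
  proof -
    have "wsum \<beta> ?C + card (below \<beta> ?C) = (\<Sum>q\<in>below \<beta> ?C. snd q + 1)"
      unfolding wsum_def[of \<beta>] sum.distrib by simp
    also have "\<dots> \<le> (\<Sum>q\<in>below \<beta> ?C. wsum \<alpha> (fst q) + card (below \<alpha> (fst q)))"
      by (intro sum_mono) (use q in fastforce)
    finally show ?thesis unfolding eqs by (simp only: sum.distrib)
  qed
  moreover have "wsum \<beta> (fst r) \<le> snd r \<and> snd r < wsum \<beta> (fst r) + card (below \<beta> (fst r))"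
    using le(2) r wp_le_iff[OF W(2,3)] by blast
  ultimately show "wsum \<alpha> (fst r) \<le> snd r" "snd r < wsum \<alpha> (fst r) + card (below \<alpha> (fst r))"
    by linarith+
qed

lemma card_below_pos:
  assumes "\<alpha> \<in> weighted_partitions n" "\<beta> \<in> weighted_partitions n" "wp_le n \<alpha> \<beta>" "q \<in> \<beta>"
  shows "card (below \<alpha> (fst q)) \<ge> 1"
proof -
  have "wsum \<alpha> (fst q) \<le> snd q \<and> snd q < wsum \<alpha> (fst q) + card (below \<alpha> (fst q))"
    using assms(3,4) wp_le_iff[OF assms(1,2)] by blast
  then show ?thesis by linarith
qed

lemma card_eq_sum_below:
  assumes "\<alpha> \<in> weighted_partitions n" "\<beta> \<in> weighted_partitions n" "wp_le n \<alpha> \<beta>"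
  shows "card \<alpha> = (\<Sum>q\<in>\<beta>. card (below \<alpha> (fst q)))"
proof -
  have "card (below \<alpha> UNIV) = (\<Sum>q\<in>below \<beta> UNIV. card (below \<alpha> (fst q)))"
    by (rule below_refine(2)[OF assms]) (rule subset_UNIV)
  then show ?thesis by (simp add: below_def)
qed

lemma block_of_card_one:
  assumes "\<alpha> \<in> weighted_partitions n" "\<beta> \<in> weighted_partitions n" "wp_le n \<alpha> \<beta>" "q \<in> \<beta>"
    "card (below \<alpha> (fst q)) = 1"
  shows "q \<in> \<alpha>"
proof -
  obtain p where p: "below \<alpha> (fst q) = {p}" using assms(5) by (auto simp: card_1_singleton_iff)
  then have "fst p = fst q" using Union_below[OF assms(1-4)] by simp
  moreover have "wsum \<alpha> (fst q) \<le> snd q \<and> snd q < wsum \<alpha> (fst q) + card (below \<alpha> (fst q))"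
    using assms(3,4) wp_le_iff[OF assms(1,2)] by blast
  then have "snd p = snd q" using p by (simp add: wsum_def)
  ultimately have "p = q" by (simp add: prod_eq_iff)
  moreover have "p \<in> \<alpha>" using p by (auto simp: below_def)
  ultimately show ?thesis by simp
qed

lemma sum_eq_card_imp_one:
  fixes f :: "'a \<Rightarrow> nat"
  assumes "finite A" "\<And>x. x \<in> A \<Longrightarrow> 1 \<le> f x" "sum f A = card A" "x \<in> A"
  shows "f x = 1"
proof -
  have "(\<Sum>y\<in>A - {x}. 1) \<le> sum f (A - {x})" using assms(2) by (intro sum_mono) simp
  moreover have "sum f A = f x + sum f (A - {x})" using assms(1,4) by (rule sum.remove)
  moreover have "card A = Suc (card (A - {x}))" using assms(1,4) by (rule card.remove)
  ultimately show ?thesis using assms(2)[OF assms(4)] assms(3) by simp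
qed

text \<open>Each block of \<open>\<beta>\<close> contains at least one block of
  \<open>\<alpha>\<close>. If the numbers agree, each contains exactly one, and then the interval of
  admissible weights is a single point, so weights agree as well.\<close>

lemma wp_le_card:
  assumes "\<alpha> \<in> weighted_partitions n" "\<beta> \<in> weighted_partitions n" "wp_le n \<alpha> \<beta>"
  shows "card \<beta> \<le> card \<alpha>" "card \<alpha> = card \<beta> \<Longrightarrow> \<alpha> = \<beta>"
proof -
  have fin: "finite \<beta>" using finite_wp[OF assms(2)] .
  have pos: "1 \<le> card (below \<alpha> (fst q))" if "q \<in> \<beta>" for q using card_below_pos[OF assms that] .
  have "(\<Sum>q\<in>\<beta>. 1) \<le> (\<Sum>q\<in>\<beta>. card (below \<alpha> (fst q)))" by (intro sum_mono) (use pos in blast)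
  then show "card \<beta> \<le> card \<alpha>" using card_eq_sum_below[OF assms] by simp
  assume eq: "card \<alpha> = card \<beta>"
  have "card (below \<alpha> (fst q)) = 1" if q: "q \<in> \<beta>" for q
    by (rule sum_eq_card_imp_one[OF fin pos _ q]) (simp_all add: card_eq_sum_below[OF assms, symmetric] eq)
  then have "\<beta> \<subseteq> \<alpha>" using block_of_card_one[OF assms] by blast
  then show "\<alpha> = \<beta>" using card_subset_eq[OF finite_wp[OF assms(1)], of \<beta>] eq by simp
qed

lemma wp_le_antisym_card:
  assumes "\<alpha> \<in> weighted_partitions n" "\<beta> \<in> weighted_partitions n" "wp_le n \<alpha> \<beta>" "\<alpha> \<noteq> \<beta>"
  shows "card \<beta> < card \<alpha>"
  using wp_le_card[OF assms(1-3)] assms(4) by linarith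

lemma Min_less_cases:
  fixes A B :: "nat set"
  assumes "finite A" "finite B" "A \<noteq> {}" "B \<noteq> {}" "A \<inter> B = {}"
  shows "Min A < Min B \<or> Min B < Min A"
proof -
  have "Min A \<in> A" "Min B \<in> B" using assms by auto
  then have "Min A \<noteq> Min B" using assms(5) by (metis IntI empty_iff)
  then show ?thesis by linarith
qed

text \<open>The counts of blocks of \<open>\<alpha>\<close> inside blocks of \<open>\<beta>\<close>
  are positive and sum to one more than the number of blocks of \<open>\<beta>\<close>. Hence
  exactly one block contains two, and the weight left over there is the colour
  \<open>u\<close>.\<close>

lemma wp_cover_relation:
  assumes W: "\<alpha> \<in> weighted_partitions n" "\<beta> \<in> weighted_partitions n" and le: "wp_le n \<alpha> \<beta>"
    and card: "card \<alpha> = Suc (card \<beta>)"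
  obtains L a R b u where "(L \<union> R, a + b + u) \<in> \<beta>" "L \<inter> R = {}" "L \<noteq> {}" "R \<noteq> {}" "Min L < Min R"
    "u \<le> 1" "\<alpha> = \<beta> - {(L \<union> R, a + b + u)} \<union> {(L, a), (R, b)}"
proof -
  have fin: "finite \<beta>" using finite_wp[OF W(2)] .
  have pos: "1 \<le> card (below \<alpha> (fst q))" if "q \<in> \<beta>" for q using card_below_pos[OF W le that] .
  have "\<exists>q\<in>\<beta>. card (below \<alpha> (fst q)) \<noteq> 1"
  proof (rule ccontr)
    assume "\<not> ?thesis"
    then show False using card_eq_sum_below[OF W le] card by simp
  qed
  then obtain q where q: "q \<in> \<beta>" "card (below \<alpha> (fst q)) \<noteq> 1" by blast
  have sum: "card \<alpha> = card (below \<alpha> (fst q)) + (\<Sum>q\<in>\<beta> - {q}. card (below \<alpha> (fst q)))"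
    using card_eq_sum_below[OF W le] sum.remove[OF fin q(1)] by simp
  have ge: "(\<Sum>r\<in>\<beta> - {q}. 1) \<le> (\<Sum>r\<in>\<beta> - {q}. card (below \<alpha> (fst r)))"
    by (intro sum_mono) (use pos in blast)
  have cardq: "card \<beta> = Suc (card (\<beta> - {q}))" using fin q(1) by (rule card.remove)
  have two: "card (below \<alpha> (fst q)) = 2" using sum ge cardq card pos[OF q(1)] q(2) by simp
  have rest: "r \<in> \<alpha>" if r: "r \<in> \<beta> - {q}" for r
  proof -
    have "card (below \<alpha> (fst r)) = 1"
    proof (rule sum_eq_card_imp_one[of "\<beta> - {q}"])
      show "(\<Sum>r\<in>\<beta> - {q}. card (below \<alpha> (fst r))) = card (\<beta> - {q})"
        using sum two cardq card by simp
    qed (use fin r pos in simp_all)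
    then show ?thesis using block_of_card_one[OF W le] r by blast
  qed
  obtain p1 p2 where p12: "below \<alpha> (fst q) = {p1, p2}" "p1 \<noteq> p2" using two by (auto simp: card_2_iff)
  have p: "p1 \<in> \<alpha>" "p2 \<in> \<alpha>" using p12 by (auto simp: below_def)
  have disj: "fst p1 \<inter> fst p2 = {}" using wp_disjoint[OF W(1) p] p12(2) by blast
  obtain P Q where PQ: "{P, Q} = {p1, p2}" "Min (fst P) < Min (fst Q)" "fst P \<inter> fst Q = {}" "P \<in> \<alpha>" "Q \<in> \<alpha>" "P \<noteq> Q"
  proof -
    have "Min (fst p1) < Min (fst p2) \<or> Min (fst p2) < Min (fst p1)"
      using disj wp_block(1,3)[OF W(1)] p by (intro Min_less_cases) auto
    then show ?thesis
    proof
      assume "Min (fst p1) < Min (fst p2)"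
      then show ?thesis using that[of p1 p2] disj p p12(2) by simp
    next
      assume "Min (fst p2) < Min (fst p1)"
      then show ?thesis using that[of p2 p1] disj p p12(2) by (simp add: insert_commute Int_commute)
    qed
  qed
  have bel: "below \<alpha> (fst q) = {P, Q}" using p12 PQ by simp
  have un: "fst q = fst P \<union> fst Q" using Union_below[OF W le q(1)] bel by simp
  have ws: "wsum \<alpha> (fst q) = snd P + snd Q" using bel PQ(6) by (simp add: wsum_def)
  have w: "snd P + snd Q \<le> snd q" "snd q < snd P + snd Q + 2"
  proof -
    have "wsum \<alpha> (fst q) \<le> snd q \<and> snd q < wsum \<alpha> (fst q) + card (below \<alpha> (fst q))"
      using le q(1) wp_le_iff[OF W] by blast
    then show "snd P + snd Q \<le> snd q" "snd q < snd P + snd Q + 2" using ws two by simp_all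
  qed
  define u where "u = snd q - (snd P + snd Q)"
  have qe: "q = (fst P \<union> fst Q, snd P + snd Q + u)" using un w by (simp add: u_def prod_eq_iff)
  have "\<alpha> = \<beta> - {q} \<union> {P, Q}"
  proof
    show "\<beta> - {q} \<union> {P, Q} \<subseteq> \<alpha>" using rest PQ by blast
    show "\<alpha> \<subseteq> \<beta> - {q} \<union> {P, Q}"
    proof
      fix s assume s: "s \<in> \<alpha>"
      then obtain r where r: "r \<in> \<beta>" "fst s \<subseteq> fst r" using le wp_le_iff[OF W] by blast
      show "s \<in> \<beta> - {q} \<union> {P, Q}"
      proof (cases "r = q")
        case True
        then show ?thesis using bel s r by (auto simp: below_def)
      next
        case False
        then have "r \<in> \<alpha>" using rest r by blast
        then have "below \<alpha> (fst r) = {r}" by (rule below_self[OF W(1)])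
        moreover have "s \<in> below \<alpha> (fst r)" using s r by (simp add: below_def)
        ultimately have "s = r" by simp
        then show ?thesis using False r by simp
      qed
    qed
  qed
  moreover have "u \<le> 1" using w by (simp add: u_def)
  ultimately show ?thesis
    using that[of "fst P" "fst Q" "snd P" "snd Q" u] q(1) PQ wp_block(1)[OF W(1)] unfolding qe by simp
qed

section \<open>Splitting ordered partitions\<close>

text \<open>Chains are read from the top. The blocks of a weighted partition are listed in a plane order
  that depends on the part of the chain above it: a block is split in place into two blocks, the one
  with the smaller minimum on the left.\<close>

type_synonym ostate = "(nat set \<times> nat) list"

definition state :: "nat \<Rightarrow> ostate \<Rightarrow> bool" where
  "state n S \<longleftrightarrow> distinct S \<and> set S \<in> weighted_partitions n"

text \<open>The inverse of a \<open>u\<close>-merge performed at position \<open>p\<close>;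
  \<open>u = 0\<close> is a blue node and \<open>u = 1\<close> a red one.\<close>

definition splits :: "nat \<Rightarrow> nat \<Rightarrow> ostate \<Rightarrow> ostate \<Rightarrow> bool" where
  "splits p u S S' \<longleftrightarrow> (\<exists>xs ys L a R b. S = xs @ (L \<union> R, a + b + u) # ys \<and> S' = xs @ (L, a) # (R, b) # ys \<and>
    p = length xs \<and> L \<inter> R = {} \<and> L \<noteq> {} \<and> R \<noteq> {} \<and> Min L < Min R \<and> u \<le> 1)"

text \<open>Position and colour are recovered from the two lists alone. The lists first differ where
  \<open>L \<union> R\<close> is replaced by \<open>L\<close>, as \<open>R\<close> is nonempty, and
  the colour is the weight missing from the two parts.\<close>

definition split_pos :: "ostate \<Rightarrow> ostate \<Rightarrow> nat" where
  "split_pos S S' = (LEAST i. S ! i \<noteq> S' ! i)"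

definition split_col :: "ostate \<Rightarrow> ostate \<Rightarrow> nat" where
  "split_col S S' = (let p = split_pos S S' in snd (S ! p) - snd (S' ! p) - snd (S' ! Suc p))"

lemma splitsI:
  "\<lbrakk>L \<inter> R = {}; L \<noteq> {}; R \<noteq> {}; Min L < Min R; u \<le> 1; p = length xs; B = L \<union> R; v = a + b + u\<rbrakk> \<Longrightarrow>
    splits p u (xs @ (B, v) # ys) (xs @ (L, a) # (R, b) # ys)"
  unfolding splits_def by blast

lemma splitsE:
  assumes "splits p u S S'"
  obtains xs ys L a R b where "S = xs @ (L \<union> R, a + b + u) # ys" "S' = xs @ (L, a) # (R, b) # ys"
    "p = length xs" "L \<inter> R = {}" "L \<noteq> {}" "R \<noteq> {}" "Min L < Min R" "u \<le> 1"
  using assms unfolding splits_def by blast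

lemma split_pos_col:
  assumes "splits p u S S'"
  shows "split_pos S S' = p" "split_col S S' = u"
proof -
  obtain xs ys L a R b where e: "S = xs @ (L \<union> R, a + b + u) # ys" "S' = xs @ (L, a) # (R, b) # ys"
    "p = length xs" "L \<inter> R = {}" "R \<noteq> {}"
    using assms by (rule splitsE)
  have "S ! p \<noteq> S' ! p" using e by auto
  moreover have "\<not> S ! i \<noteq> S' ! i" if "i < p" for i using that e by (simp add: nth_append)
  ultimately show 1: "split_pos S S' = p"
    unfolding split_pos_def by (intro Least_equality) (auto simp: not_less[symmetric])
  have "S' ! Suc (length xs) = (R, b)" using e(2) by (simp add: nth_append)
  then show "split_col S S' = u" unfolding split_col_def 1 Let_def using e(1-3) by simp
qed

lemma length_splits: "splits p u S S' \<Longrightarrow> length S' = Suc (length S) \<and> p < length S"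
  by (elim splitsE) simp

lemma state_blocks:
  assumes "state n S"
  shows "p \<in> set S \<Longrightarrow> fst p \<noteq> {}" "p \<in> set S \<Longrightarrow> fst p \<subseteq> {1..n}" "p \<in> set S \<Longrightarrow> finite (fst p)"
    "p \<in> set S \<Longrightarrow> snd p < card (fst p)" "finite (set S)"
    "p \<in> set S \<Longrightarrow> q \<in> set S \<Longrightarrow> x \<in> fst p \<Longrightarrow> x \<in> fst q \<Longrightarrow> p = q"
  using assms wp_block[of "set S" n p] wp_disjoint[of "set S" n p q x] by (auto simp: state_def)

lemma state_card: "state n S \<Longrightarrow> card (set S) = length S"
  by (simp add: state_def distinct_card)

lemma stateI: "set S \<in> weighted_partitions n \<Longrightarrow> length S = card (set S) \<Longrightarrow> state n S"
  by (simp add: state_def card_distinct)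

text \<open>Validity passes from the finer list to the coarser one. The weight bound survives
  because two strict bounds leave room for the extra \<open>u\<close>, which is at most 1.\<close>

lemma splits_state:
  assumes sp: "splits p u S S'" and st: "state n S'"
  shows "state n S" "wp_le n (set S') (set S)"
proof -
  obtain xs ys L a R b where e: "S = xs @ (L \<union> R, a + b + u) # ys" "S' = xs @ (L, a) # (R, b) # ys"
    "p = length xs" "L \<inter> R = {}" "L \<noteq> {}" "R \<noteq> {}" "Min L < Min R" "u \<le> 1"
    using sp by (rule splitsE)
  have W': "set S' \<in> weighted_partitions n" and d': "distinct S'" using st by (auto simp: state_def)
  have L: "(L, a) \<in> set S'" and R: "(R, b) \<in> set S'" using e by auto
  note bl = wp_block[OF W']
  have other: "(fst q \<inter> (L \<union> R) = {})" if q: "q \<in> set xs \<union> set ys" for q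
  proof -
    have "q \<in> set S'" "q \<noteq> (L, a)" "q \<noteq> (R, b)" using q d' e by auto
    then show ?thesis using wp_disjoint[OF W' _ L, of q] wp_disjoint[OF W' _ R, of q] by (metis Int_Un_distrib Un_empty disjoint_iff fst_conv)
  qed
  have setS: "set S = insert (L \<union> R, a + b + u) (set xs \<union> set ys)"
    and setS': "set S' = insert (L, a) (insert (R, b) (set xs \<union> set ys))" using e by auto
  have card: "card (L \<union> R) = card L + card R"
    using e bl(3)[OF L] bl(3)[OF R] by (intro card_Un_disjoint) auto
  have w: "a + b + u < card (L \<union> R)" using bl(4)[OF L] bl(4)[OF R] card e(8) by simp
  have W: "set S \<in> weighted_partitions n"
    unfolding weighted_partitions_iff
  proof (intro conjI ballI impI)
    have mem: "q = (L \<union> R, a + b + u) \<or> q \<in> set S'" if "q \<in> set S" for q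
      using that unfolding setS setS' by blast
    show "fst q \<noteq> {}" if "q \<in> set S" for q using mem[OF that] bl(1)[of q] e(5) by auto
    have "L \<subseteq> {1..n}" "R \<subseteq> {1..n}" using bl(2)[OF L] bl(2)[OF R] by simp_all
    then show "fst q \<subseteq> {1..n}" if "q \<in> set S" for q
      using mem[OF that] bl(2)[of q] by (metis Un_least fst_conv)
    show "snd q < card (fst q)" if "q \<in> set S" for q using mem[OF that] bl(4)[of q] w by auto
    show "fst q \<inter> fst r = {}" if "q \<in> set S" "r \<in> set S" "q \<noteq> r" for q r
    proof -
      consider "q \<in> set xs \<union> set ys" "r \<in> set xs \<union> set ys" | "q = (L \<union> R, a + b + u)" "r \<in> set xs \<union> set ys"
        | "r = (L \<union> R, a + b + u)" "q \<in> set xs \<union> set ys"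
        using \<open>q \<in> set S\<close> \<open>r \<in> set S\<close> \<open>q \<noteq> r\<close> unfolding setS by (metis insertE)
      then show ?thesis
      proof cases
        case 1
        then have "q \<in> set S'" "r \<in> set S'" unfolding setS' by auto
        then show ?thesis using wp_disjoint[OF W'] that(3) by blast
      next
        case 2 then show ?thesis using other[of r] by auto
      next
        case 3 then show ?thesis using other[of q] by auto
      qed
    qed
    show "{1..n} \<subseteq> (\<Union>p\<in>set S. fst p)"
    proof
      fix x assume "x \<in> {1..n}"
      then obtain q where q: "q \<in> set S'" "x \<in> fst q" using wp_cover[OF W'] by metis
      then show "x \<in> (\<Union>p\<in>set S. fst p)" unfolding setS setS' by auto
    qed
  qed
  have "(L \<union> R, a + b + u) \<notin> set xs \<union> set ys" using other e(5) by force
  then have "distinct S" using d' e by auto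
  then show st: "state n S" using W by (simp add: state_def)
  show "wp_le n (set S') (set S)"
    unfolding wp_le_iff[OF W' W]
  proof (intro conjI ballI)
    show "\<exists>r\<in>set S. fst q \<subseteq> fst r" if "q \<in> set S'" for q
      using that unfolding setS setS' by auto
    fix r assume r: "r \<in> set S"
    have *: "wsum (set S') (fst r) \<le> snd r \<and> snd r < wsum (set S') (fst r) + card (below (set S') (fst r))"
    proof (cases "r = (L \<union> R, a + b + u)")
      case True
      have sep: "fst q \<subseteq> L \<or> fst q \<subseteq> R" if "q \<in> set S'" "fst q \<subseteq> L \<union> R" for q
      proof -
        have "fst q \<noteq> {}" using bl(1) that by blast
        then have "q \<notin> set xs \<union> set ys" using other[of q] that by blast
        then show ?thesis using that unfolding setS' by auto
      qed
      show ?thesis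
        using below_Un[OF W' e(4,5) sep] below_self[OF W' L] below_self[OF W' R] True e(8) by simp
    next
      case False
      then have "r \<in> set S'" using r unfolding setS setS' by simp
      then show ?thesis using below_self[OF W'] by simp
    qed
    then show "wsum (set S') (fst r) \<le> snd r" "snd r < wsum (set S') (fst r) + card (below (set S') (fst r))"
      by simp_all
  qed
qed

lemma splits_cover:
  assumes st: "state n S" and W: "\<alpha> \<in> weighted_partitions n" and le: "wp_le n \<alpha> (set S)"
    and card: "card \<alpha> = Suc (length S)"
  obtains p u S' where "splits p u S S'" "set S' = \<alpha>" "state n S'"
proof -
  have WS: "set S \<in> weighted_partitions n" using st by (simp add: state_def)
  obtain L a R b u where c: "(L \<union> R, a + b + u) \<in> set S" "L \<inter> R = {}" "L \<noteq> {}" "R \<noteq> {}" "Min L < Min R"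
    "u \<le> 1" "\<alpha> = set S - {(L \<union> R, a + b + u)} \<union> {(L, a), (R, b)}"
    using wp_cover_relation[OF W WS le] card state_card[OF st] by metis
  obtain xs ys where S: "S = xs @ (L \<union> R, a + b + u) # ys" using c(1) by (meson split_list)
  let ?S' = "xs @ (L, a) # (R, b) # ys"
  have sp: "splits (length xs) u S ?S'" unfolding S using c by (intro splitsI) auto
  have "set ?S' = \<alpha>" unfolding c(7) S using st by (auto simp: state_def S)
  moreover then have "state n ?S'" using W card S by (intro stateI) auto
  ultimately show ?thesis using that sp by blast
qed

text \<open>The split block is the only one missing from the finer set, and its two parts are
  ordered by their minima. So below a given ordered list the order of each finer partition is
  forced.\<close>

lemma splits_unique:
  assumes "state n S'" "state n S''" "splits p u S S'" "splits p' u' S S''" "set S' = set S''"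
  shows "S' = S''"
proof -
  obtain xs ys L a R b where e: "S = xs @ (L \<union> R, a + b + u) # ys" "S' = xs @ (L, a) # (R, b) # ys"
    "p = length xs" "L \<inter> R = {}" "L \<noteq> {}" "R \<noteq> {}" "Min L < Min R" "u \<le> 1"
    using assms(3) by (rule splitsE)
  obtain xs' ys' L' a' R' b' where e': "S = xs' @ (L' \<union> R', a' + b' + u') # ys'" "S'' = xs' @ (L', a') # (R', b') # ys'"
    "p' = length xs'" "L' \<inter> R' = {}" "L' \<noteq> {}" "R' \<noteq> {}" "Min L' < Min R'" "u' \<le> 1"
    using assms(4) by (rule splitsE)
  have st: "state n S" by (rule splits_state(1)[OF assms(3,1)])
  have dist: "distinct S" using st by (simp add: state_def)
  note fn = state_blocks(3)[OF assms(1)]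
  have mem: "(L, a) \<in> set S'" "(R, b) \<in> set S'" using e(2) by simp_all
  have mem': "(L', a') \<in> set S'" "(R', b') \<in> set S'" unfolding assms(5) using e'(2) by simp_all
  have "(L \<union> R, a + b + u) \<notin> set S'"
  proof
    assume "(L \<union> R, a + b + u) \<in> set S'"
    moreover obtain x where x: "x \<in> R" using e(6) by blast
    ultimately have "(L \<union> R, a + b + u) = (R, b)"
      by (intro state_blocks(6)[OF assms(1) _ mem(2), of _ x]) simp_all
    then show False using e(4,5) by blast
  qed
  moreover have "q \<in> set S'" if "q \<in> set S" "q \<noteq> (L' \<union> R', a' + b' + u')" for q
    using that(2) \<open>q \<in> set S\<close>[unfolded e'(1)] unfolding assms(5) e'(2) by auto
  moreover have "(L \<union> R, a + b + u) \<in> set S" using e(1) by simp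
  ultimately have eq: "(L \<union> R, a + b + u) = (L' \<union> R', a' + b' + u')" by metis
  have xy: "xs = xs'" "ys = ys'"
  proof -
    have S: "xs @ (L \<union> R, a + b + u) # ys = xs' @ (L \<union> R, a + b + u) # ys'" using e(1) e'(1) eq by simp
    have "(L \<union> R, a + b + u) \<notin> set xs" "(L \<union> R, a + b + u) \<notin> set ys" using dist e(1) by simp_all
    then have "xs = xs' \<and> ys = ys'" by (rule append_Cons_eq_iff[THEN iffD1, OF _ _ S])
    then show "xs = xs'" "ys = ys'" by simp_all
  qed
  have notin: "q \<notin> set xs \<union> set ys" if q': "q \<in> set S'" "fst q \<subseteq> L \<union> R" for q
  proof
    assume q: "q \<in> set xs \<union> set ys"
    obtain x where x: "x \<in> fst q" using state_blocks(1)[OF assms(1) q'(1)] by blast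
    have "q = (L \<union> R, a + b + u)"
    proof (rule state_blocks(6)[OF st _ _ x])
      show "q \<in> set S" "(L \<union> R, a + b + u) \<in> set S" using q e(1) by auto
      show "x \<in> fst (L \<union> R, a + b + u)" using x q'(2) by auto
    qed
    then show False using dist q e(1) by auto
  qed
  have only: "q = (L, a) \<or> q = (R, b)" if "q \<in> set S'" "fst q \<subseteq> L \<union> R" for q
    using notin[OF that] that(1) e(2) by auto
  have "(L', a') = (L, a) \<or> (L', a') = (R, b)" "(R', b') = (L, a) \<or> (R', b') = (R, b)"
  proof -
    have "fst (L', a') \<subseteq> L \<union> R" "fst (R', b') \<subseteq> L \<union> R" using eq by auto
    then show "(L', a') = (L, a) \<or> (L', a') = (R, b)" "(R', b') = (L, a) \<or> (R', b') = (R, b)"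
      using only[OF mem'(1)] only[OF mem'(2)] by simp_all
  qed
  moreover have "L' \<noteq> R'" using e'(4,5) by blast
  ultimately have "(L', a') = (L, a) \<and> (R', b') = (R, b)" using e(7) e'(7) by (metis Pair_inject not_less_iff_gr_or_eq)
  then show ?thesis using e(2) e'(2) xy by simp
qed

text \<open>Consecutive splits from \<open>S\<close> to \<open>T\<close> in which every adjacent
  pair satisfies \<open>adj\<close>. The first two states are both arguments because
  \<open>adj\<close> relates three states.\<close>

inductive run :: "(ostate \<Rightarrow> ostate \<Rightarrow> ostate \<Rightarrow> bool) \<Rightarrow> ostate \<Rightarrow> ostate \<Rightarrow> ostate \<Rightarrow> bool" for adj where
  base: "splits p u S S1 \<Longrightarrow> run adj S S1 S1"
| step: "splits p u S S1 \<Longrightarrow> run adj S1 S2 T \<Longrightarrow> adj S S1 S2 \<Longrightarrow> run adj S S1 T"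

lemma run_splits: "run adj S S1 T \<Longrightarrow> splits (split_pos S S1) (split_col S S1) S S1"
  by (erule run.cases) (auto simp: split_pos_col)

lemma run_state:
  assumes "run adj S S1 T" "state n T"
  shows "state n S1 \<and> wp_le n (set T) (set S1)"
  using assms
proof (induction rule: run.induct)
  case (base p u S S1)
  then show ?case using wp_le_refl by (simp add: state_def)
next
  case (step p u S S1 S2 T)
  have sp: "splits (split_pos S1 S2) (split_col S1 S2) S1 S2" using step.hyps(2) by (rule run_splits)
  have s2: "state n S2" "wp_le n (set T) (set S2)" using step.IH step.prems by auto
  then show ?case
    using splits_state[OF sp s2(1)] wp_le_trans[of "set T" n "set S2" "set S1"] step.prems by (simp add: state_def)
qed

text \<open>A block of \<open>T\<close> must lie inside a single block of every partition above
  \<open>T\<close>, so it cannot have been divided between the two parts.\<close>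

lemma kept_block_not_split:
  assumes "state n T" "state n S'" "wp_le n (set T) (set S')" "splits p u S S'" "S ! p \<in> set T"
  shows False
proof -
  obtain xs ys L a R b where e: "S = xs @ (L \<union> R, a + b + u) # ys" "S' = xs @ (L, a) # (R, b) # ys"
    "p = length xs" "L \<inter> R = {}" "L \<noteq> {}" "R \<noteq> {}" "Min L < Min R" "u \<le> 1"
    using assms(4) by (rule splitsE)
  have T: "(L \<union> R, a + b + u) \<in> set T" using assms(5) e by simp
  have W: "set T \<in> weighted_partitions n" "set S' \<in> weighted_partitions n" using assms(1,2) by (auto simp: state_def)
  obtain x y where xy: "x \<in> L" "y \<in> R" using e by blast
  have "L \<union> R \<subseteq> L"
    using below_block[OF W assms(3) T, of "(L, a)" x] xy e(2) by auto
  then show False using xy e(4) by blast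
qed

lemma run_below_Un:
  assumes T: "state n T" and S1: "state n S1" and le: "wp_le n (set T) (set S1)"
    and mem: "(L, a) \<in> set S1" "(R, b) \<in> set S1" and LR: "L \<inter> R = {}" "L \<noteq> {}"
  shows "wsum (set T) (L \<union> R) = wsum (set T) L + wsum (set T) R"
    "card (below (set T) (L \<union> R)) = card (below (set T) L) + card (below (set T) R)"
    "q \<in> set T \<Longrightarrow> fst q \<subseteq> L \<union> R \<Longrightarrow> fst q \<subseteq> L \<or> fst q \<subseteq> R"
proof -
  have W: "set T \<in> weighted_partitions n" "set S1 \<in> weighted_partitions n" using T S1 by (auto simp: state_def)
  show sep: "fst q \<subseteq> L \<or> fst q \<subseteq> R" if q: "q \<in> set T" "fst q \<subseteq> L \<union> R" for q
  proof -
    obtain x where x: "x \<in> fst q" using wp_block(1)[OF W(1) q(1)] by (metis ex_in_conv)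
    then have "x \<in> L \<or> x \<in> R" using q by blast
    then show ?thesis
      using below_block[OF W le q(1) mem(1) x] below_block[OF W le q(1) mem(2) x] by auto
  qed
  show "wsum (set T) (L \<union> R) = wsum (set T) L + wsum (set T) R"
    "card (below (set T) (L \<union> R)) = card (below (set T) L) + card (below (set T) R)"
    using below_Un[OF W(1) LR sep] by blast+
qed

lemma state_below_self:
  assumes "state n T" "(B, v) \<in> set T"
  shows "wsum (set T) B = v" "card (below (set T) B) = 1"
  using below_self[of "set T" n "(B, v)"] assms by (auto simp: state_def)

section \<open>Leading pairs for combs\<close>

text \<open>A pair is leading if the second split lies to the right of the first, except when it is
  a blue split of the right part of a red one. Pairs that are not leading thus work from right to
  left, and meet a nonleaf right child only in the pattern allowed in a bicolored comb.\<close>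

definition comb_adj :: "ostate \<Rightarrow> ostate \<Rightarrow> ostate \<Rightarrow> bool" where
  "comb_adj S S1 S2 \<longleftrightarrow> split_pos S S1 < split_pos S1 S2 \<and>
    \<not> (split_pos S1 S2 = Suc (split_pos S S1) \<and> split_col S S1 = 1 \<and> split_col S1 S2 = 0)"

text \<open>Lexicographic order on triples written as a number with radices \<open>n + 1\<close> and
  2: the middle entry will be at most \<open>n\<close> and the last at most 1.\<close>

definition lex3 :: "nat \<Rightarrow> nat \<Rightarrow> nat \<Rightarrow> nat \<Rightarrow> nat" where
  "lex3 n x y z = (x * Suc n + y) * 2 + z"

lemma lex3_less:
  assumes "y' \<le> n" "z' \<le> 1" "x' < x \<or> x' = x \<and> y' < y \<or> x' = x \<and> y' = y \<and> z' < z"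
  shows "lex3 n x' y' z' < lex3 n x y z"
proof -
  consider "x' < x" | "x' = x" "y' < y" | "x' = x" "y' = y" "z' < z" using assms(3) by blast
  then show ?thesis
  proof cases
    case 1
    then have "Suc x' * Suc n \<le> x * Suc n" by (intro mult_le_mono1) simp
    then have "x' * Suc n + y' < x * Suc n" using assms(1) by simp
    then have "x' * Suc n + y' < x * Suc n + y" by linarith
    moreover have "A * 2 + z' < B * 2 + z" if "A < B" for A B using that assms(2) by linarith
    ultimately show ?thesis unfolding lex3_def by blast
  qed (use assms in \<open>simp_all add: lex3_def\<close>)
qed

text \<open>The largest key belongs to the leftmost split, then to the largest right part, then to
  blue. These are the three ways in which an exchange improves a pair.\<close>

definition comb_key :: "nat \<Rightarrow> ostate \<Rightarrow> ostate \<Rightarrow> nat" where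
  "comb_key n S S1 = lex3 n (length S - split_pos S S1)
    (card (fst (S1 ! Suc (split_pos S S1)))) (1 - split_col S S1)"

section \<open>Entries, weights and minima around a split\<close>

lemma splits_nth_less: "splits p u S S' \<Longrightarrow> i < p \<Longrightarrow> S' ! i = S ! i"
  by (elim splitsE) (simp add: nth_append)

lemma splits_nth_greater: "splits p u S S' \<Longrightarrow> p < i \<Longrightarrow> S' ! Suc i = S ! i"
  by (elim splitsE) (simp add: nth_append nth_Cons' Suc_diff_le)

lemma splits_nth:
  "(xs @ x # ys) ! length xs = x" "(xs @ x # y # ys) ! Suc (length xs) = y"
  by (simp_all add: nth_append)

lemma splits_col_le: "splits p u S S' \<Longrightarrow> u \<le> 1"
  by (elim splitsE) simp

lemma block_eq:
  assumes "state n T" "q \<in> set T" "(B, v) \<in> set T" "fst q \<subseteq> B"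
  shows "q = (B, v)"
proof -
  obtain x where "x \<in> fst q" using state_blocks(1)[OF assms(1,2)] by blast
  then show ?thesis using state_blocks(6)[OF assms(1-3), of x] assms(4) by auto
qed

lemma state_le_block:
  assumes "state n T" "state n S" "wp_le n (set T) (set S)" "(B, v) \<in> set S"
  shows "wsum (set T) B \<le> v" "v < wsum (set T) B + card (below (set T) B)"
proof -
  have "set T \<in> weighted_partitions n" "set S \<in> weighted_partitions n" using assms by (auto simp: state_def)
  from wp_le_iff[OF this] show "wsum (set T) B \<le> v" "v < wsum (set T) B + card (below (set T) B)"
    using assms(3,4) by fastforce+
qed

lemma Min_Un_less:
  fixes L R :: "nat set"
  assumes "finite L" "finite R" "L \<noteq> {}" "R \<noteq> {}" "Min L < Min R"
  shows "Min (L \<union> R) = Min L"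
  using assms by (simp add: Min_Un min.absorb1)

text \<open>All later splits lie strictly to the right, so the entries up to the first split
  position are final.\<close>

lemma comb_run_mem:
  assumes "run comb_adj S S1 T" "i \<le> split_pos S S1"
  shows "S1 ! i \<in> set T"
  using assms
proof (induction arbitrary: i rule: run.induct)
  case (base p u S S1)
  then have "i < length S1" using length_splits[OF base.hyps] split_pos_col(1)[OF base.hyps] by simp
  then show ?case by simp
next
  case (step p u S S1 S2 T)
  have lt: "split_pos S S1 < split_pos S1 S2" using step.hyps(3) by (simp add: comb_adj_def)
  then have "S2 ! i = S1 ! i" using splits_nth_less[OF run_splits[OF step.hyps(2)]] step.prems by simp
  moreover have "S2 ! i \<in> set T" using step.IH[of i] lt step.prems by simp
  ultimately show ?case by simp
qed

lemma comb_split_max: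
  assumes sp: "splits p 1 S S1" and st: "state n T" "state n S1" and le: "wp_le n (set T) (set S1)"
    and L: "S1 ! p \<in> set T"
    and R: "wsum (set T) (fst (S1 ! Suc p)) + card (below (set T) (fst (S1 ! Suc p))) = Suc (snd (S1 ! Suc p))"
  shows "wsum (set T) (fst (S ! p)) + card (below (set T) (fst (S ! p))) = Suc (snd (S ! p))"
proof -
  obtain xs ys L a R b where e: "S = xs @ (L \<union> R, a + b + 1) # ys" "S1 = xs @ (L, a) # (R, b) # ys"
    "p = length xs" "L \<inter> R = {}" "L \<noteq> {}"
    using sp by (rule splitsE)
  have nth: "S ! p = (L \<union> R, a + b + 1)" "S1 ! p = (L, a)" "S1 ! Suc p = (R, b)"
    unfolding e(1-3) by (simp_all only: splits_nth)
  have "(L, a) \<in> set S1" "(R, b) \<in> set S1" unfolding e(2) by simp_all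
  from run_below_Un(1,2)[OF st le this e(4,5)] show ?thesis
    using state_below_self[OF st(1) L[unfolded nth]] R unfolding nth by simp
qed

text \<open>A red split followed by a blue split of its right part is not leading, so red propagates
  along the right spine, while left parts are kept. Every merge inside the block is red, and its
  weight is the largest that \<open>T\<close> permits.\<close>

lemma comb_run_max:
  assumes "run comb_adj S S1 T" "state n T" "split_col S S1 = 1"
  shows "wsum (set T) (fst (S ! split_pos S S1)) + card (below (set T) (fst (S ! split_pos S S1))) =
    Suc (snd (S ! split_pos S S1))"
  using assms
proof (induction rule: run.induct)
  case (base p u S S1)
  have pu: "split_pos S S1 = p" "u = 1" using split_pos_col[OF base.hyps] base.prems by auto
  have len: "Suc p < length S1" using length_splits[OF base.hyps] by simp
  have mem: "S1 ! p \<in> set S1" "S1 ! Suc p \<in> set S1" using len by simp_all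
  have "wsum (set S1) (fst (S1 ! Suc p)) + card (below (set S1) (fst (S1 ! Suc p))) = Suc (snd (S1 ! Suc p))"
    using state_below_self[OF base.prems(1), of "fst (S1 ! Suc p)" "snd (S1 ! Suc p)"] mem(2) by simp
  then show ?case
    using comb_split_max[OF base.hyps[unfolded pu(2)] base.prems(1) base.prems(1) _ mem(1)]
      wp_le_refl base.prems(1) pu(1) by (simp add: state_def)
next
  case (step p u S S1 S2 T)
  have pu: "split_pos S S1 = p" "u = 1" using split_pos_col[OF step.hyps(1)] step.prems by auto
  let ?q = "split_pos S1 S2"
  have adj: "p < ?q" "?q = Suc p \<longrightarrow> split_col S1 S2 \<noteq> 0"
    using step.hyps(3) step.prems pu by (auto simp: comb_adj_def)
  have run: "run comb_adj S S1 T" using step.hyps by (rule run.step)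
  have sp2: "splits ?q (split_col S1 S2) S1 S2" by (rule run_splits[OF step.hyps(2)])
  have st: "state n S1" "wp_le n (set T) (set S1)" using run_state[OF run step.prems(1)] by auto
  have "wsum (set T) (fst (S1 ! Suc p)) + card (below (set T) (fst (S1 ! Suc p))) = Suc (snd (S1 ! Suc p))"
  proof (cases "?q = Suc p")
    case True
    then have "split_col S1 S2 = 1" using adj(2) splits_col_le[OF sp2] by simp
    then show ?thesis using step.IH[OF step.prems(1)] True by simp
  next
    case False
    then have "Suc p < ?q" using adj(1) by simp
    then have "S1 ! Suc p \<in> set T"
      using comb_run_mem[OF step.hyps(2), of "Suc p"] splits_nth_less[OF sp2, of "Suc p"] by simp
    then show ?thesis
      using state_below_self[OF step.prems(1), of "fst (S1 ! Suc p)" "snd (S1 ! Suc p)"] by simp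
  qed
  moreover have "S1 ! p \<in> set T" using comb_run_mem[OF run, of p] pu by simp
  ultimately show ?case
    using comb_split_max[OF step.hyps(1)[unfolded pu(2)] step.prems(1) st] pu(1) by simp
qed

text \<open>A competitor cannot split a kept block, so it splits at \<open>p\<close> or further
  right. At \<open>p\<close>, its left part shares its minimum with the kept block \<open>L\<close>
  and hence contains it, so its right part is no larger. If the parts agree only the colour can
  differ, and blue instead of red would exceed the maximal weight of the right part.\<close>

lemma comb_max:
  assumes run: "run comb_adj S S1 T" and T: "state n T" and sp': "splits p' u' S S'" and S': "state n S'"
    and le: "wp_le n (set T) (set S')" and neq: "S' \<noteq> S1"
  shows "comb_key n S S' < comb_key n S S1"
proof -
  define p u where pu: "p = split_pos S S1" "u = split_col S S1"
  have sp: "splits p u S S1" unfolding pu by (rule run_splits[OF run])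
  obtain xs ys L a R b where e: "S = xs @ (L \<union> R, a + b + u) # ys" "S1 = xs @ (L, a) # (R, b) # ys"
    "p = length xs" "L \<inter> R = {}" "L \<noteq> {}" "R \<noteq> {}" "Min L < Min R" "u \<le> 1"
    using sp by (rule splitsE)
  obtain xs' ys' L' a' R' b' where e': "S = xs' @ (L' \<union> R', a' + b' + u') # ys'" "S' = xs' @ (L', a') # (R', b') # ys'"
    "p' = length xs'" "L' \<inter> R' = {}" "L' \<noteq> {}" "R' \<noteq> {}" "Min L' < Min R'" "u' \<le> 1"
    using sp' by (rule splitsE)
  have S1: "state n S1" "wp_le n (set T) (set S1)" using run_state[OF run T] by auto
  have fin: "finite L" "finite R" "finite L'" "finite R'"
    using state_blocks(3)[OF S1(1), of "(L, a)"] state_blocks(3)[OF S1(1), of "(R, b)"]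
      state_blocks(3)[OF S', of "(L', a')"] state_blocks(3)[OF S', of "(R', b')"] e(2) e'(2) by auto
  have "S1 ! Suc p = (R, b)" unfolding e(2,3) by (simp only: splits_nth)
  then have k: "comb_key n S S1 = lex3 n (length S - p) (card R) (1 - u)"
    unfolding comb_key_def pu[symmetric] by simp
  have "S' ! Suc p' = (R', b')" unfolding e'(2,3) by (simp only: splits_nth)
  then have k': "comb_key n S S' = lex3 n (length S - p') (card R') (1 - u')"
    unfolding comb_key_def split_pos_col[OF sp'] by simp
  have R'n: "card R' \<le> n"
    using card_mono[of "{1..n}" R'] state_blocks(2)[OF S', of "(R', b')"] e'(2) by auto
  have ge: "p \<le> p'"
  proof (rule ccontr)
    assume "\<not> p \<le> p'"
    then have "S ! p' \<in> set T"
      using comb_run_mem[OF run, of p'] splits_nth_less[OF sp, of p'] pu by simp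
    then show False by (rule kept_block_not_split[OF T S' le sp'])
  qed
  show ?thesis
  proof (cases "p = p'")
    case False
    then have "length S - p' < length S - p" using ge e'(1,3) by simp
    then show ?thesis unfolding k k' using R'n by (intro lex3_less) auto
  next
    case True
    have eq: "xs' = xs" "L' \<union> R' = L \<union> R" "a' + b' + u' = a + b + u" "ys' = ys"
      using e(1) e'(1) True e(3) e'(3) by auto
    have La: "(L, a) \<in> set T"
    proof -
      have "S1 ! p = (L, a)" unfolding e(2,3) by (simp only: splits_nth)
      then show ?thesis using comb_run_mem[OF run, of p] pu by simp
    qed
    have m: "Min L = Min L'"
      using Min_Un_less[OF fin(1,2) e(5,6,7)] Min_Un_less[OF fin(3,4) e'(5,6,7)] eq(2) by simp
    have "L \<subseteq> L'"
    proof -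
      have "Min L \<in> L" "Min L \<in> L'" unfolding m using m fin e e' by (metis Min_in, metis Min_in)
      then show ?thesis
        using below_block[of "set T" n "set S'" "(L, a)" "(L', a')" "Min L"] T S' le La e'(2) by (simp add: state_def)
    qed
    show ?thesis
    proof (cases "L = L'")
      case False
      then have "R' \<subset> R" using \<open>L \<subseteq> L'\<close> eq(2) e(4) e'(4) by blast
      then have "card R' < card R" using fin(2) by (intro psubset_card_mono)
      then show ?thesis unfolding k k' True using e'(8) R'n by (intro lex3_less) auto
    next
      case LL: True
      have RR: "R' = R" using LL eq(2) e(4) e'(4) by blast
      have "a' = a"
        using state_le_block[OF T S' le, of L' a'] e'(2) state_below_self[OF T La] LL by simp
      moreover have "u \<noteq> u'"
      proof
        assume "u = u'"
        then have "b = b'" using eq(3) \<open>a' = a\<close> by simp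
        then show False using neq e(2) e'(2) eq LL RR \<open>a' = a\<close> by simp
      qed
      moreover have "\<not> (u = 1 \<and> u' = 0)"
      proof
        assume uu: "u = 1 \<and> u' = 0"
        have "S ! p = (L \<union> R, a + b + u)" unfolding e(1,3) by (simp only: splits_nth)
        then have "wsum (set T) (L \<union> R) + card (below (set T) (L \<union> R)) = Suc (a + b + 1)"
          using comb_run_max[OF run T] uu pu by simp
        moreover have "(L, a) \<in> set S1" "(R, b) \<in> set S1" unfolding e(2) by simp_all
        note run_below_Un(1,2)[OF T S1 this e(4,5)]
        moreover have "b' < wsum (set T) R + card (below (set T) R)"
          using state_le_block(2)[OF T S' le, of R' b'] e'(2) RR by simp
        ultimately show False
          using state_below_self[OF T La] eq(3) \<open>a' = a\<close> uu by simp
      qed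
      ultimately have "u = 0 \<and> u' = 1" using e(8) e'(8) by linarith
      then show ?thesis unfolding k k' True RR using R'n RR by (intro lex3_less) auto
    qed
  qed
qed

lemma split_list_cases:
  assumes "xs @ A # B # ys = xs2 @ X # ys2"
  obtains (left) zs where "xs = xs2 @ X # zs" "ys2 = zs @ A # B # ys"
    | (first) "xs2 = xs" "X = A" "ys2 = B # ys"
    | (second) "xs2 = xs @ [A]" "X = B" "ys2 = ys"
    | (right) zs where "ys = zs @ X # ys2" "xs2 = xs @ A # B # zs"
proof -
  have "(\<exists>zs. xs = xs2 @ X # zs \<and> ys2 = zs @ A # B # ys) \<or> (xs2 = xs \<and> X = A \<and> ys2 = B # ys) \<or>
      (xs2 = xs @ [A] \<and> X = B \<and> ys2 = ys) \<or> (\<exists>zs. ys = zs @ X # ys2 \<and> xs2 = xs @ A # B # zs)"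
    using assms by (auto simp: append_eq_append_conv2 append_eq_Cons_conv Cons_eq_append_conv)
  then show ?thesis using left first second right by blast
qed

text \<open>If the second split lies to the left, the two are swapped. If it divides the left part,
  the block with the smallest minimum among the three is split off first. If it divides the right
  part, only colours change. Further right, nothing needs to change.\<close>

lemma comb_exchange:
  assumes S2: "state n S2" and sp: "splits p u S S1" "splits q w S1 S2"
  shows "\<exists>S1' S2' p u q w. splits p u S S1' \<and> splits q w S1' S2' \<and> set S2' = set S2 \<and> comb_adj S S1' S2'"
proof -
  obtain xs ys L a R b where e: "S = xs @ (L \<union> R, a + b + u) # ys" "S1 = xs @ (L, a) # (R, b) # ys"
    "p = length xs" "L \<inter> R = {}" "L \<noteq> {}" "R \<noteq> {}" "Min L < Min R" "u \<le> 1"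
    using sp(1) by (rule splitsE)
  obtain xs2 ys2 L2 a2 R2 b2 where f: "S1 = xs2 @ (L2 \<union> R2, a2 + b2 + w) # ys2" "S2 = xs2 @ (L2, a2) # (R2, b2) # ys2"
    "q = length xs2" "L2 \<inter> R2 = {}" "L2 \<noteq> {}" "R2 \<noteq> {}" "Min L2 < Min R2" "w \<le> 1"
    using sp(2) by (rule splitsE)
  have S1: "state n S1" by (rule splits_state(1)[OF sp(2) S2])
  have fin: "finite L" "finite R" "finite L2" "finite R2"
    using state_blocks(3)[OF S1, of "(L, a)"] state_blocks(3)[OF S1, of "(R, b)"]
      state_blocks(3)[OF S2, of "(L2, a2)"] state_blocks(3)[OF S2, of "(R2, b2)"] e(2) f(2) by auto
  \<comment> \<open>The two colours are redistributed with the smaller one first. This keeps the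
    total weight and avoids red over blue.\<close>
  define t m where tm: "t = min u w" "m = max u w"
  have tm': "t \<le> 1" "m \<le> 1" "t + m = u + w" "\<not> (t = 1 \<and> m = 0)" using e(8) f(8) by (auto simp: tm min_def max_def)
  have adjI: "comb_adj S S1' S2'" if "splits p' t' S S1'" "splits q' m' S1' S2'" "p' < q'"
    "q' = Suc p' \<Longrightarrow> \<not> (t' = 1 \<and> m' = 0)" for p' t' q' m' S1' S2'
    using that by (auto simp: comb_adj_def split_pos_col[OF that(1)] split_pos_col[OF that(2)])
  from e(2) f(1) have eq: "xs @ (L, a) # (R, b) # ys = xs2 @ (L2 \<union> R2, a2 + b2 + w) # ys2" by simp
  then show ?thesis
  proof (cases rule: split_list_cases)
    case (left zs)
    let ?S1 = "xs2 @ (L2, a2) # (R2, b2) # zs @ (L \<union> R, a + b + u) # ys"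
    have 1: "splits (length xs2) w S ?S1"
      unfolding e(1) left(1) append_assoc append_Cons using f by (intro splitsI) auto
    have "splits (length (xs2 @ (L2, a2) # (R2, b2) # zs)) u ((xs2 @ (L2, a2) # (R2, b2) # zs) @ (L \<union> R, a + b + u) # ys)
        ((xs2 @ (L2, a2) # (R2, b2) # zs) @ (L, a) # (R, b) # ys)"
      using e by (intro splitsI) auto
    then have 2: "splits (length xs2 + 2 + length zs) u ?S1 S2" unfolding f(2) left(2) by simp
    have "comb_adj S ?S1 S2" by (rule adjI[OF 1 2]) simp_all
    with 1 2 show ?thesis by blast
  next
    case first
    \<comment> \<open>\<open>R2\<close> and \<open>R\<close> are to be the parts of one block, and
      which of them has the smaller minimum is not known: \<open>P\<close> and \<open>Q\<close> are
      the same two blocks in the right order.\<close>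
    obtain P c Q d where PQ: "{(P, c), (Q, d)} = {(R2, b2), (R, b)}" "Min P < Min Q" "c + d = b2 + b" "P \<union> Q = R2 \<union> R"
    proof -
      have "R2 \<inter> R = {}" using first(2) e(4) by auto
      then have "Min R2 < Min R \<or> Min R < Min R2" using fin e f by (intro Min_less_cases) auto
      then show ?thesis using that[of R2 b2 R b] that[of R b R2 b2] by auto
    qed
    have LL: "L = L2 \<union> R2" "a = a2 + b2 + w" using first(2) by auto
    have disj: "R2 \<inter> R = {}" "L2 \<inter> (R2 \<union> R) = {}" using LL e(4) f(4) by auto
    have PQ': "P \<inter> Q = {}" "P \<noteq> {}" "Q \<noteq> {}" using PQ(1) disj(1) e f by (auto simp: doubleton_eq_iff)
    have mL: "Min L2 < Min R" using e(7) Min_Un_less[OF fin(3,4) f(5,6,7)] LL by simp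
    have mR: "Min L2 < Min (R2 \<union> R)" using fin e(6) f(6) mL f(7) by (simp add: Min_Un)
    let ?S1 = "xs @ (L2, a2) # (R2 \<union> R, b2 + b + m) # ys" and ?S2 = "xs @ (L2, a2) # (P, c) # (Q, d) # ys"
    have 1: "splits p t S ?S1"
      unfolding e(1) using disj mR f(5) e(6) tm' LL by (intro splitsI) (auto simp: e(3))
    have "splits (Suc p) m ((xs @ [(L2, a2)]) @ (R2 \<union> R, b2 + b + m) # ys) ((xs @ [(L2, a2)]) @ (P, c) # (Q, d) # ys)"
      using PQ PQ' tm' by (intro splitsI) (auto simp: e(3))
    then have 2: "splits (Suc p) m ?S1 ?S2" by simp
    have "set ?S2 = {(P, c), (Q, d)} \<union> (set xs \<union> set ys \<union> {(L2, a2)})" by auto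
    also have "\<dots> = set S2" unfolding PQ(1) f(2) first(1,3) by auto
    finally have 3: "set ?S2 = set S2" .
    have "comb_adj S ?S1 ?S2" by (rule adjI[OF 1 2]) (use tm' in simp_all)
    with 1 2 3 show ?thesis by blast
  next
    case second
    have RR: "R = L2 \<union> R2" "b = a2 + b2 + w" using second(2) by auto
    let ?S1 = "xs @ (L, a) # (R, a2 + b2 + m) # ys"
    have 1: "splits p t S ?S1"
      unfolding e(1) using e tm' RR by (intro splitsI) auto
    have "splits (Suc p) m ((xs @ [(L, a)]) @ (R, a2 + b2 + m) # ys) ((xs @ [(L, a)]) @ (L2, a2) # (R2, b2) # ys)"
      using f tm' RR e(3) by (intro splitsI) auto
    then have 2: "splits (Suc p) m ?S1 S2" unfolding f(2) second by simp
    have "comb_adj S ?S1 S2" by (rule adjI[OF 1 2]) (use tm' in simp_all)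
    with 1 2 show ?thesis by blast
  next
    case (right zs)
    have "comb_adj S S1 S2" using e(3) f(3) right(2) by (intro adjI[OF sp]) auto
    then show ?thesis using sp by blast
  qed
qed

section \<open>Leading pairs for Lyndon trees\<close>

text \<open>Here leading pairs move to the left or stay at the left part. In the latter case the new
  right part must have the smaller minimum, and blue over red is excluded. A pair that splits a left
  part and is not leading is therefore a Lyndon node or a blue node with red left child.\<close>

definition lyn_adj :: "ostate \<Rightarrow> ostate \<Rightarrow> ostate \<Rightarrow> bool" where
  "lyn_adj S S1 S2 \<longleftrightarrow> (let p = split_pos S S1; q = split_pos S1 S2 in
    q \<le> p \<and> (q = p \<longrightarrow> Min (fst (S2 ! Suc p)) < Min (fst (S1 ! Suc p)) \<and> \<not> (split_col S S1 = 0 \<and> split_col S1 S2 = 1)))"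

text \<open>The largest key belongs to the rightmost split, then to the largest minimum of the right
  part, then to red.\<close>

definition lyn_key :: "nat \<Rightarrow> ostate \<Rightarrow> ostate \<Rightarrow> nat" where
  "lyn_key n S S1 = lex3 n (split_pos S S1) (Min (fst (S1 ! Suc (split_pos S S1)))) (split_col S S1)"

lemma lyn_run_mem:
  assumes "run lyn_adj S S1 T" "split_pos S S1 < i" "i < length S1"
  shows "S1 ! i \<in> set T"
  using assms
proof (induction arbitrary: i rule: run.induct)
  case (base p u S S1)
  then show ?case by simp
next
  case (step p u S S1 S2 T)
  have le: "split_pos S1 S2 \<le> split_pos S S1" using step.hyps(3) by (simp add: lyn_adj_def Let_def)
  note sp2 = run_splits[OF step.hyps(2)]
  have "S2 ! Suc i = S1 ! i" using splits_nth_greater[OF sp2] le step.prems by simp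
  moreover have "S2 ! Suc i \<in> set T" using step.IH[of "Suc i"] le step.prems length_splits[OF sp2] by simp
  ultimately show ?case by simp
qed

text \<open>The left part at \<open>p\<close> may be split again, unlike the entries further right.
  It becomes final once the run has moved strictly to the left of it.\<close>

lemma lyn_run_left:
  assumes "run lyn_adj S1 S2 T" "split_pos S1 S2 < p" "p < length S1"
  shows "S1 ! p \<in> set T"
proof -
  note sp = run_splits[OF assms(1)]
  have "S2 ! Suc p = S1 ! p" using splits_nth_greater[OF sp assms(2)] .
  then show ?thesis using lyn_run_mem[OF assms(1), of "Suc p"] assms(2,3) length_splits[OF sp] by simp
qed

lemma lyn_split_Min:
  assumes sp: "splits p u S S1" and st: "state n T" "state n S1" and le: "wp_le n (set T) (set S1)"
    and R: "S1 ! Suc p \<in> set T"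
    and L: "\<And>r. r \<in> set T \<Longrightarrow> fst r \<subseteq> fst (S1 ! p) \<Longrightarrow> Min (fst r) \<le> Min (fst (S1 ! Suc p))"
    and q: "q \<in> set T" "fst q \<subseteq> fst (S ! p)"
  shows "Min (fst q) \<le> Min (fst (S1 ! Suc p))"
proof -
  obtain xs ys L a R b where e: "S = xs @ (L \<union> R, a + b + u) # ys" "S1 = xs @ (L, a) # (R, b) # ys"
    "p = length xs" "L \<inter> R = {}" "L \<noteq> {}"
    using sp by (rule splitsE)
  have nth: "S ! p = (L \<union> R, a + b + u)" "S1 ! p = (L, a)" "S1 ! Suc p = (R, b)"
    unfolding e(1-3) by (simp_all only: splits_nth)
  have "(L, a) \<in> set S1" "(R, b) \<in> set S1" unfolding e(2) by simp_all
  from run_below_Un(3)[OF st le this e(4,5) q(1)] q(2) have "fst q \<subseteq> L \<or> fst q \<subseteq> R" unfolding nth by simp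
  then show ?thesis
  proof
    assume "fst q \<subseteq> L" then show ?thesis using L[OF q(1)] unfolding nth by simp
  next
    assume "fst q \<subseteq> R"
    then have "q = (R, b)" using block_eq[OF st(1) q(1)] R unfolding nth by simp
    then show ?thesis unfolding nth by simp
  qed
qed

lemma splits_Min_less:
  "splits p u S S1 \<Longrightarrow> Min (fst (S1 ! p)) < Min (fst (S1 ! Suc p))"
  by (elim splitsE) (simp add: nth_append)

text \<open>As long as the run stays at the same position, the minima of the successive right parts
  decrease. The first right part thus has the largest minimum among the blocks of \<open>T\<close>
  inside the split block.\<close>

lemma lyn_run_Min:
  assumes "run lyn_adj S S1 T" "state n T" "q \<in> set T" "fst q \<subseteq> fst (S ! split_pos S S1)"
  shows "Min (fst q) \<le> Min (fst (S1 ! Suc (split_pos S S1)))"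
  using assms
proof (induction arbitrary: q rule: run.induct)
  case (base p u S S1)
  have pu: "split_pos S S1 = p" using split_pos_col[OF base.hyps] by auto
  have len: "Suc p < length S1" using length_splits[OF base.hyps] by simp
  show ?case unfolding pu
  proof (rule lyn_split_Min[OF base.hyps base.prems(1) base.prems(1) _ _ _ base.prems(2)])
    show "wp_le n (set S1) (set S1)" using wp_le_refl base.prems(1) by (simp add: state_def)
    show "S1 ! Suc p \<in> set S1" using len by simp
    show "fst q \<subseteq> fst (S ! p)" using base.prems(3) pu by simp
    fix r assume r: "r \<in> set S1" "fst r \<subseteq> fst (S1 ! p)"
    have "r = S1 ! p" using block_eq[OF base.prems(1) r(1), of "fst (S1 ! p)" "snd (S1 ! p)"] r(2) len by simp
    then show "Min (fst r) \<le> Min (fst (S1 ! Suc p))" using splits_Min_less[OF base.hyps] by simp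
  qed
next
  case (step p u S S1 S2 T)
  have pu: "split_pos S S1 = p" "split_col S S1 = u" using split_pos_col[OF step.hyps(1)] by auto
  let ?q = "split_pos S1 S2"
  have adj: "?q \<le> p" "?q = p \<Longrightarrow> Min (fst (S2 ! Suc p)) < Min (fst (S1 ! Suc p))"
    using step.hyps(3) pu by (auto simp: lyn_adj_def Let_def)
  have run: "run lyn_adj S S1 T" using step.hyps by (rule run.step)
  have len: "Suc p < length S1" using length_splits[OF step.hyps(1)] by simp
  have st: "state n S1" "wp_le n (set T) (set S1)" using run_state[OF run step.prems(1)] by auto
  show ?case unfolding pu
  proof (rule lyn_split_Min[OF step.hyps(1) step.prems(1) st _ _ step.prems(2)])
    show "S1 ! Suc p \<in> set T" using lyn_run_mem[OF run, of "Suc p"] len pu by simp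
    show "fst q \<subseteq> fst (S ! p)" using step.prems(3) pu by simp
    fix r assume r: "r \<in> set T" "fst r \<subseteq> fst (S1 ! p)"
    show "Min (fst r) \<le> Min (fst (S1 ! Suc p))"
    proof (cases "?q = p")
      case True
      then have "Min (fst r) \<le> Min (fst (S2 ! Suc p))" using step.IH[OF step.prems(1) r(1)] r(2) by simp
      then show ?thesis using adj(2)[OF True] by simp
    next
      case False
      then have "S1 ! p \<in> set T" using lyn_run_left[OF step.hyps(2), of p] adj(1) len by simp
      then have "r = S1 ! p"
        using block_eq[OF step.prems(1) r(1), of "fst (S1 ! p)" "snd (S1 ! p)"] r(2) by simp
      then show ?thesis using splits_Min_less[OF step.hyps(1)] by simp
    qed
  qed
qed

lemma lyn_split_min:
  assumes sp: "splits p 0 S S1" and st: "state n T" "state n S1" and le: "wp_le n (set T) (set S1)"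
    and R: "S1 ! Suc p \<in> set T"
    and L: "wsum (set T) (fst (S1 ! p)) = snd (S1 ! p)"
  shows "wsum (set T) (fst (S ! p)) = snd (S ! p)"
proof -
  obtain xs ys L a R b where e: "S = xs @ (L \<union> R, a + b + 0) # ys" "S1 = xs @ (L, a) # (R, b) # ys"
    "p = length xs" "L \<inter> R = {}" "L \<noteq> {}"
    using sp by (rule splitsE)
  have nth: "S ! p = (L \<union> R, a + b + 0)" "S1 ! p = (L, a)" "S1 ! Suc p = (R, b)"
    unfolding e(1-3) by (simp_all only: splits_nth)
  have "(L, a) \<in> set S1" "(R, b) \<in> set S1" unfolding e(2) by simp_all
  from run_below_Un(1)[OF st le this e(4,5)] show ?thesis
    using state_below_self[OF st(1) R[unfolded nth]] L unfolding nth by simp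
qed

text \<open>This concerns weights, in contrast to \<open>lyn_run_Min\<close>. Blue over red being
  excluded, blue propagates along the left spine while right parts are kept, so the weight of the
  block is the least that \<open>T\<close> permits.\<close>

lemma lyn_run_min:
  assumes "run lyn_adj S S1 T" "state n T" "split_col S S1 = 0"
  shows "wsum (set T) (fst (S ! split_pos S S1)) = snd (S ! split_pos S S1)"
  using assms
proof (induction rule: run.induct)
  case (base p u S S1)
  have pu: "split_pos S S1 = p" "u = 0" using split_pos_col[OF base.hyps] base.prems by auto
  have len: "Suc p < length S1" using length_splits[OF base.hyps] by simp
  have mem: "S1 ! p \<in> set S1" "S1 ! Suc p \<in> set S1" using len by simp_all
  have "wsum (set S1) (fst (S1 ! p)) = snd (S1 ! p)"
    using state_below_self[OF base.prems(1), of "fst (S1 ! p)" "snd (S1 ! p)"] mem(1) by simp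
  then show ?case
    using lyn_split_min[OF base.hyps[unfolded pu(2)] base.prems(1) base.prems(1) _ mem(2)]
      wp_le_refl base.prems(1) pu(1) by (simp add: state_def)
next
  case (step p u S S1 S2 T)
  have pu: "split_pos S S1 = p" "u = 0" using split_pos_col[OF step.hyps(1)] step.prems by auto
  let ?q = "split_pos S1 S2"
  have adj: "?q \<le> p" "?q = p \<Longrightarrow> split_col S1 S2 \<noteq> 1"
    using step.hyps(3) step.prems pu by (auto simp: lyn_adj_def Let_def)
  have run: "run lyn_adj S S1 T" using step.hyps by (rule run.step)
  have sp2: "splits ?q (split_col S1 S2) S1 S2" by (rule run_splits[OF step.hyps(2)])
  have len: "Suc p < length S1" using length_splits[OF step.hyps(1)] by simp
  have st: "state n S1" "wp_le n (set T) (set S1)" using run_state[OF run step.prems(1)] by auto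
  have "wsum (set T) (fst (S1 ! p)) = snd (S1 ! p)"
  proof (cases "?q = p")
    case True
    then have "split_col S1 S2 = 0" using adj(2) splits_col_le[OF sp2] by simp
    then show ?thesis using step.IH[OF step.prems(1)] True by simp
  next
    case False
    then have "S1 ! p \<in> set T" using lyn_run_left[OF step.hyps(2), of p] adj(1) len by simp
    then show ?thesis
      using state_below_self[OF step.prems(1), of "fst (S1 ! p)" "snd (S1 ! p)"] by simp
  qed
  moreover have "S1 ! Suc p \<in> set T" using lyn_run_mem[OF run, of "Suc p"] pu len by simp
  ultimately show ?case
    using lyn_split_min[OF step.hyps(1)[unfolded pu(2)] step.prems(1) st] pu(1) by simp
qed

text \<open>Kept blocks confine the competitor to positions up to \<open>p\<close>. At
  \<open>p\<close>, its right part has minimum at most \<open>Min R\<close>, with equality only for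
  the same parts. Then only the colour can differ, and red instead of blue would make the weight of
  the left part too small.\<close>

lemma lyn_max:
  assumes run: "run lyn_adj S S1 T" and T: "state n T" and sp': "splits p' u' S S'" and S': "state n S'"
    and le: "wp_le n (set T) (set S')" and neq: "S' \<noteq> S1"
  shows "lyn_key n S S' < lyn_key n S S1"
proof -
  define p u where pu: "p = split_pos S S1" "u = split_col S S1"
  have sp: "splits p u S S1" unfolding pu by (rule run_splits[OF run])
  obtain xs ys L a R b where e: "S = xs @ (L \<union> R, a + b + u) # ys" "S1 = xs @ (L, a) # (R, b) # ys"
    "p = length xs" "L \<inter> R = {}" "L \<noteq> {}" "R \<noteq> {}" "Min L < Min R" "u \<le> 1"
    using sp by (rule splitsE)
  obtain xs' ys' L' a' R' b' where e': "S = xs' @ (L' \<union> R', a' + b' + u') # ys'" "S' = xs' @ (L', a') # (R', b') # ys'"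
    "p' = length xs'" "L' \<inter> R' = {}" "L' \<noteq> {}" "R' \<noteq> {}" "Min L' < Min R'" "u' \<le> 1"
    using sp' by (rule splitsE)
  have S1: "state n S1" "wp_le n (set T) (set S1)" using run_state[OF run T] by auto
  have W: "set T \<in> weighted_partitions n" "set S' \<in> weighted_partitions n" using T S' by (auto simp: state_def)
  have fin: "finite R" "finite R'"
    using state_blocks(3)[OF S1(1), of "(R, b)"] state_blocks(3)[OF S', of "(R', b')"] e(2) e'(2) by auto
  have nth: "S ! p = (L \<union> R, a + b + u)" "S1 ! p = (L, a)" "S1 ! Suc p = (R, b)"
    unfolding e(1-3) by (simp_all only: splits_nth)
  then have k: "lyn_key n S S1 = lex3 n p (Min R) u"
    unfolding lyn_key_def pu[symmetric] by simp
  have "S' ! Suc p' = (R', b')" unfolding e'(2,3) by (simp only: splits_nth)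
  then have k': "lyn_key n S S' = lex3 n p' (Min R') u'"
    unfolding lyn_key_def split_pos_col[OF sp'] by simp
  have R'n: "Min R' \<le> n"
    using Min_in[OF fin(2) e'(6)] state_blocks(2)[OF S', of "(R', b')"] e'(2) by auto
  have mem: "(R', b') \<in> set S'" using e'(2) by simp
  have ge: "p' \<le> p"
  proof (rule ccontr)
    assume "\<not> p' \<le> p"
    then have "S ! p' \<in> set T"
      using lyn_run_mem[OF run, of "Suc p'"] splits_nth_greater[OF sp, of p'] pu length_splits[OF sp] length_splits[OF sp']
      by simp
    then show False by (rule kept_block_not_split[OF T S' le sp'])
  qed
  have RT: "(R, b) \<in> set T"
    using lyn_run_mem[OF run, of "Suc p"] pu length_splits[OF sp] nth by simp
  have RS: "(L, a) \<in> set S1" "(R, b) \<in> set S1" unfolding e(2) by simp_all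
  have Minle: "Min (fst q) \<le> Min R" if "q \<in> set T" "fst q \<subseteq> L \<union> R" for q
    using lyn_run_Min[OF run T that(1)] that(2) pu nth by simp
  show ?thesis
  proof (cases "p = p'")
    case False
    then have "p' < p" using ge by simp
    then show ?thesis unfolding k k' using R'n e'(8) by (intro lex3_less) auto
  next
    case True
    have eq: "xs' = xs" "L' \<union> R' = L \<union> R" "a' + b' + u' = a + b + u" "ys' = ys"
      using e(1) e'(1) True e(3) e'(3) by auto
    \<comment> \<open>The minimum of every block of \<open>T\<close> inside \<open>R'\<close> is
      squeezed between \<open>Min R'\<close> and \<open>Min R\<close>. If these coincide,
      \<open>R\<close> is the only such block.\<close>
    have inside: "\<exists>q\<in>set T. x \<in> fst q \<and> fst q \<subseteq> R' \<and> Min R' \<le> Min (fst q) \<and> Min (fst q) \<le> Min R" if x: "x \<in> R'" for x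
    proof -
      have "x \<in> {1..n}" using x state_blocks(2)[OF S' mem] by auto
      then obtain q where q: "q \<in> set T" "x \<in> fst q" using wp_cover[OF W(1)] by metis
      have sub: "fst q \<subseteq> R'" using below_block[OF W le q(1) mem q(2)] x by simp
      have "Min R' \<le> Min (fst q)" using sub q(2) fin(2) by (intro Min_antimono) auto
      moreover have "Min (fst q) \<le> Min R" using Minle[OF q(1)] sub eq(2) by auto
      ultimately show ?thesis using q sub by blast
    qed
    have "Min R' \<le> Min R" using inside[OF Min_in[OF fin(2) e'(6)]] by auto
    show ?thesis
    proof (cases "Min R' = Min R")
      case False
      then have "Min R' < Min R" using \<open>Min R' \<le> Min R\<close> by simp
      then show ?thesis unfolding k k' True using e'(8) R'n by (intro lex3_less) auto
    next
      case mm: True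
      have MR: "Min R \<in> R" "Min R \<in> R'" using Min_in[OF fin(1) e(6)] Min_in[OF fin(2) e'(6)] mm by auto
      have "R \<subseteq> R'" using below_block[OF W le RT mem, of "Min R"] MR by simp
      moreover have "R' \<subseteq> R"
      proof
        fix x assume "x \<in> R'"
        then obtain q where q: "q \<in> set T" "x \<in> fst q" "Min R' \<le> Min (fst q)" "Min (fst q) \<le> Min R"
          using inside by blast
        have "Min (fst q) = Min R" using q(3,4) mm by (intro antisym) simp_all
        then have "Min R \<in> fst q"
          using Min_in[of "fst q"] state_blocks(1,3)[OF T q(1)] by metis
        then have "q = (R, b)" using state_blocks(6)[OF T q(1) RT, of "Min R"] MR by simp
        then show "x \<in> R" using q(2) by simp
      qed
      ultimately have RR: "R' = R" by blast
      then have LL: "L' = L" using eq(2) e(4) e'(4) by blast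
      have bb: "b' = b"
        using state_le_block[OF T S' le mem] state_below_self[OF T RT] RR by simp
      have "u \<noteq> u'"
      proof
        assume "u = u'"
        then have "a = a'" using eq(3) bb by simp
        then show False using neq e(2) e'(2) eq LL RR bb by simp
      qed
      moreover have "\<not> (u = 0 \<and> u' = 1)"
      proof
        assume uu: "u = 0 \<and> u' = 1"
        have "wsum (set T) (L \<union> R) = a + b + u" using lyn_run_min[OF run T] uu pu nth by simp
        moreover note run_below_Un(1)[OF T S1 RS e(4,5)]
        moreover have "wsum (set T) L \<le> a'"
          using state_le_block(1)[OF T S' le, of L' a'] e'(2) LL by simp
        ultimately show False
          using state_below_self[OF T RT] eq(3) bb uu by simp
      qed
      ultimately have "u = 1 \<and> u' = 0" using e(8) e'(8) by linarith
      then show ?thesis unfolding k k' True RR using R'n RR by (intro lex3_less) auto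
    qed
  qed
qed

text \<open>For three blocks obtained from one, the block with the largest minimum is split off
  first and the remaining two afterwards. The larger of the two colours comes first, which avoids
  blue over red; splits of disjoint blocks are put in order from right to left.\<close>

lemma lyn_exchange:
  assumes S2: "state n S2" and sp: "splits p u S S1" "splits q w S1 S2"
  shows "\<exists>S1' S2' p u q w. splits p u S S1' \<and> splits q w S1' S2' \<and> set S2' = set S2 \<and> lyn_adj S S1' S2'"
proof -
  obtain xs ys L a R b where e: "S = xs @ (L \<union> R, a + b + u) # ys" "S1 = xs @ (L, a) # (R, b) # ys"
    "p = length xs" "L \<inter> R = {}" "L \<noteq> {}" "R \<noteq> {}" "Min L < Min R" "u \<le> 1"
    using sp(1) by (rule splitsE)
  obtain xs2 ys2 L2 a2 R2 b2 where f: "S1 = xs2 @ (L2 \<union> R2, a2 + b2 + w) # ys2" "S2 = xs2 @ (L2, a2) # (R2, b2) # ys2"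
    "q = length xs2" "L2 \<inter> R2 = {}" "L2 \<noteq> {}" "R2 \<noteq> {}" "Min L2 < Min R2" "w \<le> 1"
    using sp(2) by (rule splitsE)
  have S1: "state n S1" by (rule splits_state(1)[OF sp(2) S2])
  have fin: "finite L" "finite R" "finite L2" "finite R2"
    using state_blocks(3)[OF S1, of "(L, a)"] state_blocks(3)[OF S1, of "(R, b)"]
      state_blocks(3)[OF S2, of "(L2, a2)"] state_blocks(3)[OF S2, of "(R2, b2)"] e(2) f(2) by auto
  define t m where tm: "t = max u w" "m = min u w"
  have tm': "t \<le> 1" "m \<le> 1" "t + m = u + w" "\<not> (t = 0 \<and> m = 1)" using e(8) f(8) by (auto simp: tm min_def max_def)
  have adjI: "lyn_adj S S1' S2'" if "splits p' t' S S1'" "splits q' m' S1' S2'" "q' \<le> p'"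
    "q' = p' \<Longrightarrow> Min (fst (S2' ! Suc p')) < Min (fst (S1' ! Suc p')) \<and> \<not> (t' = 0 \<and> m' = 1)" for p' t' q' m' S1' S2'
    using that by (auto simp: lyn_adj_def split_pos_col[OF that(1)] split_pos_col[OF that(2)])
  from e(2) f(1) have eq: "xs @ (L, a) # (R, b) # ys = xs2 @ (L2 \<union> R2, a2 + b2 + w) # ys2" by simp
  then show ?thesis
  proof (cases rule: split_list_cases)
    case (left zs)
    have "lyn_adj S S1 S2" using e(3) f(3) left(1) by (intro adjI[OF sp]) auto
    then show ?thesis using sp by blast
  next
    case first
    have LL: "L = L2 \<union> R2" "a = a2 + b2 + w" using first(2) by auto
    have disj: "R2 \<inter> R = {}" "L2 \<inter> R = {}" using LL e(4) by auto
    have mL: "Min L2 < Min R" using e(7) Min_Un_less[OF fin(3,4) f(5,6,7)] LL by simp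
    have "Min R2 < Min R \<or> Min R < Min R2" using fin e f disj(1) by (intro Min_less_cases) auto
    then show ?thesis
    proof
      assume less: "Min R2 < Min R"
      let ?S1 = "xs @ (L, a2 + b2 + m) # (R, b) # ys"
      have 1: "splits p t S ?S1" unfolding e(1) using e tm' LL by (intro splitsI) auto
      have 2: "splits p m ?S1 S2"
        unfolding f(2) first using f tm' LL e(3) by (intro splitsI) auto
      have n: "?S1 ! Suc p = (R, b)" "S2 ! Suc p = (R2, b2)"
        unfolding f(2) first e(3) by (simp_all only: splits_nth)
      have "lyn_adj S ?S1 S2" by (rule adjI[OF 1 2]) (use tm' less n in simp_all)
      with 1 2 show ?thesis by blast
    next
      assume less: "Min R < Min R2"
      let ?S1 = "xs @ (L2 \<union> R, a2 + b + m) # (R2, b2) # ys" and ?S2 = "xs @ (L2, a2) # (R, b) # (R2, b2) # ys"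
      have mn: "Min (L2 \<union> R) = Min L2" using fin(3,2) f(5) e(6) mL by (rule Min_Un_less)
      have 1: "splits p t S ?S1"
        unfolding e(1) using disj f(4,5,6,7) e(3) tm' LL mn by (intro splitsI) auto
      have 2: "splits p m ?S1 ?S2" using disj f(5) e(6) mL tm' e(3) by (intro splitsI) auto
      have n: "?S1 ! Suc p = (R2, b2)" "?S2 ! Suc p = (R, b)"
        unfolding e(3) by (simp_all only: splits_nth)
      have 3: "set ?S2 = set S2" unfolding f(2) first by auto
      have "lyn_adj S ?S1 ?S2" by (rule adjI[OF 1 2]) (use tm' less n in simp_all)
      with 1 2 3 show ?thesis by blast
    qed
  next
    case second
    have RR: "R = L2 \<union> R2" "b = a2 + b2 + w" using second(2) by auto
    have disj: "L \<inter> L2 = {}" "L \<inter> R2 = {}" using RR e(4) by auto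
    have mL: "Min L < Min L2" using e(7) Min_Un_less[OF fin(3,4) f(5,6,7)] RR by simp
    have mn: "Min (L \<union> L2) = Min L" using fin(1,3) e(5) f(5) mL by (rule Min_Un_less)
    let ?S1 = "xs @ (L \<union> L2, a + a2 + m) # (R2, b2) # ys"
    have 1: "splits p t S ?S1"
      unfolding e(1) using disj f(4,5,6,7) e(3,5) tm' RR mn mL by (intro splitsI) auto
    have S2': "S2 = xs @ (L, a) # (L2, a2) # (R2, b2) # ys" unfolding f(2) second by simp
    have 2: "splits p m ?S1 S2" unfolding S2' using disj f(5) e(5) mL tm' e(3) by (intro splitsI) auto
    have n: "?S1 ! Suc p = (R2, b2)" "S2 ! Suc p = (L2, a2)"
      unfolding S2' e(3) by (simp_all only: splits_nth)
    have "lyn_adj S ?S1 S2" by (rule adjI[OF 1 2]) (use tm' f(7) n in simp_all)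
    with 1 2 show ?thesis by blast
  next
    case (right zs)
    let ?S1 = "xs @ (L \<union> R, a + b + u) # zs @ (L2, a2) # (R2, b2) # ys2"
    have "splits (length (xs @ (L \<union> R, a + b + u) # zs)) w ((xs @ (L \<union> R, a + b + u) # zs) @ (L2 \<union> R2, a2 + b2 + w) # ys2)
        ((xs @ (L \<union> R, a + b + u) # zs) @ (L2, a2) # (R2, b2) # ys2)"
      using f by (intro splitsI) auto
    then have 1: "splits (length xs + 1 + length zs) w S ?S1" unfolding e(1) right(1) by simp
    have 2: "splits (length xs) u ?S1 S2"
      unfolding f(2) right(2) append_assoc append_Cons using e by (intro splitsI) auto
    have "lyn_adj S ?S1 S2" by (rule adjI[OF 1 2]) simp_all
    with 1 2 show ?thesis by blast
  qed
qed

section \<open>Maximal chains of weighted partitions\<close>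

lemma card_wp_le:
  assumes "\<alpha> \<in> weighted_partitions n"
  shows "card \<alpha> \<le> n"
proof -
  have inj: "inj_on (\<lambda>p. Min (fst p)) \<alpha>"
  proof (rule inj_onI)
    fix p q assume pq: "p \<in> \<alpha>" "q \<in> \<alpha>" "Min (fst p) = Min (fst q)"
    have "Min (fst p) \<in> fst p" "Min (fst q) \<in> fst q"
      using wp_block(1,3)[OF assms pq(1)] wp_block(1,3)[OF assms pq(2)] by (simp_all only: Min_in not_False_eq_True)
    then show "p = q" using wp_disjoint[OF assms pq(1,2), of "Min (fst p)"] pq(3) by simp
  qed
  have "(\<lambda>p. Min (fst p)) ` \<alpha> \<subseteq> {1..n}"
  proof (rule image_subsetI)
    fix p assume p: "p \<in> \<alpha>"
    show "Min (fst p) \<in> {1..n}" using Min_in[OF wp_block(3,1)[OF assms p]] wp_block(2)[OF assms p] by (rule subsetD[rotated])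
  qed
  then have "card ((\<lambda>p. Min (fst p)) ` \<alpha>) \<le> card {1..n}" by (intro card_mono) simp_all
  then show ?thesis using card_image[OF inj] by simp
qed

lemma wp_bot_in: "wp_bot n \<in> weighted_partitions n"
  unfolding weighted_partitions_iff
proof (intro conjI ballI impI)
  show "{1..n} \<subseteq> (\<Union>p\<in>wp_bot n. fst p)" by (force simp: wp_bot_def)
qed (auto simp: wp_bot_def)

lemma card_wp_bot: "card (wp_bot n) = n"
  unfolding wp_bot_def by (subst card_image) (auto simp: inj_on_def)

lemma wp_bot_le:
  assumes "\<alpha> \<in> weighted_partitions n"
  shows "wp_le n (wp_bot n) \<alpha>"
  unfolding wp_le_iff[OF wp_bot_in assms]
proof (intro conjI ballI)
  fix p assume "p \<in> wp_bot n"
  then obtain i where "i \<in> {1..n}" "fst p = {i}" by (auto simp: wp_bot_def)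
  moreover then obtain q where "q \<in> \<alpha>" "i \<in> fst q" using wp_cover[OF assms, of i] by blast
  ultimately show "\<exists>q\<in>\<alpha>. fst p \<subseteq> fst q" by (intro bexI[of _ q]) simp_all
next
  fix q assume q: "q \<in> \<alpha>"
  have b: "below (wp_bot n) (fst q) = (\<lambda>i. ({i}, 0)) ` fst q"
    using wp_block(2)[OF assms q] by (auto simp: below_def wp_bot_def)
  have "card (below (wp_bot n) (fst q)) = card (fst q)"
    unfolding b by (subst card_image) (auto simp: inj_on_def)
  moreover have "wsum (wp_bot n) (fst q) = 0" unfolding wsum_def b by (intro sum.neutral) auto
  ultimately show "wsum (wp_bot n) (fst q) \<le> snd q"
    "snd q < wsum (wp_bot n) (fst q) + card (below (wp_bot n) (fst q))"
    using wp_block(4)[OF assms q] by simp_all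
qed

lemma card_eq_bot:
  assumes "\<alpha> \<in> weighted_partitions n" "card \<alpha> = n"
  shows "\<alpha> = wp_bot n"
  using wp_le_card(2)[OF wp_bot_in assms(1) wp_bot_le[OF assms(1)]] assms(2) card_wp_bot[of n] by simp

lemma card_eq_one:
  assumes "\<alpha> \<in> weighted_partitions n" "card \<alpha> = 1"
  obtains i where "\<alpha> = {({1..n}, i)}" "i < n"
proof -
  obtain p where p: "\<alpha> = {p}" using assms(2) by (auto simp: card_1_singleton_iff)
  have "{1..n} \<subseteq> fst p" using assms(1)[unfolded weighted_partitions_iff] p by simp
  moreover have "fst p \<subseteq> {1..n}" using wp_block(2)[OF assms(1)] p by simp
  ultimately have f: "fst p = {1..n}" by (rule antisym[rotated])
  moreover have "snd p < card (fst p)" using wp_block(4)[OF assms(1)] p by simp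
  ultimately have "snd p < n" by simp
  moreover have "\<alpha> = {({1..n}, snd p)}" unfolding p f[symmetric] by simp
  ultimately show ?thesis by (rule that[rotated])
qed

lemma top_in: "i < n \<Longrightarrow> {({1..n}, i)} \<in> weighted_partitions n"
  unfolding weighted_partitions_iff by auto

section \<open>Maximal chains indexed from the top\<close>

definition down_chain :: "nat \<Rightarrow> (nat \<Rightarrow> wpartition) \<Rightarrow> bool" where
  "down_chain n t \<longleftrightarrow> (\<forall>k<n. t k \<in> weighted_partitions n \<and> card (t k) = Suc k) \<and>
    (\<forall>k. Suc k < n \<longrightarrow> wp_le n (t (Suc k)) (t k))"

lemma down_chain_le:
  assumes "down_chain n t" "j \<le> k" "k < n"
  shows "wp_le n (t k) (t j)"
  using assms(2,3)
proof (induction k rule: dec_induct)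
  case base
  then show ?case using assms(1) wp_le_refl by (simp add: down_chain_def)
next
  case (step k)
  then show ?case
    using assms(1) wp_le_trans[of "t (Suc k)" n "t k" "t j"] by (simp add: down_chain_def)
qed

text \<open>The entries of a chain in \<open>\<Pi>\<^sub>n\<^sup>w - {0}\<close> indexed from the top, followed by the minimum.\<close>

definition from_top :: "nat \<Rightarrow> wpartition list \<Rightarrow> nat \<Rightarrow> wpartition" where
  "from_top n c k = (if k < n - 1 then c ! (n - 2 - k) else wp_bot n)"

abbreviation max_chains :: "nat \<Rightarrow> wpartition list set" where
  "max_chains n \<equiv> poset_chains (weighted_partitions n - {wp_bot n}) (wp_le n) (int n - 2)"

lemma nth_from_top:
  assumes "i < n - 1"
  shows "c ! i = from_top n c (n - 2 - i)"
proof -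
  have "n - 2 - (n - 2 - i) = i" "n - 2 - i < n - 1" using assms by arith+
  then show ?thesis unfolding from_top_def by simp
qed

text \<open>The \<open>n - 1\<close> numbers of blocks strictly decrease, start below
  \<open>n\<close> because only the removed minimum has \<open>n\<close> blocks, and end at 1 or
  more. So they take every value from \<open>n - 1\<close> to 1.\<close>

lemma max_chains_iff:
  assumes n: "2 \<le> n"
  shows "c \<in> max_chains n \<longleftrightarrow> length c = n - 1 \<and> down_chain n (from_top n c)"
proof
  assume c: "c \<in> max_chains n"
  then have "int (length c) = int n - 1" by (simp add: poset_chains_def)
  then have len: "length c = n - 1" using n by arith
  have W: "c ! i \<in> weighted_partitions n" "c ! i \<noteq> wp_bot n" if "i < n - 1" for i
    using c that len by (auto simp: poset_chains_def subset_iff)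
  have le: "wp_le n (c ! i) (c ! j)" "c ! i \<noteq> c ! j" if "i < j" "j < n - 1" for i j
    using c that len by (auto simp: poset_chains_def sorted_wrt_iff_nth_less)
  have dec: "card (c ! j) + (j - i) \<le> card (c ! i)" if "i \<le> j" "j < n - 1" for i j
    using that
  proof (induction j rule: dec_induct)
    case (step j)
    have "card (c ! Suc j) < card (c ! j)"
      using wp_le_antisym_card[OF W(1) W(1) le, of j "Suc j"] step by simp
    then show ?case using step by simp
  qed simp
  have card: "card (c ! i) = n - 1 - i" if i: "i < n - 1" for i
  proof -
    have "card (c ! 0) \<noteq> n" "card (c ! 0) \<le> n" using W[of 0] card_eq_bot card_wp_le n by auto
    then have "card (c ! i) \<le> n - 1 - i" using dec[of 0 i] i by simp
    moreover have "card (c ! (n - 2)) \<noteq> 0"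
    proof -
      have W2: "c ! (n - 2) \<in> weighted_partitions n" using W(1)[of "n - 2"] n by simp
      obtain p where "p \<in> c ! (n - 2)" "1 \<in> fst p" by (rule wp_cover[OF W2, of 1]) (use n in simp)
      then show ?thesis using finite_wp[OF W2] by auto
    qed
    moreover have "i \<le> n - 2" "n - 2 < n - 1" using i by arith+
    note dec[OF this]
    ultimately show ?thesis using i by linarith
  qed
  show "length c = n - 1 \<and> down_chain n (from_top n c)"
    unfolding down_chain_def
  proof (intro conjI allI impI len)
    fix k assume k: "k < n"
    show "from_top n c k \<in> weighted_partitions n"
      using W(1)[of "n - 2 - k"] wp_bot_in n by (simp add: from_top_def)
    show "card (from_top n c k) = Suc k"
      using card[of "n - 2 - k"] card_wp_bot k n by (auto simp: from_top_def)
  next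
    fix k assume k: "Suc k < n"
    show "wp_le n (from_top n c (Suc k)) (from_top n c k)"
    proof (cases "Suc k < n - 1")
      case True
      then show ?thesis using le(1)[of "n - 2 - Suc k" "n - 2 - k"] by (simp add: from_top_def)
    next
      case False
      then show ?thesis using k W(1)[of "n - 2 - k"] wp_bot_le by (simp add: from_top_def)
    qed
  qed
next
  assume r: "length c = n - 1 \<and> down_chain n (from_top n c)"
  note nth = nth_from_top[of _ n c]
  have 1: "c ! i \<in> weighted_partitions n" "card (c ! i) = n - 1 - i" if "i < n - 1" for i
    using r that unfolding nth[OF that] down_chain_def by auto
  have "c ! i \<noteq> wp_bot n" if "i < n - 1" for i using 1(2)[OF that] card_wp_bot[of n] that n by auto
  then have "set c \<subseteq> weighted_partitions n - {wp_bot n}" using 1(1) r by (auto simp: in_set_conv_nth)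
  moreover have "wp_le n (c ! i) (c ! j) \<and> c ! i \<noteq> c ! j" if "i < j" "j < n - 1" for i j
  proof -
    have "wp_le n (c ! i) (c ! j)"
      unfolding nth[OF that(2)] nth[OF less_trans[OF that]] using r that by (intro down_chain_le) auto
    moreover have "card (c ! i) \<noteq> card (c ! j)" using 1(2) that by simp
    ultimately show ?thesis by auto
  qed
  ultimately show "c \<in> max_chains n"
    using r n by (auto simp: poset_chains_def sorted_wrt_iff_nth_less)
qed

lemma from_top_update:
  "i < length c \<Longrightarrow> length c = n - 1 \<Longrightarrow> from_top n (c[i := x]) = (from_top n c)(n - 2 - i := x)"
  by (rule ext) (auto simp: from_top_def nth_list_update)

text \<open>The choices are only apparent. The top is a single block, and each next list is forced
  by the one above it, so level \<open>k\<close> of the lift depends only on levels up to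
  \<open>k\<close>.\<close>

primrec lift :: "nat \<Rightarrow> (nat \<Rightarrow> wpartition) \<Rightarrow> nat \<Rightarrow> ostate" where
  "lift n t 0 = (SOME S. state n S \<and> set S = t 0)"
| "lift n t (Suc k) = (SOME S. state n S \<and> set S = t (Suc k) \<and> (\<exists>p u. splits p u (lift n t k) S))"

declare lift.simps [simp del]

lemma lift_state:
  assumes "down_chain n t" "k < n"
  shows "state n (lift n t k) \<and> set (lift n t k) = t k"
    "Suc k < n \<Longrightarrow> \<exists>p u. splits p u (lift n t k) (lift n t (Suc k))"
proof -
  have succ: "state n (lift n t (Suc k)) \<and> set (lift n t (Suc k)) = t (Suc k) \<and>
      (\<exists>p u. splits p u (lift n t k) (lift n t (Suc k)))"
    if k: "Suc k < n" and s: "state n (lift n t k)" "set (lift n t k) = t k" for k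
  proof -
    have "t (Suc k) \<in> weighted_partitions n" "wp_le n (t (Suc k)) (set (lift n t k))"
      "card (t (Suc k)) = Suc (length (lift n t k))"
    proof -
      have c: "card (t (Suc k)) = Suc (Suc k)" "card (t k) = Suc k"
        using assms(1) k by (simp_all add: down_chain_def)
      show "t (Suc k) \<in> weighted_partitions n" "wp_le n (t (Suc k)) (set (lift n t k))"
        unfolding s(2) using assms(1) k by (simp_all add: down_chain_def)
      show "card (t (Suc k)) = Suc (length (lift n t k))" using c state_card[OF s(1)] s(2) by simp
    qed
    from splits_cover[OF s(1) this] have "\<exists>S. state n S \<and> set S = t (Suc k) \<and> (\<exists>p u. splits p u (lift n t k) S)"
      by metis
    from someI_ex[OF this] show ?thesis by (simp add: lift.simps)
  qed
  have *: "state n (lift n t k) \<and> set (lift n t k) = t k" if "k < n" for k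
    using that
  proof (induction k)
    case 0
    have W: "t 0 \<in> weighted_partitions n" using assms(1) 0 by (simp add: down_chain_def)
    obtain S where "set S = t 0" "distinct S" using finite_distinct_list[OF finite_wp[OF W]] by blast
    then have "\<exists>S. state n S \<and> set S = t 0" using W by (auto simp: state_def)
    from someI_ex[OF this] show ?case by (simp add: lift.simps)
  next
    case (Suc k)
    then show ?case using succ[of k] by simp
  qed
  show "state n (lift n t k) \<and> set (lift n t k) = t k" using * assms(2) .
  show "Suc k < n \<Longrightarrow> \<exists>p u. splits p u (lift n t k) (lift n t (Suc k))"
    using succ[of k] *[of k] by simp
qed

lemma lift_splits:
  assumes "down_chain n t" "Suc k < n"
  obtains p u where "splits p u (lift n t k) (lift n t (Suc k))"
  using lift_state(2)[OF assms(1) Suc_lessD[OF assms(2)] assms(2)] by blast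

lemma lift_cong:
  assumes "\<And>j. j \<le> k \<Longrightarrow> t j = t' j"
  shows "lift n t k = lift n t' k"
  using assms by (induction k) (simp_all add: lift.simps)

lemma lift_unique:
  assumes t: "down_chain n t" and m: "m < n"
    and S: "\<And>j. j \<le> m \<Longrightarrow> state n (S j) \<and> set (S j) = t j"
    and sp: "\<And>j. j < m \<Longrightarrow> \<exists>p u. splits p u (S j) (S (Suc j))"
    and "j \<le> m"
  shows "lift n t j = S j"
  using assms(5)
proof (induction j)
  case 0
  have s: "state n (S 0)" "set (S 0) = t 0" using S by auto
  have l: "state n (lift n t 0)" "set (lift n t 0) = t 0" using lift_state(1)[OF t, of 0] m by auto
  have "card (t 0) = 1" using t m by (simp add: down_chain_def)
  then have "length (S 0) = 1" "length (lift n t 0) = 1"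
    using state_card[OF s(1)] s(2) state_card[OF l(1)] l(2) by simp_all
  then obtain x y where "S 0 = [x]" "lift n t 0 = [y]" by (auto simp: length_Suc_conv)
  then have "{x} = {y}" using s(2) l(2) by simp
  then show ?case using \<open>S 0 = [x]\<close> \<open>lift n t 0 = [y]\<close> by simp
next
  case (Suc j)
  have l: "state n (lift n t (Suc j))" "set (lift n t (Suc j)) = t (Suc j)"
    using lift_state(1)[OF t, of "Suc j"] Suc.prems m by auto
  obtain p u where p: "splits p u (lift n t j) (lift n t (Suc j))"
    using lift_state(2)[OF t, of j] Suc.prems m by auto
  obtain q w where q: "splits q w (S j) (S (Suc j))" using sp[of j] Suc.prems by auto
  have "lift n t j = S j" using Suc by simp
  then have p': "splits p u (S j) (lift n t (Suc j))" using p by simp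
  have s: "state n (S (Suc j))" "set (lift n t (Suc j)) = set (S (Suc j))" using S[OF Suc.prems] l(2) by simp_all
  show ?case by (rule splits_unique[OF l(1) s(1) p' q s(2)])
qed

lemma lift_top:
  assumes "down_chain n t" "0 < n"
  obtains i where "lift n t 0 = [({1..n}, i)]" "t 0 = {({1..n}, i)}" "i < n"
proof -
  have l: "state n (lift n t 0)" "set (lift n t 0) = t 0" using lift_state(1)[OF assms] by auto
  have "card (t 0) = 1" "t 0 \<in> weighted_partitions n" using assms by (auto simp: down_chain_def)
  then obtain i where i: "t 0 = {({1..n}, i)}" "i < n" using card_eq_one by metis
  have "length (lift n t 0) = 1" using state_card[OF l(1)] l(2) i by simp
  then obtain x where "lift n t 0 = [x]" by (auto simp: length_Suc_conv)
  then show ?thesis using that[of i] l(2) i by simp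
qed

text \<open>The common interface of the two rules. The top level has no split above it, so its
  leading condition is the colour \<open>top_col\<close> of the first split and its key depends on
  the top weight; \<open>top_max\<close> replaces \<open>key_max\<close> there.\<close>

locale split_rule =
  fixes n :: nat and adj :: "ostate \<Rightarrow> ostate \<Rightarrow> ostate \<Rightarrow> bool" and key :: "ostate \<Rightarrow> ostate \<Rightarrow> nat"
    and top_col :: nat and top_key :: "nat \<Rightarrow> nat"
  assumes n: "2 \<le> n" and top_col: "top_col \<le> 1"
    and key_max: "\<lbrakk>run adj S S1 T; state n T; splits p u S S'; state n S'; wp_le n (set T) (set S'); S' \<noteq> S1\<rbrakk>
      \<Longrightarrow> key S S' < key S S1"
    and top_max: "\<lbrakk>run adj [({1..n}, i)] S1 T; split_col [({1..n}, i)] S1 = top_col; state n T;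
      wp_le n (set T) {({1..n}, i')}; i' < n; i' \<noteq> i\<rbrakk> \<Longrightarrow> top_key i' < top_key i"
    and exchange: "\<lbrakk>state n S2; splits p u S S1; splits q w S1 S2\<rbrakk> \<Longrightarrow>
      \<exists>S1' S2' p u q w. splits p u S S1' \<and> splits q w S1' S2' \<and> set S2' = set S2 \<and> adj S S1' S2'"
begin

lemma n_pos: "0 < n"
  using n by simp

definition lead_at :: "(nat \<Rightarrow> wpartition) \<Rightarrow> nat \<Rightarrow> bool" where
  "lead_at t k = (case k of 0 \<Rightarrow> split_col (lift n t 0) (lift n t 1) = top_col
    | Suc j \<Rightarrow> adj (lift n t j) (lift n t k) (lift n t (Suc k)))"

definition key_at :: "(nat \<Rightarrow> wpartition) \<Rightarrow> nat \<Rightarrow> nat" where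
  "key_at t k = (case k of 0 \<Rightarrow> top_key (snd (hd (lift n t 0))) | Suc j \<Rightarrow> key (lift n t j) (lift n t k))"

definition key_less :: "wpartition list \<Rightarrow> wpartition list \<Rightarrow> bool" where
  "key_less c' c \<longleftrightarrow> (\<exists>k. (\<forall>j<k. key_at (from_top n c') j = key_at (from_top n c) j) \<and>
    key_at (from_top n c') k < key_at (from_top n c) k)"

lemma down_chain_update:
  assumes t: "down_chain n t" and k: "Suc k < n" and x: "x \<in> weighted_partitions n" "card x = Suc k"
    and le: "wp_le n (t (Suc k)) x" "0 < k \<Longrightarrow> wp_le n x (t (k - 1))"
  shows "down_chain n (t(k := x))"
  unfolding down_chain_def
proof (intro conjI allI impI)
  fix j assume "j < n"
  then show "(t(k := x)) j \<in> weighted_partitions n" "card ((t(k := x)) j) = Suc j"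
    using t x by (auto simp: down_chain_def)
next
  fix j assume "Suc j < n"
  then show "wp_le n ((t(k := x)) (Suc j)) ((t(k := x)) j)"
    using t le by (auto simp: down_chain_def)
qed

text \<open>At the top only the weight is changed. At a lower level the two splits around it are
  exchanged. This may reorder the blocks at level \<open>k + 1\<close> and below, which is harmless
  because \<open>lead_at\<close> at \<open>k\<close> inspects nothing below level
  \<open>k + 1\<close>.\<close>

lemma lead_exists:
  assumes t: "down_chain n t" and k: "Suc k < n"
  shows "\<exists>x. down_chain n (t(k := x)) \<and> lead_at (t(k := x)) k"
proof (cases k)
  case 0
  obtain i where i: "lift n t 0 = [({1..n}, i)]" "t 0 = {({1..n}, i)}" using lift_top[OF t n_pos] by blast
  have l1: "state n (lift n t 1)" "set (lift n t 1) = t 1" using lift_state(1)[OF t, of 1] n by auto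
  obtain p u where "splits p u [({1..n}, i)] (lift n t 1)" using lift_state(2)[OF t, of 0] n i by auto
  then obtain xs ys L a R b where e: "[({1..n}, i)] = xs @ (L \<union> R, a + b + u) # ys" "lift n t 1 = xs @ (L, a) # (R, b) # ys"
    "p = length xs" "L \<inter> R = {}" "L \<noteq> {}" "R \<noteq> {}" "Min L < Min R" "u \<le> 1"
    by (rule splitsE)
  have xy: "xs = []" "ys = []" "{1..n} = L \<union> R" using e(1) by (auto simp: Cons_eq_append_conv)
  \<comment> \<open>With this weight the given blocks \<open>L\<close> and \<open>R\<close> arise by
    a first split of colour \<open>top_col\<close>.\<close>
  let ?S = "[({1..n}, a + b + top_col)]"
  have "splits (length []) top_col ([] @ ({1..n}, a + b + top_col) # []) ([] @ (L, a) # (R, b) # [])"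
    by (rule splitsI) (use e xy top_col in auto)
  then have sp: "splits 0 top_col ?S (lift n t 1)" unfolding e(2) xy by simp
  have S: "state n ?S" "wp_le n (t 1) (set ?S)" using splits_state[OF sp l1(1)] l1(2) by auto
  have dc: "down_chain n (t(0 := set ?S))"
    using S n by (intro down_chain_update[OF t]) (auto simp: state_def)
  have "lift n (t(0 := set ?S)) j = (if j = 0 then ?S else lift n t 1)" if "j \<le> 1" for j
  proof (rule lift_unique[OF dc _ _ _ that])
    show "1 < n" using n by simp
    show "state n (if j = 0 then ?S else lift n t 1) \<and> set (if j = 0 then ?S else lift n t 1) = (t(0 := set ?S)) j"
      if "j \<le> 1" for j using that S(1) l1 by (cases "j = 0") (auto simp: le_Suc_eq)
    show "\<exists>p u. splits p u (if j = 0 then ?S else lift n t 1) (if Suc j = 0 then ?S else lift n t 1)" if "j < 1" for j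
      using that sp by auto
  qed
  from this[of 0] this[of 1] have "lift n (t(0 := set ?S)) 0 = ?S" "lift n (t(0 := set ?S)) 1 = lift n t 1"
    by simp_all
  then have "lead_at (t(0 := set ?S)) 0"
    unfolding lead_at_def using split_pos_col(2)[OF sp] by simp
  then show ?thesis using dc 0 by blast
next
  case (Suc j)
  let ?S = "lift n t j" and ?S1 = "lift n t k" and ?S2 = "lift n t (Suc k)"
  have st: "state n ?S2" "set ?S2 = t (Suc k)" "set ?S = t j" "state n ?S"
    using lift_state(1)[OF t] k Suc by auto
  obtain p u q w where "splits p u ?S ?S1" "splits q w ?S1 ?S2"
    using lift_state(2)[OF t, of j] lift_state(2)[OF t, of k] k Suc by auto
  from exchange[OF st(1) this] obtain S1 S2 p u q w where
    ex: "splits p u ?S S1" "splits q w S1 S2" "set S2 = set ?S2" "adj ?S S1 S2" by blast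
  have S2: "state n S2"
    using st ex length_splits[OF ex(1)] length_splits[OF ex(2)] state_card[OF st(1)] state_card[OF st(4)] t k Suc
    by (intro stateI) (auto simp: state_def down_chain_def)
  have S1: "state n S1" "wp_le n (t (Suc k)) (set S1)" using splits_state[OF ex(2) S2] ex(3) st(2) by auto
  have le: "wp_le n (set S1) (t j)" using splits_state(2)[OF ex(1) S1(1)] st(3) by simp
  have card: "card (set S1) = Suc k"
    using state_card[OF S1(1)] length_splits[OF ex(1)] state_card[OF st(4)] st(3) t k Suc by (simp add: down_chain_def)
  let ?t = "t(k := set S1)"
  have dc: "down_chain n ?t"
    using S1 card le k Suc by (intro down_chain_update[OF t]) (auto simp: state_def)
  \<comment> \<open>The lift of the modified chain: unchanged above \<open>k\<close>, and given by
    the exchanged pair at \<open>k\<close> and \<open>k + 1\<close>.\<close>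
  let ?L = "\<lambda>i. if i < k then lift n t i else if i = k then S1 else S2"
  have "lift n ?t i = ?L i" if "i \<le> Suc k" for i
  proof (rule lift_unique[OF dc k _ _ that])
    fix i assume i: "i \<le> Suc k"
    consider "i < k" | "i = k" | "i = Suc k" using i by linarith
    then show "state n (?L i) \<and> set (?L i) = ?t i"
    proof cases
      case 1 then show ?thesis using lift_state(1)[OF t, of i] k by simp
    next
      case 2 then show ?thesis using S1 by simp
    next
      case 3 then show ?thesis using S2 ex(3) st(2) by simp
    qed
  next
    fix i assume i: "i < Suc k"
    consider "Suc i < k" | "Suc i = k" | "i = k" using i by linarith
    then show "\<exists>p u. splits p u (?L i) (?L (Suc i))"
    proof cases
      case 1 then show ?thesis using lift_state(2)[OF t, of i] k by simp
    next
      case 2 then show ?thesis using ex(1) Suc by auto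
    next
      case 3 then show ?thesis using ex(2) by auto
    qed
  qed
  from this[of j] this[of k] this[of "Suc k"] have "lead_at ?t k"
    using ex(4) Suc unfolding lead_at_def by simp
  then show ?thesis using dc by blast
qed

text \<open>Let \<open>k\<close> be the first level where the chains differ and \<open>m\<close> the
  next level where they agree. All levels between differ and so are leading; they form a run ending
  at a partition that also lies below the competitor's level \<open>k\<close>, and the local
  maximality applies.\<close>

lemma lead_key_max:
  assumes t: "down_chain n t" and t': "down_chain n t'" and neq: "\<exists>k<n - 1. t k \<noteq> t' k" and eq: "t (n - 1) = t' (n - 1)"
    and lead: "\<And>k. k < n - 1 \<Longrightarrow> t k \<noteq> t' k \<Longrightarrow> lead_at t k"
  shows "\<exists>k. (\<forall>j<k. key_at t' j = key_at t j) \<and> key_at t' k < key_at t k"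
proof -
  define k where "k = (LEAST k. k < n - 1 \<and> t k \<noteq> t' k)"
  have k: "k < n - 1" "t k \<noteq> t' k" using neq LeastI_ex[of "\<lambda>k. k < n - 1 \<and> t k \<noteq> t' k"] by (auto simp: k_def)
  have before: "t j = t' j" if "j < k" for j
    using not_less_Least[of j "\<lambda>k. k < n - 1 \<and> t k \<noteq> t' k"] that k(1) by (auto simp: k_def)
  define m where "m = (LEAST m. k < m \<and> t m = t' m)"
  have m: "k < m" "t m = t' m" using LeastI[of "\<lambda>m. k < m \<and> t m = t' m" "n - 1"] k(1) eq by (auto simp: m_def)
  have mn: "m \<le> n - 1" unfolding m_def using k(1) eq by (intro Least_le) simp
  have diff: "t j \<noteq> t' j" if "k \<le> j" "j < m" for j
    using not_less_Least[of j "\<lambda>m. k < m \<and> t m = t' m"] that k(2) by (auto simp: m_def le_less)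
  have leads: "lead_at t j" if "k \<le> j" "j < m" for j using lead[of j] diff[OF that] that mn by simp
  \<comment> \<open>The run has to start one level above \<open>k\<close> when \<open>k\<close> is
    positive, whence the bound \<open>k \<le> Suc j\<close>.\<close>
  have run: "run adj (lift n t j) (lift n t (Suc j)) (lift n t m)" if "k \<le> Suc j" "j < m" for j
    using that
  proof (induction "m - j" arbitrary: j)
    case (Suc d)
    have "Suc j < n" using Suc.prems mn by arith
    then obtain p u where sp: "splits p u (lift n t j) (lift n t (Suc j))" by (rule lift_splits[OF t])
    show ?case
    proof (cases "Suc j = m")
      case True
      then show ?thesis using run.base[OF sp] by simp
    next
      case False
      then have j: "Suc j < m" using Suc.prems by simp
      have "run adj (lift n t (Suc j)) (lift n t (Suc (Suc j))) (lift n t m)"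
        using Suc.hyps Suc.prems j by simp
      moreover have "adj (lift n t j) (lift n t (Suc j)) (lift n t (Suc (Suc j)))"
        using leads[of "Suc j"] Suc.prems j by (simp add: lead_at_def)
      ultimately show ?thesis by (rule run.step[OF sp])
    qed
  qed simp
  have stm: "state n (lift n t m)" "set (lift n t m) = t m" using lift_state(1)[OF t, of m] mn n by auto
  have lem: "wp_le n (t m) (t' k)" using down_chain_le[OF t', of k m] m mn n by simp
  have lifts: "lift n t j = lift n t' j" if "j < k" for j
    by (rule lift_cong) (use before that in auto)
  have keys: "key_at t' j = key_at t j" if "j < k" for j
    using that lifts by (auto simp: key_at_def split: nat.splits)
  have "key_at t' k < key_at t k"
  proof (cases k)
    case 0
    obtain i where i: "lift n t 0 = [({1..n}, i)]" "t 0 = {({1..n}, i)}" "i < n" using lift_top[OF t n_pos] by blast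
    obtain i' where i': "lift n t' 0 = [({1..n}, i')]" "t' 0 = {({1..n}, i')}" "i' < n" using lift_top[OF t' n_pos] by blast
    have "top_key i' < top_key i"
    proof (rule top_max[OF _ _ stm(1)])
      show "run adj [({1..n}, i)] (lift n t 1) (lift n t m)" using run[of 0] 0 m i(1) by simp
      show "split_col [({1..n}, i)] (lift n t 1) = top_col" using leads[of 0] 0 m i(1) by (simp add: lead_at_def)
      show "wp_le n (set (lift n t m)) {({1..n}, i')}" using lem stm(2) i'(2) 0 by simp
      show "i' \<noteq> i" using k(2) 0 i(2) i'(2) by auto
    qed (rule i'(3))
    then show ?thesis using 0 i i' by (simp add: key_at_def)
  next
    case (Suc j)
    have l': "state n (lift n t' k)" "set (lift n t' k) = t' k" using lift_state(1)[OF t', of k] k by auto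
    have l: "set (lift n t k) = t k" using lift_state(1)[OF t, of k] k by auto
    have "Suc j < n" using k(1) Suc by arith
    then obtain p u where "splits p u (lift n t' j) (lift n t' k)" unfolding Suc by (rule lift_splits[OF t'])
    then have sp: "splits p u (lift n t j) (lift n t' k)" using lifts[of j] Suc by simp
    have "key (lift n t j) (lift n t' k) < key (lift n t j) (lift n t k)"
    proof (rule key_max[OF _ stm(1) sp l'(1)])
      show "run adj (lift n t j) (lift n t k) (lift n t m)" using run[of j] Suc m by simp
      show "wp_le n (set (lift n t m)) (set (lift n t' k))" using lem stm(2) l'(2) by simp
      show "lift n t' k \<noteq> lift n t k" using l l'(2) k(2) by auto
    qed
    then show ?thesis using Suc lifts[of j] by (simp add: key_at_def)
  qed
  then show ?thesis using keys by blast
qed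

text \<open>List positions count from the bottom and levels from the top: position \<open>i\<close>
  is level \<open>n - 2 - i\<close>, and its entry has \<open>n - 1 - i\<close> blocks.\<close>

sublocale leading_positions "max_chains n" "n - 1" "\<lambda>\<alpha>. n - 1 - card \<alpha>"
  "\<lambda>c i. lead_at (from_top n c) (n - 2 - i)" key_less
proof
  show "finite (max_chains n)" by (rule finite_poset_chains) (simp add: finite_weighted_partitions)
next
  fix c assume c: "c \<in> max_chains n"
  then show len: "length c = n - 1" using max_chains_iff[OF n] by blast
  fix i assume i: "i < n - 1"
  have dc: "down_chain n (from_top n c)" using c max_chains_iff[OF n] by blast
  have i': "n - 2 - i < n" "Suc (n - 2 - i) < n" "n - 1 - Suc (n - 2 - i) = i" using i by arith+
  have "card (c ! i) = Suc (n - 2 - i)" unfolding nth_from_top[OF i] using dc i'(1) by (simp only: down_chain_def)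
  then show "n - 1 - card (c ! i) = i" using i'(3) by simp
  obtain x where x: "down_chain n ((from_top n c)(n - 2 - i := x))" "lead_at ((from_top n c)(n - 2 - i := x)) (n - 2 - i)"
    using lead_exists[OF dc i'(2)] by blast
  have "from_top n (c[i := x]) = (from_top n c)(n - 2 - i := x)" using from_top_update i len by simp
  then show "\<exists>x. c[i := x] \<in> max_chains n \<and> lead_at (from_top n (c[i := x])) (n - 2 - i)"
    using x len max_chains_iff[OF n, of "c[i := x]"] by (intro exI[of _ x]) simp
next
  fix c c' assume c: "c \<in> max_chains n" "c' \<in> max_chains n" "c \<noteq> c'"
    and lead: "\<And>i. i < n - 1 \<Longrightarrow> c ! i \<noteq> c' ! i \<Longrightarrow> lead_at (from_top n c) (n - 2 - i)"
  have dc: "down_chain n (from_top n c)" "down_chain n (from_top n c')" and len: "length c = n - 1" "length c' = n - 1"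
    using c max_chains_iff[OF n] by auto
  obtain i where i: "i < n - 1" "c ! i \<noteq> c' ! i" using c(3) len by (metis nth_equalityI)
  show "key_less c' c" unfolding key_less_def
  proof (rule lead_key_max[OF dc])
    show "\<exists>k<n - 1. from_top n c k \<noteq> from_top n c' k"
    proof (intro exI conjI)
      show "n - 2 - i < n - 1" using i(1) by arith
      show "from_top n c (n - 2 - i) \<noteq> from_top n c' (n - 2 - i)"
        using i(2) unfolding nth_from_top[OF i(1)] .
    qed
    show "from_top n c (n - 1) = from_top n c' (n - 1)" by (simp add: from_top_def)
    fix k assume k: "k < n - 1" "from_top n c k \<noteq> from_top n c' k"
    have k': "n - 2 - k < n - 1" "n - 2 - (n - 2 - k) = k" using k(1) by arith+
    show "lead_at (from_top n c) k"
      using lead[OF k'(1)] k(2) unfolding nth_from_top[OF k'(1)] k'(2) by blast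
  qed
next
  fix a b c assume "key_less a b" "key_less b c"
  then obtain k l where k: "\<forall>j<k. key_at (from_top n a) j = key_at (from_top n b) j" "key_at (from_top n a) k < key_at (from_top n b) k"
    and l: "\<forall>j<l. key_at (from_top n b) j = key_at (from_top n c) j" "key_at (from_top n b) l < key_at (from_top n c) l"
    unfolding key_less_def by blast
  show "key_less a c" unfolding key_less_def
  proof (intro exI conjI allI impI)
    show "key_at (from_top n a) j = key_at (from_top n c) j" if "j < min k l" for j using k(1) l(1) that by simp
    show "key_at (from_top n a) (min k l) < key_at (from_top n c) (min k l)"
      using k l by (cases k l rule: linorder_cases) (auto simp: min_def)
  qed
next
  show "\<not> key_less c c" for c by (simp add: key_less_def)
qed

end

section \<open>Expanding forests\<close>

text \<open>The weight of the block formed by the leaves of the tree: leaves start at weight 0 and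
  each red merge adds 1.\<close>

fun reds :: "bitree \<Rightarrow> nat" where
  "reds (Leaf a) = 0"
| "reds (Node c l r) = reds l + reds r + color_weight c"

definition weighted_leaves :: "bitree \<Rightarrow> nat set \<times> nat" where
  "weighted_leaves t = (set (leaves t), reds t)"

abbreviation fstate :: "bitree list \<Rightarrow> ostate" where
  "fstate \<equiv> map weighted_leaves"

definition is_leaf :: "bitree \<Rightarrow> bool" where
  "is_leaf t \<longleftrightarrow> (\<exists>a. t = Leaf a)"

lemma is_leaf_simps [simp]: "is_leaf (Leaf a)" "\<not> is_leaf (Node c l r)"
  by (auto simp: is_leaf_def)

definition expands :: "nat \<Rightarrow> bitree list \<Rightarrow> bitree list \<Rightarrow> bool" where
  "expands p fs fs' \<longleftrightarrow> (\<exists>xs c l r ys. fs = xs @ Node c l r # ys \<and> fs' = xs @ l # r # ys \<and> p = length xs)"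

lemma expandsE:
  assumes "expands p fs fs'"
  obtains xs c l r ys where "fs = xs @ Node c l r # ys" "fs' = xs @ l # r # ys" "p = length xs"
  using assms unfolding expands_def by blast

lemma expandsI: "p = length xs \<Longrightarrow> expands p (xs @ Node c l r # ys) (xs @ l # r # ys)"
  unfolding expands_def by blast

lemma leaves_nonempty [simp]: "leaves t \<noteq> []"
  by (induction t) auto

lemma self_in_subtrees: "t \<in> subtrees t"
  by (cases t) auto

lemma color_weight_le: "color_weight c \<le> 1"
  by (cases c) auto

lemma normalized_Leaf [simp]: "normalized (Leaf a)"
  by (simp add: normalized_def)

lemma normalized_Node:
  assumes "distinct (leaves (Node c l r))"
  shows "normalized (Node c l r) \<longleftrightarrow> normalized l \<and> normalized r \<and> Min (set (leaves l)) < Min (set (leaves r))"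
proof -
  have hd: "normalized t \<Longrightarrow> hd (leaves t) = Min (set (leaves t))" for t
    using self_in_subtrees by (auto simp: normalized_def)
  have split: "normalized (Node c l r) \<longleftrightarrow> normalized l \<and> normalized r \<and>
      hd (leaves l) = Min (set (leaves l) \<union> set (leaves r))"
    by (auto simp: normalized_def)
  have U: "Min (set (leaves l) \<union> set (leaves r)) = min (Min (set (leaves l))) (Min (set (leaves r)))"
    by (intro Min_Un) auto
  have "Min (set (leaves l)) \<in> set (leaves l)" "Min (set (leaves r)) \<in> set (leaves r)" by (auto intro!: Min_in)
  then have "Min (set (leaves l)) \<noteq> Min (set (leaves r))" using assms by (metis IntI distinct_append empty_iff leaves.simps(2))
  then have "min (Min (set (leaves l))) (Min (set (leaves r))) = Min (set (leaves l)) \<longleftrightarrow>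
      Min (set (leaves l)) < Min (set (leaves r))" by linarith
  moreover have "normalized l \<Longrightarrow> hd (leaves l) = Min (set (leaves l))" by (rule hd)
  ultimately show ?thesis unfolding split U by metis
qed

section \<open>Normalized forests and their ordered partitions\<close>

definition forest :: "nat \<Rightarrow> bitree list \<Rightarrow> bool" where
  "forest n fs \<longleftrightarrow> distinct (concat (map leaves fs)) \<and> set (concat (map leaves fs)) = {1..n} \<and> (\<forall>t\<in>set fs. normalized t)"

lemma expands_forest:
  assumes "forest n fs" "expands p fs fs'"
  shows "forest n fs'"
proof -
  obtain xs c l r ys where e: "fs = xs @ Node c l r # ys" "fs' = xs @ l # r # ys" using assms(2) by (rule expandsE)
  have "distinct (leaves (Node c l r))" "normalized (Node c l r)" using assms(1) e by (auto simp: forest_def)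
  then have "normalized l" "normalized r" using normalized_Node by blast+
  then show ?thesis using assms(1) unfolding e forest_def by auto
qed

lemma weighted_leaves_Node:
  "weighted_leaves (Node c l r) = (set (leaves l) \<union> set (leaves r), reds l + reds r + color_weight c)"
  by (simp add: weighted_leaves_def)

lemma expands_splits:
  assumes "forest n (xs @ Node c l r # ys)"
  shows "splits (length xs) (color_weight c) (fstate (xs @ Node c l r # ys)) (fstate (xs @ l # r # ys))"
proof -
  have d: "distinct (leaves (Node c l r))" "normalized (Node c l r)" using assms by (auto simp: forest_def)
  then have "Min (set (leaves l)) < Min (set (leaves r))" using normalized_Node by blast
  then show ?thesis
    using d(1) color_weight_le[of c] unfolding map_append list.map weighted_leaves_def[of l] weighted_leaves_def[of r]
      weighted_leaves_Node by (intro splitsI) auto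
qed

lemma fstate_leaves:
  assumes "forest n fs" "\<forall>t\<in>set fs. is_leaf t"
  shows "set (fstate fs) = wp_bot n" "distinct (fstate fs)"
proof -
  have "\<exists>as. fs = map Leaf as" using assms(2)
  proof (induction fs)
    case (Cons t fs)
    then obtain a as where "t = Leaf a" "fs = map Leaf as" by (auto simp: is_leaf_def)
    then show ?case by (intro exI[of _ "a # as"]) simp
  qed simp
  then obtain as where as: "fs = map Leaf as" by blast
  have c: "concat (map leaves fs) = as" unfolding as by (induction as) auto
  have "set as = {1..n}" "distinct as" using assms(1) by (simp_all add: forest_def c)
  then show "set (fstate fs) = wp_bot n" "distinct (fstate fs)"
    unfolding as by (auto simp: weighted_leaves_def wp_bot_def distinct_map inj_on_def)
qed

text \<open>Validity is clear for a forest of leaves and passes upward through each split, so the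
  induction goes to finer forests.\<close>

lemma forest_state:
  assumes "forest n fs"
  shows "state n (fstate fs)"
  using assms
proof (induction "sum_list (map size fs)" arbitrary: fs rule: less_induct)
  case less
  show ?case
  proof (cases "\<forall>t\<in>set fs. is_leaf t")
    case True
    then show ?thesis using fstate_leaves[OF less.prems] wp_bot_in by (simp add: state_def)
  next
    case False
    then obtain t where t: "t \<in> set fs" "\<not> is_leaf t" by blast
    obtain c l r where "t = Node c l r" using t(2) by (cases t) simp_all
    then obtain xs ys where fs: "fs = xs @ Node c l r # ys" using t(1) by (meson split_list)
    have "forest n (xs @ l # r # ys)" using expands_forest[OF less.prems] expandsI fs by metis
    then have "state n (fstate (xs @ l # r # ys))" by (intro less.hyps) (simp_all add: fs)
    then show ?thesis unfolding fs
      by (rule splits_state(1)[OF expands_splits[OF less.prems[unfolded fs]]])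
  qed
qed

lemma leaf_of_singleton:
  assumes "distinct (leaves t)" "set (leaves t) = {a}"
  shows "t = Leaf a"
proof (cases t)
  case (Node c l r)
  obtain x y where "x \<in> set (leaves l)" "y \<in> set (leaves r)" by (meson leaves_nonempty list.set_sel(1))
  moreover then have "x = a" "y = a" using assms(2) Node by auto
  ultimately show ?thesis using assms(1) Node by auto
qed (use assms in simp)

lemma forest_bot_leaves:
  assumes "forest n fs" "set (fstate fs) = wp_bot n"
  shows "\<forall>t\<in>set fs. is_leaf t"
proof
  fix t assume t: "t \<in> set fs"
  then have "weighted_leaves t \<in> wp_bot n" using assms(2) by auto
  then obtain a where "set (leaves t) = {a}" by (auto simp: weighted_leaves_def wp_bot_def)
  moreover have "distinct (leaves t)" using t assms(1) by (auto simp: forest_def distinct_concat_iff)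
  ultimately show "is_leaf t" using leaf_of_singleton by (simp add: is_leaf_def) blast
qed

text \<open>An order of the internal nodes with parents before children: \<open>F k\<close> is the
  forest left after removing the first \<open>k\<close> of them. It has \<open>k + 1\<close> trees,
  so only indices below \<open>n\<close> matter.\<close>

definition expansion :: "nat \<Rightarrow> bitree \<Rightarrow> (nat \<Rightarrow> bitree list) \<Rightarrow> bool" where
  "expansion n t F \<longleftrightarrow> t \<in> BT n \<and> normalized t \<and> F 0 = [t] \<and> (\<forall>k. Suc k < n \<longrightarrow> (\<exists>p. expands p (F k) (F (Suc k))))"

text \<open>Reversed because chains are listed upward; index \<open>n - 1\<close>, where all trees
  are leaves, is the removed minimum.\<close>

definition expansion_chain :: "nat \<Rightarrow> (nat \<Rightarrow> bitree list) \<Rightarrow> wpartition list" where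
  "expansion_chain n F = rev (map (\<lambda>k. set (fstate (F k))) [0..<n - 1])"

section \<open>The correspondence between expansions and maximal chains\<close>

context
  fixes n :: nat
  assumes n: "2 \<le> n"
begin

lemma expansion_forest:
  assumes "expansion n t F" "k < n"
  shows "forest n (F k) \<and> length (F k) = Suc k"
  using assms(2)
proof (induction k)
  case 0
  then show ?case using assms(1) by (auto simp: expansion_def forest_def BT_def)
next
  case (Suc k)
  obtain p where p: "expands p (F k) (F (Suc k))" using assms(1) Suc.prems by (auto simp: expansion_def)
  then have "length (F (Suc k)) = Suc (length (F k))" by (elim expandsE) simp
  then show ?case using Suc expands_forest[OF _ p] by simp
qed

lemma expansion_state:
  assumes "expansion n t F" "k < n"
  shows "state n (fstate (F k))" "card (set (fstate (F k))) = Suc k"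
  using expansion_forest[OF assms] forest_state state_card by fastforce+

lemma expansion_step:
  assumes "expansion n t F" "Suc k < n"
  obtains xs c l r ys where "F k = xs @ Node c l r # ys" "F (Suc k) = xs @ l # r # ys"
    "splits (length xs) (color_weight c) (fstate (F k)) (fstate (F (Suc k)))"
proof -
  obtain p where "expands p (F k) (F (Suc k))" using assms by (auto simp: expansion_def)
  then obtain xs c l r ys where e: "F k = xs @ Node c l r # ys" "F (Suc k) = xs @ l # r # ys" by (rule expandsE)
  have "forest n (F k)" using expansion_forest[OF assms(1), of k] assms(2) by simp
  then have "splits (length xs) (color_weight c) (fstate (F k)) (fstate (F (Suc k)))"
    unfolding e by (rule expands_splits)
  then show ?thesis using that e by blast
qed

lemma expansion_splits:
  assumes "expansion n t F" "Suc k < n"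
  shows "\<exists>p u. splits p u (fstate (F k)) (fstate (F (Suc k)))"
proof -
  from assms obtain xs c l r ys where "F k = xs @ Node c l r # ys" "F (Suc k) = xs @ l # r # ys"
    "splits (length xs) (color_weight c) (fstate (F k)) (fstate (F (Suc k)))"
    by (rule expansion_step)
  then show ?thesis by blast
qed

lemma expansion_down_chain:
  assumes "expansion n t F"
  shows "down_chain n (\<lambda>k. set (fstate (F k)))"
  unfolding down_chain_def
proof (intro conjI allI impI)
  fix k assume "k < n"
  then show "set (fstate (F k)) \<in> weighted_partitions n" "card (set (fstate (F k))) = Suc k"
    using expansion_state[OF assms] by (simp_all only: state_def)
next
  fix k assume k: "Suc k < n"
  obtain p u where "splits p u (fstate (F k)) (fstate (F (Suc k)))" using expansion_splits[OF assms k] by blast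
  then show "wp_le n (set (fstate (F (Suc k)))) (set (fstate (F k)))"
    by (rule splits_state(2)) (rule expansion_state(1)[OF assms k])
qed

lemma expansion_bot:
  assumes "expansion n t F"
  shows "set (fstate (F (n - 1))) = wp_bot n" "\<forall>s\<in>set (F (n - 1)). is_leaf s"
proof -
  have n1: "n - 1 < n" using n by simp
  show bot: "set (fstate (F (n - 1))) = wp_bot n"
    using expansion_state[OF assms n1] n by (intro card_eq_bot) (simp_all only: state_def Suc_diff_1)
  show "\<forall>s\<in>set (F (n - 1)). is_leaf s"
    using forest_bot_leaves[OF _ bot] expansion_forest[OF assms n1] by simp
qed

lemma from_top_expansion_chain:
  assumes "expansion n t F" "k < n"
  shows "from_top n (expansion_chain n F) k = set (fstate (F k))"
proof (cases "k < n - 1")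
  case True
  then have "n - 2 - k < n - 1" "n - 1 - Suc (n - 2 - k) = k" by arith+
  then show ?thesis unfolding from_top_def expansion_chain_def using True by (simp add: rev_nth)
next
  case False
  then have "k = n - 1" using assms(2) by simp
  then show ?thesis using expansion_bot(1)[OF assms(1)] by (simp add: from_top_def)
qed

lemma down_chain_cong: "(\<And>k. k < n \<Longrightarrow> t k = t' k) \<Longrightarrow> down_chain n t \<longleftrightarrow> down_chain n t'"
  by (simp add: down_chain_def)

lemma expansion_chain_in:
  assumes "expansion n t F"
  shows "expansion_chain n F \<in> max_chains n"
proof -
  have "down_chain n (from_top n (expansion_chain n F)) \<longleftrightarrow> down_chain n (\<lambda>k. set (fstate (F k)))"
    by (rule down_chain_cong) (rule from_top_expansion_chain[OF assms])
  then have "down_chain n (from_top n (expansion_chain n F))" using expansion_down_chain[OF assms] by simp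
  then show ?thesis unfolding max_chains_iff[OF n] by (simp add: expansion_chain_def)
qed

text \<open>In a normalized tree the left child has the smaller minimum, so replacing a node by its
  two children in place is exactly the forced ordering of a split.\<close>

lemma lift_expansion:
  assumes "expansion n t F" "k < n"
  shows "lift n (from_top n (expansion_chain n F)) k = fstate (F k)"
proof (rule lift_unique[of n _ "n - 1"])
  show "down_chain n (from_top n (expansion_chain n F))"
    using expansion_chain_in[OF assms(1)] unfolding max_chains_iff[OF n] by blast
  show "n - 1 < n" "k \<le> n - 1" using n assms(2) by simp_all
  fix j
  show "state n (fstate (F j)) \<and> set (fstate (F j)) = from_top n (expansion_chain n F) j" if "j \<le> n - 1"
    using that n expansion_state(1)[OF assms(1), of j] from_top_expansion_chain[OF assms(1), of j] by simp
  show "\<exists>p u. splits p u (fstate (F j)) (fstate (F (Suc j)))" if "j < n - 1"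
  proof -
    have "Suc j < n" using that by arith
    then show ?thesis by (rule expansion_splits[OF assms(1)])
  qed
qed

lemma fstate_inj_leaves:
  assumes "\<forall>s\<in>set fs. is_leaf s" "\<forall>s\<in>set gs. is_leaf s" "fstate fs = fstate gs"
  shows "fs = gs"
  using assms
proof (induction fs arbitrary: gs)
  case (Cons f fs)
  obtain g gs' where gs: "gs = g # gs'" using Cons.prems(3) by (cases gs) simp_all
  have wl: "weighted_leaves f = weighted_leaves g" "fstate fs = fstate gs'" using Cons.prems(3) gs by simp_all
  have "is_leaf f" "is_leaf g" using Cons.prems(1,2) gs by simp_all
  then obtain a b where "f = Leaf a" "g = Leaf b" unfolding is_leaf_def by blast
  then have "f = g" using wl(1) by (simp add: weighted_leaves_def)
  moreover have "fs = gs'" using Cons.prems(1,2) gs by (intro Cons.IH[OF _ _ wl(2)]) simp_all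
  ultimately show ?case using gs by simp
qed simp

lemma color_weight_inj: "color_weight c = color_weight d \<Longrightarrow> c = d"
  by (cases c; cases d) auto

text \<open>The chain determines the lists of weighted blocks, hence position and colour of each
  split. The lowest forest consists of leaves and is determined by its labels; from there the
  forests are rebuilt upward.\<close>

lemma expansion_chain_inj:
  assumes F: "expansion n t F" and G: "expansion n s G" and eq: "expansion_chain n F = expansion_chain n G"
  shows "t = s"
proof -
  have st: "fstate (F k) = fstate (G k)" if "k < n" for k
    using lift_expansion[OF F that] lift_expansion[OF G that] eq by simp
  have "F (n - 1 - d) = G (n - 1 - d)" for d
  proof (induction d)
    case 0
    show ?case using expansion_bot(2)[OF F] expansion_bot(2)[OF G] st[of "n - 1"] n by (simp add: fstate_inj_leaves)
  next
    case (Suc d)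
    show ?case
    proof (cases "Suc d \<le> n - 1")
      case True
      define k where "k = n - 1 - Suc d"
      have k: "Suc k < n" "n - 1 - d = Suc k" using True n by (auto simp: k_def)
      from F k(1) obtain xs c l r ys where f: "F k = xs @ Node c l r # ys" "F (Suc k) = xs @ l # r # ys"
        "splits (length xs) (color_weight c) (fstate (F k)) (fstate (F (Suc k)))" by (rule expansion_step)
      from G k(1) obtain xs' c' l' r' ys' where g: "G k = xs' @ Node c' l' r' # ys'" "G (Suc k) = xs' @ l' # r' # ys'"
        "splits (length xs') (color_weight c') (fstate (G k)) (fstate (G (Suc k)))" by (rule expansion_step)
      have "length xs = length xs'" "color_weight c = color_weight c'"
        using split_pos_col[OF f(3)] split_pos_col[OF g(3)] st[of k] st[of "Suc k"] k(1) by simp_all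
      moreover have "xs @ l # r # ys = xs' @ l' # r' # ys'" using Suc f(2) g(2) k(2) by simp
      ultimately show ?thesis unfolding k_def[symmetric] f(1) g(1) using color_weight_inj by auto
    next
      case False
      then have "n - 1 - Suc d = n - 1 - d" by simp
      then show ?thesis using Suc by simp
    qed
  qed
  from this[of "n - 1"] show ?thesis using F G by (simp add: expansion_def)
qed

text \<open>The converse construction: starting with the leaves in the order of the lowest list,
  each split of the lifted chain glues two neighbouring trees to a node of its colour.\<close>

lemma max_chain_expansion:
  assumes c: "c \<in> max_chains n"
  obtains t F where "expansion n t F" "c = expansion_chain n F"
proof -
  have dc: "down_chain n (from_top n c)" and len: "length c = n - 1" using c max_chains_iff[OF n] by auto
  let ?O = "lift n (from_top n c)"
  have O: "state n (?O k)" "set (?O k) = from_top n c k" if "k < n" for k using lift_state(1)[OF dc that] by auto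
  \<comment> \<open>\<open>F\<close> is built from the bottom: \<open>?P k\<close> prescribes its
    values from level \<open>k\<close> on.\<close>
  let ?P = "\<lambda>k F. (\<forall>j. k \<le> j \<and> j < n \<longrightarrow> fstate (F j) = ?O j \<and> (\<forall>t\<in>set (F j). normalized t \<and> distinct (leaves t))) \<and>
    (\<forall>j. k \<le> j \<and> Suc j < n \<longrightarrow> (\<exists>p. expands p (F j) (F (Suc j))))"
  have "\<exists>F. ?P (n - 1 - d) F" for d
  proof (induction d)
    case 0
    define fs where "fs = map (\<lambda>p. Leaf (the_elem (fst p))) (?O (n - 1))"
    have "set (?O (n - 1)) = wp_bot n" using O(2)[of "n - 1"] n by (simp add: from_top_def)
    then have "weighted_leaves (Leaf (the_elem (fst p))) = p" if "p \<in> set (?O (n - 1))" for p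
      using that by (auto simp: wp_bot_def weighted_leaves_def)
    then have "fstate fs = ?O (n - 1)" unfolding fs_def map_map by (intro map_idI) simp
    moreover have "\<forall>t\<in>set fs. normalized t \<and> distinct (leaves t)" by (auto simp: fs_def)
    moreover have "j = n - 1" if "n - 1 \<le> j" "j < n" for j using that by simp
    ultimately show ?case by (intro exI[of _ "\<lambda>_. fs"]) auto
  next
    case (Suc d)
    then obtain F where F: "?P (n - 1 - d) F" by blast
    show ?case
    proof (cases "Suc d \<le> n - 1")
      case True
      define k where "k = n - 1 - Suc d"
      have k: "Suc k < n" "n - 1 - d = Suc k" using True n by (auto simp: k_def)
      have F1: "fstate (F j) = ?O j" "\<forall>t\<in>set (F j). normalized t \<and> distinct (leaves t)"
        if "Suc k \<le> j" "j < n" for j using F that unfolding k(2) by blast+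
      have F2: "\<exists>p. expands p (F j) (F (Suc j))" if "Suc k \<le> j" "Suc j < n" for j
        using F that unfolding k(2) by blast
      obtain p u where "splits p u (?O k) (?O (Suc k))" using dc k(1) by (rule lift_splits)
      then obtain xs ys L a R b where e: "?O k = xs @ (L \<union> R, a + b + u) # ys" "?O (Suc k) = xs @ (L, a) # (R, b) # ys"
        "p = length xs" "L \<inter> R = {}" "L \<noteq> {}" "R \<noteq> {}" "Min L < Min R" "u \<le> 1" by (rule splitsE)
      have "fstate (F (Suc k)) = xs @ (L, a) # (R, b) # ys" using F1(1)[OF order_refl k(1)] e(2) by simp
      then obtain fx l r fy where f: "F (Suc k) = fx @ l # r # fy" "fstate fx = xs" "weighted_leaves l = (L, a)"
        "weighted_leaves r = (R, b)" "fstate fy = ys"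
        by (auto simp: map_eq_append_conv map_eq_Cons_conv)
      note ok = F1(2)[OF order_refl k(1)]
      let ?N = "Node (if u = 0 then Blue else Red) l r"
      have lr: "set (leaves l) = L" "set (leaves r) = R" using f by (auto simp: weighted_leaves_def)
      have d: "distinct (leaves ?N)" using ok f(1) lr e(4) by simp
      then have N: "normalized ?N" using normalized_Node[OF d] ok f(1) lr e(7) by simp
      have w: "weighted_leaves ?N = (L \<union> R, a + b + u)" using f e(8) by (auto simp: weighted_leaves_def)
      define G where "G = F(k := fx @ ?N # fy)"
      have "?P k G"
      proof (intro conjI allI impI)
        fix j assume j: "k \<le> j \<and> j < n"
        show "fstate (G j) = ?O j"
        proof (cases "j = k")
          case True
          then show ?thesis using f w e(1) by (simp add: G_def)
        next
          case False
          then show ?thesis using F1(1)[of j] j by (simp add: G_def)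
        qed
        show "\<forall>t\<in>set (G j). normalized t \<and> distinct (leaves t)"
        proof (cases "j = k")
          case True
          then show ?thesis using ok f(1) N d by (auto simp: G_def)
        next
          case False
          then show ?thesis using F1(2)[of j] j by (simp add: G_def)
        qed
      next
        fix j assume j: "k \<le> j \<and> Suc j < n"
        show "\<exists>p. expands p (G j) (G (Suc j))"
        proof (cases "j = k")
          case True
          have "expands (length fx) (G k) (G (Suc k))"
            using expandsI[OF refl, of fx "if u = 0 then Blue else Red" l r fy] f(1) by (simp add: G_def)
          then show ?thesis unfolding True by blast
        next
          case False
          then show ?thesis using F2[of j] j by (simp add: G_def)
        qed
      qed
      then show ?thesis unfolding k_def by blast
    next
      case False
      then have "n - 1 - Suc d = n - 1 - d" by simp
      then show ?thesis using F by (intro exI[of _ F]) simp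
    qed
  qed
  from this[of "n - 1"] obtain F where P0: "?P 0 F" by auto
  have F: "fstate (F j) = ?O j" "\<forall>t\<in>set (F j). normalized t \<and> distinct (leaves t)" if "j < n" for j
    using P0 that by blast+
  have Fe: "\<exists>p. expands p (F j) (F (Suc j))" if "Suc j < n" for j using P0 that by blast
  have n0: "0 < n" using n by simp
  obtain i where i: "?O 0 = [({1..n}, i)]" using lift_top[OF dc n0] by metis
  obtain t where t: "F 0 = [t]" "weighted_leaves t = ({1..n}, i)"
  proof -
    have "fstate (F 0) = [({1..n}, i)]" using F(1)[OF n0] i by simp
    then show ?thesis using that by (auto simp: map_eq_Cons_conv)
  qed
  have "expansion n t F"
    using F(2)[OF n0] Fe t by (simp add: expansion_def BT_def weighted_leaves_def)
  moreover have "c = expansion_chain n F"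
  proof (rule nth_equalityI)
    show "length c = length (expansion_chain n F)" using len by (simp add: expansion_chain_def)
    fix j assume "j < length c"
    then have j: "j < n - 1" "n - 2 - j < n" using len by simp_all
    have "from_top n c (n - 2 - j) = from_top n (expansion_chain n F) (n - 2 - j)"
      unfolding from_top_expansion_chain[OF \<open>expansion n t F\<close> j(2)] F(1)[OF j(2)] O(2)[OF j(2)] ..
    then show "c ! j = expansion_chain n F ! j" unfolding nth_from_top[OF j(1)] .
  qed
  ultimately show ?thesis by (rule that)
qed

end

section \<open>Postorder\<close>

lemma merge_chain_append:
  "merge_chain \<pi> (xs @ [x]) = merge_chain \<pi> xs @ [merge_node x (last (merge_chain \<pi> xs))]"
proof (induction xs arbitrary: \<pi>)
  case (Cons y xs)
  have "merge_chain (merge_node y \<pi>) xs \<noteq> []" by (cases xs) auto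
  then show ?case using Cons by simp
qed simp

lemma concat_postorder_leaves: "\<forall>t\<in>set fs. is_leaf t \<Longrightarrow> concat (map postorder fs) = []"
  by (auto simp: is_leaf_def)

lemma merge_blocks_state:
  assumes st: "state n (xs @ (L, a) # (R, b) # ys)"
  shows "merge_blocks k L R (set (xs @ (L, a) # (R, b) # ys)) = set (xs @ (L \<union> R, a + b + k) # ys)"
proof -
  let ?S = "set (xs @ (L, a) # (R, b) # ys)"
  have d: "(L, a) \<notin> set xs \<union> set ys" "(R, b) \<notin> set xs \<union> set ys" using st by (auto simp: state_def)
  have L: "p = (L, a)" if "p \<in> ?S" "fst p = L" for p
    by (rule block_eq[OF st that(1)]) (use that in simp_all)
  have R: "p = (R, b)" if "p \<in> ?S" "fst p = R" for p
    by (rule block_eq[OF st that(1)]) (use that in simp_all)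
  have rest: "{p \<in> ?S. fst p \<noteq> L \<and> fst p \<noteq> R} = set xs \<union> set ys"
  proof
    show "{p \<in> ?S. fst p \<noteq> L \<and> fst p \<noteq> R} \<subseteq> set xs \<union> set ys" by auto
    show "set xs \<union> set ys \<subseteq> {p \<in> ?S. fst p \<noteq> L \<and> fst p \<noteq> R}"
    proof
      fix p assume p: "p \<in> set xs \<union> set ys"
      then have pS: "p \<in> ?S" by auto
      have "p \<noteq> (L, a)" "p \<noteq> (R, b)" using d p by metis+
      then have "fst p \<noteq> L" "fst p \<noteq> R" using L[OF pS] R[OF pS] by metis+
      then show "p \<in> {p \<in> ?S. fst p \<noteq> L \<and> fst p \<noteq> R}" using pS by blast
    qed
  qed
  have "(L, x) \<in> ?S \<longleftrightarrow> x = a" for x using L[of "(L, x)"] by (intro iffI) simp_all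
  moreover have "(R, x) \<in> ?S \<longleftrightarrow> x = b" for x using R[of "(R, x)"] by (intro iffI) simp_all
  ultimately have new: "{(L \<union> R, a + b + k) | a b. (L, a) \<in> ?S \<and> (R, b) \<in> ?S} = {(L \<union> R, a + b + k)}"
    by (simp only: simp_thms) simp
  show ?thesis unfolding merge_blocks_def rest new by auto
qed

lemma merge_node_fstate:
  assumes "state n (fstate (xs @ l # r # ys))"
  shows "merge_node (Node c l r) (set (fstate (xs @ l # r # ys))) = set (fstate (xs @ Node c l r # ys))"
  using merge_blocks_state[of n "fstate xs" "set (leaves l)" "reds l" "set (leaves r)" "reds r" "fstate ys" "color_weight c"]
    assms unfolding map_append list.map weighted_leaves_Node merge_node.simps
  by (simp only: weighted_leaves_def)

definition last_expansion :: "nat \<Rightarrow> (nat \<Rightarrow> bitree list) \<Rightarrow> nat \<Rightarrow> bool" where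
  "last_expansion n F k \<longleftrightarrow> (\<exists>xs c l r ys. F k = xs @ Node c l r # ys \<and> F (Suc k) = xs @ l # r # ys \<and> (\<forall>t\<in>set ys. is_leaf t))"

definition first_expansion :: "nat \<Rightarrow> (nat \<Rightarrow> bitree list) \<Rightarrow> nat \<Rightarrow> bool" where
  "first_expansion n F k \<longleftrightarrow> (\<exists>xs c l r ys. F k = xs @ Node c l r # ys \<and> F (Suc k) = xs @ l # r # ys \<and> (\<forall>t\<in>set xs. is_leaf t))"

context
  fixes n :: nat
  assumes n: "2 \<le> n"
begin

text \<open>Postorder lists the internal nodes in the order in which they are merged when always the last
  nonleaf tree of a forest is expanded.\<close>

lemma reduced_tree_chain_expansion:
  assumes F: "expansion n t F" and last: "\<And>k. Suc k < n \<Longrightarrow> last_expansion n F k"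
  shows "reduced_tree_chain n t = expansion_chain n F"
proof -
  let ?t = "\<lambda>k. set (fstate (F k))"
  have main: "merge_chain (wp_bot n) (concat (map postorder (F (n - 1 - d)))) = rev (map ?t [n - 1 - d..<n])" for d
  proof (induction d)
    case 0
    have "[n - 1..<n] = [n - 1]" using n by (cases n) simp_all
    then show ?case using expansion_bot[OF n F] by (simp add: concat_postorder_leaves)
  next
    case (Suc d)
    show ?case
    proof (cases "Suc d \<le> n - 1")
      case True
      define k where "k = n - 1 - Suc d"
      have k: "Suc k < n" "n - 1 - d = Suc k" using True n by (auto simp: k_def)
      obtain xs c l r ys where e: "F k = xs @ Node c l r # ys" "F (Suc k) = xs @ l # r # ys" "\<forall>t\<in>set ys. is_leaf t"
        using last[OF k(1)] unfolding last_expansion_def by blast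
      \<comment> \<open>Only leaves stand to the right of the expanded node, and they contribute
        nothing, so in postorder this node comes last.\<close>
      have "concat (map postorder (F k)) = concat (map postorder (F (Suc k))) @ [Node c l r]"
        using concat_postorder_leaves[OF e(3)] unfolding e(1,2) by (simp del: concat_eq_Nil_conv)
      then have "merge_chain (wp_bot n) (concat (map postorder (F k))) =
          rev (map ?t [Suc k..<n]) @ [merge_node (Node c l r) (List.last (rev (map ?t [Suc k..<n])))]"
        using Suc unfolding k(2) by (simp add: merge_chain_append)
      moreover have "List.last (rev (map ?t [Suc k..<n])) = ?t (Suc k)"
        using k(1) by (simp add: last_rev hd_map)
      moreover have "merge_node (Node c l r) (?t (Suc k)) = ?t k"
        using merge_node_fstate[of n xs l r ys c] expansion_state(1)[OF n F k(1)] unfolding e(1,2) by blast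
      moreover have "[k..<n] = k # [Suc k..<n]" using k(1) by (simp add: upt_conv_Cons)
      ultimately show ?thesis unfolding k_def[symmetric] by simp
    next
      case False
      then have "n - 1 - Suc d = n - 1 - d" by simp
      then show ?thesis using Suc by simp
    qed
  qed
  have F0: "F 0 = [t]" using F by (simp add: expansion_def)
  have "tree_chain n t = rev (map ?t [0..<n])" using main[of "n - 1"] F0 by (simp add: tree_chain_def)
  moreover have "[0..<n] = [0..<n - 1] @ [n - 1]" using n by (cases n) simp_all
  ultimately have "tree_chain n t = wp_bot n # rev (map ?t [0..<n - 1])" using expansion_bot(1)[OF n F] by simp
  moreover have "wp_bot n \<notin> set (rev (map ?t [0..<n - 1]))"
  proof
    assume "wp_bot n \<in> set (rev (map ?t [0..<n - 1]))"
    then obtain k where k: "k < n - 1" "wp_bot n = ?t k" by auto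
    then have "n = Suc k" using expansion_state(2)[OF n F, of k] card_wp_bot[of n] by simp
    then show False using k by simp
  qed
  ultimately show ?thesis by (simp add: reduced_tree_chain_def expansion_chain_def)
qed

section \<open>Expansions in a prescribed order\<close>

lemma nonleaf_exists:
  assumes "forest n fs" "length fs < n"
  shows "\<exists>t\<in>set fs. \<not> is_leaf t"
proof (rule ccontr)
  assume "\<not> ?thesis"
  then have "set (fstate fs) = wp_bot n" using fstate_leaves[OF assms(1)] by blast
  then have "card (set (fstate fs)) = n" by (simp add: card_wp_bot)
  then show False using state_card[OF forest_state[OF assms(1)]] assms(2) by simp
qed

lemma expansion_exists:
  assumes t: "t \<in> BT n" "normalized t"
    and Q: "\<And>fs. \<exists>t\<in>set fs. \<not> is_leaf t \<Longrightarrow> \<exists>fs' p. expands p fs fs' \<and> Q fs fs'"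
  obtains F where "expansion n t F" "\<And>k. Suc k < n \<Longrightarrow> Q (F k) (F (Suc k))"
proof -
  have "\<exists>F. \<forall>k. (k < n \<longrightarrow> forest n (F k) \<and> length (F k) = Suc k \<and> (k = 0 \<longrightarrow> F k = [t])) \<and>
      (Suc k < n \<longrightarrow> (\<exists>p. expands p (F k) (F (Suc k))) \<and> Q (F k) (F (Suc k)))"
  proof (rule dependent_nat_choice)
    have "forest n [t]" using t by (simp add: forest_def BT_def)
    then show "\<exists>fs. 0 < n \<longrightarrow> forest n fs \<and> length fs = Suc 0 \<and> (0 = 0 \<longrightarrow> fs = [t])"
      by (intro exI[of _ "[t]"]) simp
  next
    fix fs k assume fs: "k < n \<longrightarrow> forest n fs \<and> length fs = Suc k \<and> (k = 0 \<longrightarrow> fs = [t])"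
    show "\<exists>fs'. (Suc k < n \<longrightarrow> forest n fs' \<and> length fs' = Suc (Suc k) \<and> (Suc k = 0 \<longrightarrow> fs' = [t])) \<and>
        (Suc k < n \<longrightarrow> (\<exists>p. expands p fs fs') \<and> Q fs fs')"
    proof (cases "Suc k < n")
      case True
      then have f: "forest n fs" "length fs = Suc k" using fs by auto
      have "\<exists>t\<in>set fs. \<not> is_leaf t" by (rule nonleaf_exists[OF f(1)]) (use f(2) True in simp)
      from Q[OF this] obtain fs' p where p: "expands p fs fs'" "Q fs fs'" by (elim exE conjE)
      have "forest n fs'" by (rule expands_forest[OF f(1) p(1)])
      moreover have "length fs' = Suc (Suc k)" using p(1) f(2) by (elim expandsE) simp
      moreover have "\<exists>p. expands p fs fs'" using p(1) by (rule exI)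
      ultimately show ?thesis using p(2) by (intro exI[of _ fs'] conjI impI) simp_all
    qed simp
  qed
  then obtain F where F: "\<forall>k. (k < n \<longrightarrow> forest n (F k) \<and> length (F k) = Suc k \<and> (k = 0 \<longrightarrow> F k = [t])) \<and>
      (Suc k < n \<longrightarrow> (\<exists>p. expands p (F k) (F (Suc k))) \<and> Q (F k) (F (Suc k)))" by (elim exE)
  have "F 0 = [t]" using F[THEN spec, of 0] n by simp
  moreover have step: "(\<exists>p. expands p (F k) (F (Suc k))) \<and> Q (F k) (F (Suc k))" if "Suc k < n" for k
    using F[THEN spec, of k] that by simp
  ultimately have "expansion n t F" using t unfolding expansion_def by simp
  then show ?thesis by (rule that) (use step in simp)
qed

lemma split_last_nonleaf:
  "\<exists>t\<in>set fs. \<not> is_leaf t \<Longrightarrow> \<exists>xs c l r ys. fs = xs @ Node c l r # ys \<and> (\<forall>t\<in>set ys. is_leaf t)"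
proof -
  assume "\<exists>t\<in>set fs. \<not> is_leaf t"
  then obtain xs t ys where e: "fs = xs @ t # ys" "\<not> is_leaf t" "\<forall>t\<in>set ys. \<not> \<not> is_leaf t"
    by (rule split_list_last_propE)
  then obtain c l r where "t = Node c l r" by (cases t) simp_all
  then show ?thesis using e by blast
qed

lemma split_first_nonleaf:
  "\<exists>t\<in>set fs. \<not> is_leaf t \<Longrightarrow> \<exists>xs c l r ys. fs = xs @ Node c l r # ys \<and> (\<forall>t\<in>set xs. is_leaf t)"
proof -
  assume "\<exists>t\<in>set fs. \<not> is_leaf t"
  then obtain xs t ys where e: "fs = xs @ t # ys" "\<not> is_leaf t" "\<forall>t\<in>set xs. \<not> \<not> is_leaf t"
    by (rule split_list_first_propE)
  then obtain c l r where "t = Node c l r" by (cases t) simp_all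
  then show ?thesis using e by blast
qed

lemma last_expansion_exists:
  assumes "t \<in> BT n" "normalized t"
  obtains F where "expansion n t F" "\<And>k. Suc k < n \<Longrightarrow> last_expansion n F k"
proof (rule expansion_exists[OF assms])
  let ?Q = "\<lambda>fs fs'. \<exists>xs c l r ys. fs = xs @ Node c l r # ys \<and> fs' = xs @ l # r # ys \<and> (\<forall>t\<in>set ys. is_leaf t)"
  show "\<exists>fs' p. expands p fs fs' \<and> ?Q fs fs'" if fs: "\<exists>t\<in>set fs. \<not> is_leaf t" for fs
  proof -
    obtain xs c l r ys where "fs = xs @ Node c l r # ys" "\<forall>t\<in>set ys. is_leaf t" using split_last_nonleaf[OF fs] by blast
    then show ?thesis using expandsI[of "length xs" xs c l r ys] by blast
  qed
  fix F assume "expansion n t F" "\<And>k. Suc k < n \<Longrightarrow> ?Q (F k) (F (Suc k))"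
  then show thesis by (intro that) (simp_all only: last_expansion_def)
qed

lemma first_expansion_exists:
  assumes "t \<in> BT n" "normalized t"
  obtains F where "expansion n t F" "\<And>k. Suc k < n \<Longrightarrow> first_expansion n F k"
proof (rule expansion_exists[OF assms])
  let ?Q = "\<lambda>fs fs'. \<exists>xs c l r ys. fs = xs @ Node c l r # ys \<and> fs' = xs @ l # r # ys \<and> (\<forall>t\<in>set xs. is_leaf t)"
  show "\<exists>fs' p. expands p fs fs' \<and> ?Q fs fs'" if fs: "\<exists>t\<in>set fs. \<not> is_leaf t" for fs
  proof -
    obtain xs c l r ys where "fs = xs @ Node c l r # ys" "\<forall>t\<in>set xs. is_leaf t" using split_first_nonleaf[OF fs] by blast
    then show ?thesis using expandsI[of "length xs" xs c l r ys] by blast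
  qed
  fix F assume "expansion n t F" "\<And>k. Suc k < n \<Longrightarrow> ?Q (F k) (F (Suc k))"
  then show thesis by (intro that) (simp_all only: first_expansion_def)
qed

lemma first_nonleaf_unique:
  assumes "xs @ Node c l r # ys = xs' @ Node c' l' r' # ys'" "\<forall>t\<in>set xs. is_leaf t" "\<forall>t\<in>set xs'. is_leaf t"
  shows "xs = xs' \<and> Node c l r = Node c' l' r' \<and> ys = ys'"
  using assms
proof (induction xs arbitrary: xs')
  case Nil
  then show ?case by (cases xs') auto
next
  case (Cons x xs)
  then show ?case by (cases xs') auto
qed

lemma first_expansion_unique:
  assumes F: "expansion n t F" "\<And>k. Suc k < n \<Longrightarrow> first_expansion n F k"
    and G: "expansion n t G" "\<And>k. Suc k < n \<Longrightarrow> first_expansion n G k"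
  shows "expansion_chain n F = expansion_chain n G"
proof -
  have "F k = G k" if "k < n" for k
    using that
  proof (induction k)
    case 0
    then show ?case using F(1) G(1) by (simp add: expansion_def)
  next
    case (Suc k)
    obtain xs c l r ys where f: "F k = xs @ Node c l r # ys" "F (Suc k) = xs @ l # r # ys" "\<forall>t\<in>set xs. is_leaf t"
      using F(2)[OF Suc.prems] unfolding first_expansion_def by blast
    obtain xs' c' l' r' ys' where g: "G k = xs' @ Node c' l' r' # ys'" "G (Suc k) = xs' @ l' # r' # ys'" "\<forall>t\<in>set xs'. is_leaf t"
      using G(2)[OF Suc.prems] unfolding first_expansion_def by blast
    have "F k = G k" using Suc by simp
    then show ?case using first_nonleaf_unique[OF _ f(3) g(3), of c l r ys c' l' r' ys'] f g by simp
  qed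
  then show ?thesis unfolding expansion_chain_def by simp
qed

end

section \<open>Bicolored combs\<close>

lemma bicolored_comb_Leaf [simp]: "bicolored_comb (Leaf a)"
  by (simp add: bicolored_comb_def)

lemma bicolored_comb_Node:
  "bicolored_comb (Node c l r) \<longleftrightarrow> normalized (Node c l r) \<and> bicolored_comb l \<and> bicolored_comb r \<and>
    (\<forall>d rl rr. r = Node d rl rr \<longrightarrow> c = Red \<and> d = Blue)"
proof -
  have norm: "normalized l \<and> normalized r" if "normalized (Node c l r)"
    using that by (auto simp: normalized_def)
  show ?thesis (is "?L \<longleftrightarrow> ?R")
  proof
    assume L: ?L
    have root: "c = Red \<and> d = Blue" if "r = Node d rl rr" for d rl rr
    proof -
      have "Node c l (Node d rl rr) \<in> subtrees (Node c l r)" using that by simp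
      then show ?thesis using L unfolding bicolored_comb_def by blast
    qed
    have sub: "subtrees l \<subseteq> subtrees (Node c l r)" "subtrees r \<subseteq> subtrees (Node c l r)" by auto
    have "bicolored_comb l" using L norm sub(1) unfolding bicolored_comb_def by (meson subsetD)
    moreover have "bicolored_comb r" using L norm sub(2) unfolding bicolored_comb_def by (meson subsetD)
    moreover have "normalized (Node c l r)" using L unfolding bicolored_comb_def by blast
    ultimately show ?R using root by blast
  next
    assume R: ?R
    have "c' = Red \<and> d = Blue" if sub: "Node c' l' (Node d rl rr) \<in> subtrees (Node c l r)" for c' l' d rl rr
    proof -
      consider "c' = c" "r = Node d rl rr" | "Node c' l' (Node d rl rr) \<in> subtrees l" | "Node c' l' (Node d rl rr) \<in> subtrees r"
        using sub by auto
      then show ?thesis using R unfolding bicolored_comb_def by cases blast+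
    qed
    then show ?L using R unfolding bicolored_comb_def by blast
  qed
qed

lemma expansion_two_steps:
  assumes n: "2 \<le> n" and F: "expansion n t F" and k: "Suc (Suc k) < n"
    and e: "F k = xs @ Node c l r # ys" "F (Suc k) = xs @ l # r # ys"
    and f: "F (Suc k) = xs2 @ Node c2 l2 r2 # ys2" "F (Suc (Suc k)) = xs2 @ l2 # r2 # ys2"
  shows "split_pos (fstate (F k)) (fstate (F (Suc k))) = length xs"
    "split_col (fstate (F k)) (fstate (F (Suc k))) = color_weight c"
    "split_pos (fstate (F (Suc k))) (fstate (F (Suc (Suc k)))) = length xs2"
    "split_col (fstate (F (Suc k))) (fstate (F (Suc (Suc k)))) = color_weight c2"
proof -
  have "forest n (F k)" "forest n (F (Suc k))" using expansion_forest[OF n F] k by simp_all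
  then have "splits (length xs) (color_weight c) (fstate (F k)) (fstate (F (Suc k)))"
    "splits (length xs2) (color_weight c2) (fstate (F (Suc k))) (fstate (F (Suc (Suc k))))"
    using expands_splits[of n xs c l r ys] expands_splits[of n xs2 c2 l2 r2 ys2] e f by metis+
  from split_pos_col[OF this(1)] split_pos_col[OF this(2)] show
    "split_pos (fstate (F k)) (fstate (F (Suc k))) = length xs"
    "split_col (fstate (F k)) (fstate (F (Suc k))) = color_weight c"
    "split_pos (fstate (F (Suc k))) (fstate (F (Suc (Suc k)))) = length xs2"
    "split_col (fstate (F (Suc k))) (fstate (F (Suc (Suc k)))) = color_weight c2" by simp_all
qed

lemma color_weight_iff: "color_weight c = 1 \<longleftrightarrow> c = Red" "color_weight c = Suc 0 \<longleftrightarrow> c = Red" "color_weight c = 0 \<longleftrightarrow> c = Blue"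
  by (cases c; simp)+

text \<open>The order of expansion and the comb condition are proved together, from the leaves
  upward. The next step expands the last nonleaf, which for a pair that is not leading cannot lie to
  the right of both new parts; so the trees right of the current node are leaves. If it is the right
  child, the colours must be red over blue.\<close>

lemma comb_of_nonleading:
  assumes n: "2 \<le> n" and F: "expansion n t F"
    and nl: "\<And>k. Suc (Suc k) < n \<Longrightarrow> \<not> comb_adj (fstate (F k)) (fstate (F (Suc k))) (fstate (F (Suc (Suc k))))"
    and "k < n"
  shows "(\<forall>s\<in>set (F k). bicolored_comb s) \<and> (Suc k < n \<longrightarrow> last_expansion n F k)"
  using assms(4)
proof (induction "n - Suc k" arbitrary: k)
  case 0
  then have "k = n - 1" by simp
  then have "\<forall>s\<in>set (F k). is_leaf s" using expansion_bot(2)[OF n F] by simp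
  then show ?case using 0 by (auto simp: is_leaf_def)
next
  case (Suc m)
  have k: "Suc k < n" "m = n - Suc (Suc k)" using Suc.hyps(2) by simp_all
  from n F k(1) obtain xs c l r ys where e: "F k = xs @ Node c l r # ys" "F (Suc k) = xs @ l # r # ys"
    "splits (length xs) (color_weight c) (fstate (F k)) (fstate (F (Suc k)))" by (rule expansion_step)
  have IH: "\<forall>s\<in>set (F (Suc k)). bicolored_comb s" "Suc (Suc k) < n \<longrightarrow> last_expansion n F (Suc k)"
    using Suc.hyps(1)[OF k(2) k(1)] by blast+
  have N: "normalized (Node c l r)" using expansion_forest[OF n F, of k] Suc.prems e(1) by (simp add: forest_def)
  have key: "(\<forall>s\<in>set ys. is_leaf s) \<and> (\<forall>d rl rr. r = Node d rl rr \<longrightarrow> c = Red \<and> d = Blue)"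
  proof (cases "Suc (Suc k) < n")
    case False
    then have "Suc k = n - 1" using k(1) by simp
    then have "\<forall>s\<in>set (F (Suc k)). is_leaf s" using expansion_bot(2)[OF n F] by simp
    then show ?thesis unfolding e(2) by auto
  next
    case True
    then obtain xs2 c2 l2 r2 ys2 where f: "F (Suc k) = xs2 @ Node c2 l2 r2 # ys2" "F (Suc (Suc k)) = xs2 @ l2 # r2 # ys2"
      "\<forall>s\<in>set ys2. is_leaf s" using IH(2) unfolding last_expansion_def by blast
    note pc = expansion_two_steps[OF n F True e(1,2) f(1,2)]
    have adj: "\<not> (length xs < length xs2 \<and> \<not> (length xs2 = Suc (length xs) \<and> c = Red \<and> c2 = Blue))"
      using nl[OF True] unfolding comb_adj_def pc color_weight_iff .
    have "xs @ l # r # ys = xs2 @ Node c2 l2 r2 # ys2" using e(2) f(1) by simp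
    then show ?thesis
    proof (cases rule: split_list_cases)
      case (left zs) then show ?thesis using f(3) by auto
    next
      case first then show ?thesis using f(3) by auto
    next
      case second
      have r: "r = Node c2 l2 r2" using second(2) by simp
      have "c = Red \<and> c2 = Blue" using adj second(1) by simp
      then show ?thesis using f(3) second(3) unfolding r by auto
    next
      case (right zs) then show ?thesis using adj by simp
    qed
  qed
  have "\<forall>s\<in>set (F k). bicolored_comb s" using IH(1) N key unfolding e(1,2) by (simp add: bicolored_comb_Node)
  moreover have "last_expansion n F k" unfolding last_expansion_def using e(1,2) key by blast
  ultimately show ?case by blast
qed

text \<open>When the last nonleaf is expanded, the next one can lie to the right only as the right
  child just produced, and there the comb condition gives the excepted colours.\<close>

lemma nonleading_of_comb:
  assumes n: "2 \<le> n" and F: "expansion n t F" and last: "\<And>k. Suc k < n \<Longrightarrow> last_expansion n F k"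
    and t: "bicolored_comb t" and k: "Suc (Suc k) < n"
  shows "\<not> comb_adj (fstate (F k)) (fstate (F (Suc k))) (fstate (F (Suc (Suc k))))"
proof -
  have combs: "\<forall>s\<in>set (F k). bicolored_comb s" if "k < n" for k
    using that
  proof (induction k)
    case 0
    then show ?case using F t by (simp add: expansion_def)
  next
    case (Suc k)
    obtain xs c l r ys where "F k = xs @ Node c l r # ys" "F (Suc k) = xs @ l # r # ys"
      using last[OF Suc.prems] unfolding last_expansion_def by blast
    then show ?case using Suc by (auto simp: bicolored_comb_Node)
  qed
  obtain xs c l r ys where e: "F k = xs @ Node c l r # ys" "F (Suc k) = xs @ l # r # ys" "\<forall>t\<in>set ys. is_leaf t"
    using last[OF Suc_lessD[OF k]] unfolding last_expansion_def by blast
  obtain xs2 c2 l2 r2 ys2 where f: "F (Suc k) = xs2 @ Node c2 l2 r2 # ys2" "F (Suc (Suc k)) = xs2 @ l2 # r2 # ys2"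
    using last[OF k] unfolding last_expansion_def by blast
  have c: "bicolored_comb (Node c l r)" using combs[of k] k e(1) by simp
  note pc = expansion_two_steps[OF n F k e(1,2) f(1,2)]
  have "xs @ l # r # ys = xs2 @ Node c2 l2 r2 # ys2" using e(2) f(1) by simp
  then have "\<not> (length xs < length xs2 \<and> \<not> (length xs2 = Suc (length xs) \<and> c = Red \<and> c2 = Blue))"
  proof (cases rule: split_list_cases)
    case (right zs) then show ?thesis using e(3) by simp
  next
    case second
    have r: "r = Node c2 l2 r2" using second(2) by simp
    show ?thesis using c second(1) unfolding r bicolored_comb_Node by auto
  qed simp_all
  then show ?thesis unfolding comb_adj_def pc color_weight_iff .
qed

section \<open>Bicolored Lyndon trees\<close>

lemma bicolored_Lyndon_Leaf [simp]: "bicolored_Lyndon (Leaf a)"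
  by (simp add: bicolored_Lyndon_def)

lemma bicolored_Lyndon_Node:
  "bicolored_Lyndon (Node c l r) \<longleftrightarrow> normalized (Node c l r) \<and> bicolored_Lyndon l \<and> bicolored_Lyndon r \<and>
    (\<not> Lyndon_node (Node c l r) \<longrightarrow> c = Blue \<and> root_color l = Some Red)"
proof -
  have norm: "normalized l \<and> normalized r" if "normalized (Node c l r)"
    using that by (auto simp: normalized_def)
  show ?thesis (is "?L \<longleftrightarrow> ?R")
  proof
    assume L: ?L
    have "Node c l r \<in> subtrees (Node c l r)" by simp
    moreover have "subtrees l \<subseteq> subtrees (Node c l r)" "subtrees r \<subseteq> subtrees (Node c l r)" by auto
    ultimately show ?R using L norm unfolding bicolored_Lyndon_def by (meson subsetD)
  next
    assume R: ?R
    have "c' = Blue \<and> root_color l' = Some Red"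
      if sub: "Node c' l' r' \<in> subtrees (Node c l r) \<and> \<not> Lyndon_node (Node c' l' r')" for c' l' r'
    proof -
      consider "c' = c" "l' = l" "r' = r" | "Node c' l' r' \<in> subtrees l" | "Node c' l' r' \<in> subtrees r"
        using sub by auto
      then show ?thesis using R sub unfolding bicolored_Lyndon_def by cases blast+
    qed
    then show ?L using R unfolding bicolored_Lyndon_def by blast
  qed
qed

lemma lyn_adj_expansion:
  assumes n: "2 \<le> n" and F: "expansion n t F" and k: "Suc (Suc k) < n"
    and e: "F k = xs @ Node c l r # ys" "F (Suc k) = xs @ l # r # ys"
    and f: "F (Suc k) = xs2 @ Node c2 l2 r2 # ys2" "F (Suc (Suc k)) = xs2 @ l2 # r2 # ys2"
  shows "lyn_adj (fstate (F k)) (fstate (F (Suc k))) (fstate (F (Suc (Suc k)))) \<longleftrightarrow>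
    length xs2 \<le> length xs \<and> (length xs2 = length xs \<longrightarrow> valency r2 < valency r \<and> \<not> (c = Blue \<and> c2 = Red))"
proof -
  note pc = expansion_two_steps[OF n F k e f]
  have 1: "fst (fstate (F (Suc k)) ! Suc (length xs)) = set (leaves r)"
    unfolding e(2) by (simp add: nth_append weighted_leaves_def)
  have 2: "fst (fstate (F (Suc (Suc k))) ! Suc (length xs2)) = set (leaves r2)"
    unfolding f(2) by (simp add: nth_append weighted_leaves_def)
  show ?thesis unfolding lyn_adj_def Let_def pc color_weight_iff valency_def using 1 2 by auto
qed

text \<open>Excludes equality, so that the Lyndon condition is the exact negation of the strict
  inequality in \<open>lyn_adj\<close>.\<close>

lemma valency_neq:
  assumes "distinct (leaves (Node c (Node d l2 r2) r))"
  shows "valency r2 \<noteq> valency r"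
proof -
  have "Min (set (leaves r2)) \<in> set (leaves r2)" "Min (set (leaves r)) \<in> set (leaves r)" by (auto intro!: Min_in)
  moreover have "set (leaves r2) \<inter> set (leaves r) = {}" using assms by auto
  ultimately show ?thesis unfolding valency_def by (metis IntI empty_iff)
qed

text \<open>Again from the leaves upward, now with the next step expanding the first nonleaf. A pair
  that is not leading cannot move left, so the trees left of the current node are leaves. If the
  left child is expanded next, the minima make the node a Lyndon node, or it is blue over
  red.\<close>

lemma lyndon_of_nonleading:
  assumes n: "2 \<le> n" and F: "expansion n t F"
    and nl: "\<And>k. Suc (Suc k) < n \<Longrightarrow> \<not> lyn_adj (fstate (F k)) (fstate (F (Suc k))) (fstate (F (Suc (Suc k))))"
    and "k < n"
  shows "(\<forall>s\<in>set (F k). bicolored_Lyndon s) \<and> (Suc k < n \<longrightarrow> first_expansion n F k)"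
  using assms(4)
proof (induction "n - Suc k" arbitrary: k)
  case 0
  then have "k = n - 1" by simp
  then have "\<forall>s\<in>set (F k). is_leaf s" using expansion_bot(2)[OF n F] by simp
  then show ?case using 0 by (auto simp: is_leaf_def)
next
  case (Suc m)
  have k: "Suc k < n" "m = n - Suc (Suc k)" using Suc.hyps(2) by simp_all
  from n F k(1) obtain xs c l r ys where e: "F k = xs @ Node c l r # ys" "F (Suc k) = xs @ l # r # ys"
    "splits (length xs) (color_weight c) (fstate (F k)) (fstate (F (Suc k)))" by (rule expansion_step)
  have IH: "\<forall>s\<in>set (F (Suc k)). bicolored_Lyndon s" "Suc (Suc k) < n \<longrightarrow> first_expansion n F (Suc k)"
    using Suc.hyps(1)[OF k(2) k(1)] by blast+
  have fo: "forest n (F k)" using expansion_forest[OF n F, of k] Suc.prems by simp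
  have N: "normalized (Node c l r)" "distinct (leaves (Node c l r))" using fo unfolding e(1) by (auto simp: forest_def)
  have key: "(\<forall>s\<in>set xs. is_leaf s) \<and> (\<not> Lyndon_node (Node c l r) \<longrightarrow> c = Blue \<and> root_color l = Some Red)"
  proof (cases "Suc (Suc k) < n")
    case False
    then have "Suc k = n - 1" using k(1) by simp
    then have "\<forall>s\<in>set (F (Suc k)). is_leaf s" using expansion_bot(2)[OF n F] by simp
    then show ?thesis unfolding e(2) by (auto simp: is_leaf_def)
  next
    case True
    then obtain xs2 c2 l2 r2 ys2 where f: "F (Suc k) = xs2 @ Node c2 l2 r2 # ys2" "F (Suc (Suc k)) = xs2 @ l2 # r2 # ys2"
      "\<forall>s\<in>set xs2. is_leaf s" using IH(2) unfolding first_expansion_def by blast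
    have adj: "\<not> (length xs2 \<le> length xs \<and> (length xs2 = length xs \<longrightarrow> valency r2 < valency r \<and> \<not> (c = Blue \<and> c2 = Red)))"
      using nl[OF True] unfolding lyn_adj_expansion[OF n F True e(1,2) f(1,2)] .
    have "xs @ l # r # ys = xs2 @ Node c2 l2 r2 # ys2" using e(2) f(1) by simp
    then show ?thesis
    proof (cases rule: split_list_cases)
      case (left zs) then show ?thesis using adj by simp
    next
      case first
      have l: "l = Node c2 l2 r2" using first by simp
      have "valency r2 \<noteq> valency r" using valency_neq N(2) unfolding l by blast
      then show ?thesis using adj f(3) first l by auto
    next
      case second then show ?thesis using f(3) by (auto simp: is_leaf_def)
    next
      case (right zs) then show ?thesis using f(3) by (auto simp: is_leaf_def)
    qed
  qed
  have "\<forall>s\<in>set (F k). bicolored_Lyndon s" using IH(1) N(1) key unfolding e(1,2) by (simp add: bicolored_Lyndon_Node)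
  moreover have "first_expansion n F k" unfolding first_expansion_def using e(1,2) key by blast
  ultimately show ?case by blast
qed

lemma nonleading_of_lyndon:
  assumes n: "2 \<le> n" and F: "expansion n t F" and first: "\<And>k. Suc k < n \<Longrightarrow> first_expansion n F k"
    and t: "bicolored_Lyndon t" and k: "Suc (Suc k) < n"
  shows "\<not> lyn_adj (fstate (F k)) (fstate (F (Suc k))) (fstate (F (Suc (Suc k))))"
proof -
  have lyns: "\<forall>s\<in>set (F k). bicolored_Lyndon s" if "k < n" for k
    using that
  proof (induction k)
    case 0
    then show ?case using F t by (simp add: expansion_def)
  next
    case (Suc k)
    obtain xs c l r ys where "F k = xs @ Node c l r # ys" "F (Suc k) = xs @ l # r # ys"
      using first[OF Suc.prems] unfolding first_expansion_def by blast
    then show ?case using Suc by (auto simp: bicolored_Lyndon_Node)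
  qed
  obtain xs c l r ys where e: "F k = xs @ Node c l r # ys" "F (Suc k) = xs @ l # r # ys" "\<forall>t\<in>set xs. is_leaf t"
    using first[OF Suc_lessD[OF k]] unfolding first_expansion_def by blast
  obtain xs2 c2 l2 r2 ys2 where f: "F (Suc k) = xs2 @ Node c2 l2 r2 # ys2" "F (Suc (Suc k)) = xs2 @ l2 # r2 # ys2"
    using first[OF k] unfolding first_expansion_def by blast
  have c: "bicolored_Lyndon (Node c l r)" using lyns[of k] k e(1) by simp
  have "xs @ l # r # ys = xs2 @ Node c2 l2 r2 # ys2" using e(2) f(1) by simp
  then have "\<not> (length xs2 \<le> length xs \<and> (length xs2 = length xs \<longrightarrow> valency r2 < valency r \<and> \<not> (c = Blue \<and> c2 = Red)))"
  proof (cases rule: split_list_cases)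
    case (left zs) then show ?thesis using e(3) by simp
  next
    case first
    then show ?thesis using c by (auto simp: bicolored_Lyndon_Node)
  qed simp_all
  then show ?thesis unfolding lyn_adj_expansion[OF n F k e(1,2) f(1,2)] .
qed

section \<open>Normal chains and trees\<close>

context split_rule
begin

lemma normal_chains_iff:
  "c \<in> normal_chains \<longleftrightarrow> c \<in> max_chains n \<and> (\<forall>k. Suc k < n \<longrightarrow> \<not> lead_at (from_top n c) k)"
proof -
  have "(\<forall>i<n - 1. \<not> lead_at (from_top n c) (n - 2 - i)) \<longleftrightarrow> (\<forall>k. Suc k < n \<longrightarrow> \<not> lead_at (from_top n c) k)"
  proof (intro iffI allI impI)
    fix k assume a: "\<forall>i<n - 1. \<not> lead_at (from_top n c) (n - 2 - i)" and k: "Suc k < n"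
    have "n - 2 - k < n - 1" "n - 2 - (n - 2 - k) = k" using k by arith+
    then show "\<not> lead_at (from_top n c) k" using a by metis
  next
    fix i assume a: "\<forall>k. Suc k < n \<longrightarrow> \<not> lead_at (from_top n c) k" and i: "i < n - 1"
    have "Suc (n - 2 - i) < n" using i by arith
    then show "\<not> lead_at (from_top n c) (n - 2 - i)" using a by blast
  qed
  then show ?thesis unfolding normal_chains_def by simp
qed

text \<open>The top level contributes the condition on the colour of the root, every other level a
  condition on two consecutive expansions.\<close>

lemma normal_expansion_iff:
  assumes F: "expansion n t F" and t: "t = Node c l r"
  shows "expansion_chain n F \<in> normal_chains \<longleftrightarrow> color_weight c \<noteq> top_col \<and>
    (\<forall>k. Suc (Suc k) < n \<longrightarrow> \<not> adj (fstate (F k)) (fstate (F (Suc k))) (fstate (F (Suc (Suc k)))))"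
proof -
  let ?c = "from_top n (expansion_chain n F)"
  have lift: "lift n ?c k = fstate (F k)" if "k < n" for k by (rule lift_expansion[OF n F that])
  have n1: "Suc 0 < n" using n by simp
  from n F n1 obtain xs d l' r' ys where e: "F 0 = xs @ Node d l' r' # ys" "F (Suc 0) = xs @ l' # r' # ys"
    "splits (length xs) (color_weight d) (fstate (F 0)) (fstate (F (Suc 0)))" by (rule expansion_step)
  have "xs @ Node d l' r' # ys = [Node c l r]" using F e(1) t by (simp add: expansion_def)
  then have "d = c" by (cases xs) auto
  then have 0: "lead_at ?c 0 \<longleftrightarrow> color_weight c = top_col"
    using split_pos_col(2)[OF e(3)] lift[of 0] lift[of 1] n by (simp add: lead_at_def)
  have S: "lead_at ?c (Suc k) \<longleftrightarrow> adj (fstate (F k)) (fstate (F (Suc k))) (fstate (F (Suc (Suc k))))"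
    if "Suc (Suc k) < n" for k
    using lift[of k] lift[of "Suc k"] lift[of "Suc (Suc k)"] that by (simp add: lead_at_def)
  have "(\<forall>k. Suc k < n \<longrightarrow> \<not> lead_at ?c k) \<longleftrightarrow> \<not> lead_at ?c 0 \<and> (\<forall>k. Suc (Suc k) < n \<longrightarrow> \<not> lead_at ?c (Suc k))"
  proof (intro iffI conjI allI impI)
    fix k assume a: "\<not> lead_at ?c 0 \<and> (\<forall>k. Suc (Suc k) < n \<longrightarrow> \<not> lead_at ?c (Suc k))" and "Suc k < n"
    then show "\<not> lead_at ?c k" by (cases k) simp_all
  qed (use n1 in auto)
  then show ?thesis unfolding normal_chains_iff using 0 S expansion_chain_in[OF n F] by simp
qed

lemma expansion_root:
  assumes "expansion n t F"
  obtains c l r where "t = Node c l r"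
proof (cases t)
  case (Leaf a)
  then have "{a} = {1..n}" using assms by (simp add: expansion_def BT_def)
  then have "card {1..n} = 1" by (metis card_1_singleton_iff One_nat_def)
  then show ?thesis using n by simp
qed (rule that)

text \<open>The coboundary of a chain with exactly two completions.\<close>

lemma exact_on_two_completions:
  assumes c: "c1 \<in> max_chains n" "c2 \<in> max_chains n" "c1 \<noteq> c2" and i: "i < n - 1"
    and agree: "agree_off {i} c1 c2"
    and only: "\<And>c. c \<in> max_chains n \<Longrightarrow> agree_off {i} c1 c \<Longrightarrow> c = c1 \<or> c = c2"
  shows "exact_on (max_chains n) (\<lambda>d. (if d = c2 then 1 else 0) + (if d = c1 then 1 else (0::'k::comm_ring_1)))"
proof -
  \<comment> \<open>The primitive is concentrated at the common face, with the sign that this face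
    carries in a face sum.\<close>
  let ?g = "\<lambda>d. if d = del i c1 then (- 1) ^ i else (0::'k)"
  have "(if c = c2 then 1 else 0) + (if c = c1 then 1 else 0) = face_sum ?g c" if cX: "c \<in> max_chains n" for c
  proof -
    have iff: "del j c = del i c1 \<longleftrightarrow> j = i \<and> (c = c1 \<or> c = c2)" if j: "j < n - 1" for j
    proof
      assume "del j c = del i c1"
      then show "j = i \<and> (c = c1 \<or> c = c2)" using del_eqD[OF c(1) i cX j] only[OF cX] by metis
    next
      assume "j = i \<and> (c = c1 \<or> c = c2)"
      moreover have "del i c2 = del i c1"
      proof (rule nth_equalityI)
        show "length (del i c2) = length (del i c1)" using len c i by (simp add: length_del)
        fix m assume "m < length (del i c2)"
        then have "m < n - 1 - 1" using len c i by (simp add: length_del)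
        moreover have "c1 ! m = c2 ! m" if "m < n - 1" "m \<noteq> i" for m
          using agree that unfolding agree_off_def by blast
        ultimately show "del i c2 ! m = del i c1 ! m"
          using i len c by (simp add: nth_del)
      qed
      ultimately show "del j c = del i c1" by blast
    qed
    have "face_sum ?g c = (\<Sum>j<n - 1. if j = i then (if c = c1 \<or> c = c2 then (- 1) ^ j * (- 1) ^ j else 0) else 0)"
      unfolding face_sum_def len[OF cX] by (intro sum.cong[OF refl]) (simp add: iff)
    also have "\<dots> = (if c = c1 \<or> c = c2 then 1 else 0)" using i by (simp flip: power_add)
    finally show ?thesis using c(3) by auto
  qed
  then show ?thesis unfolding exact_on_def by (intro exI[of _ ?g]) blast
qed

section \<open>Expansions of disjoint blocks commute up to sign\<close>

definition same_up_to_sign :: "'k::comm_ring_1 itself \<Rightarrow> wpartition list \<Rightarrow> wpartition list \<Rightarrow> bool" where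
  "same_up_to_sign K c c' \<longleftrightarrow> (\<exists>\<epsilon>\<in>{1, - 1}. exact_on (max_chains n)
    (\<lambda>d. (if d = c' then 1 else 0) - \<epsilon> * (if d = c then 1 else 0 :: 'k)))"

lemma same_up_to_sign_refl: "same_up_to_sign K c c"
  unfolding same_up_to_sign_def by (rule bexI[of _ 1]) (simp_all add: exact_on_zero)

lemma same_up_to_sign_trans:
  fixes K :: "'k::comm_ring_1 itself"
  assumes "same_up_to_sign K a b" "same_up_to_sign K b c"
  shows "same_up_to_sign K a c"
proof -
  obtain \<epsilon> \<epsilon>' where e: "\<epsilon> \<in> {1, - 1}" "\<epsilon>' \<in> {1, - 1}"
    and ex: "exact_on (max_chains n) (\<lambda>d. (if d = b then 1 else 0) - \<epsilon> * (if d = a then 1 else 0 :: 'k))"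
      "exact_on (max_chains n) (\<lambda>d. (if d = c then 1 else 0) - \<epsilon>' * (if d = b then 1 else 0 :: 'k))"
    using assms unfolding same_up_to_sign_def by (elim bexE)
  have "exact_on (max_chains n) (\<lambda>d. ((if d = c then 1 else 0) - \<epsilon>' * (if d = b then 1 else 0)) +
      \<epsilon>' * ((if d = b then 1 else 0) - \<epsilon> * (if d = a then 1 else 0)))"
    by (intro exact_on_add exact_on_scale ex)
  then have "exact_on (max_chains n) (\<lambda>d. (if d = c then 1 else 0) - (\<epsilon>' * \<epsilon>) * (if d = a then 1 else 0))"
    by (simp add: right_diff_distrib mult.assoc)
  moreover have "\<epsilon>' * \<epsilon> \<in> {1, - 1}" using e by auto
  ultimately show ?thesis unfolding same_up_to_sign_def by (intro bexI[of _ "\<epsilon>' * \<epsilon>"])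
qed

lemma same_up_to_sign_two_completions:
  fixes K :: "'k::comm_ring_1 itself"
  assumes "c1 \<in> max_chains n" "c2 \<in> max_chains n" "c1 \<noteq> c2" "i < n - 1" "agree_off {i} c1 c2"
    and "\<And>c. c \<in> max_chains n \<Longrightarrow> agree_off {i} c1 c \<Longrightarrow> c = c1 \<or> c = c2"
  shows "same_up_to_sign K c1 c2"
  unfolding same_up_to_sign_def using exact_on_two_completions[OF assms, where 'k = 'k]
  by (intro bexI[of _ "- 1"]) simp_all

lemma nth_of_two:
  assumes "p < length (A @ u # B @ v # C)" "p \<noteq> length A" "p \<noteq> length A + 1 + length B"
  shows "(A @ u # B @ v # C) ! p \<in> set A \<union> set B \<union> set C"
proof -
  consider "p < length A" | q where "p = length A + 1 + q" "q < length B"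
    | q where "p = length A + 1 + length B + 1 + q" "q < length C"
  proof -
    assume 1: "p < length A \<Longrightarrow> thesis" and 2: "\<And>q. p = length A + 1 + q \<Longrightarrow> q < length B \<Longrightarrow> thesis"
      and 3: "\<And>q. p = length A + 1 + length B + 1 + q \<Longrightarrow> q < length C \<Longrightarrow> thesis"
    show thesis
      using 1 2[of "p - length A - 1"] 3[of "p - length A - 1 - length B - 1"] assms by force
  qed
  then show ?thesis by cases (simp_all add: nth_append)
qed

text \<open>Both parts of the second split are blocks of \<open>T\<close>. They can only be
  distributed over the parts of the first split in one way, because the minima must match and both
  parts are nonempty; the weights are then forced as well.\<close>

lemma split_into_kept:
  assumes "splits p u S S'" "splits p w S S1" "state n S'" "state n T" "wp_le n (set T) (set S')"
    "S1 ! p \<in> set T" "S1 ! Suc p \<in> set T"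
  shows "S' = S1"
proof -
  obtain xs ys L a R b where e: "S = xs @ (L \<union> R, a + b + u) # ys" "S' = xs @ (L, a) # (R, b) # ys"
    "p = length xs" "L \<inter> R = {}" "L \<noteq> {}" "R \<noteq> {}" "Min L < Min R" "u \<le> 1"
    using assms(1) by (rule splitsE)
  obtain xs' ys' L' a' R' b' where f: "S = xs' @ (L' \<union> R', a' + b' + w) # ys'" "S1 = xs' @ (L', a') # (R', b') # ys'"
    "p = length xs'" "L' \<inter> R' = {}" "L' \<noteq> {}" "R' \<noteq> {}" "Min L' < Min R'" "w \<le> 1"
    using assms(2) by (rule splitsE)
  have eq: "xs = xs'" "ys = ys'" "L \<union> R = L' \<union> R'" "a + b + u = a' + b' + w"
    using e(1,3) f(1,3) by auto
  have T: "(L', a') \<in> set T" "(R', b') \<in> set T"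
    using assms(6,7) unfolding f(2,3) splits_nth by (simp_all add: nth_append)
  have S': "(L, a) \<in> set S'" "(R, b) \<in> set S'" unfolding e(2) by simp_all
  have fin: "finite L" "finite R" "finite L'" "finite R'"
    using state_blocks(3)[OF assms(3) S'(1)] state_blocks(3)[OF assms(3) S'(2)]
      state_blocks(3)[OF assms(4) T(1)] state_blocks(3)[OF assms(4) T(2)] by simp_all
  have W: "set T \<in> weighted_partitions n" "set S' \<in> weighted_partitions n" using assms by (auto simp: state_def)
  note bb = below_block[OF W assms(5)]
  have m: "Min L = Min L'"
    using Min_Un_less[OF fin(1,2) e(5,6,7)] Min_Un_less[OF fin(3,4) f(5,6,7)] eq(3) by simp
  have "Min L \<in> L" using fin(1) e(5) by (rule Min_in)
  moreover have "Min L \<in> L'" unfolding m using fin(3) f(5) by (rule Min_in)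
  ultimately have LL: "L' \<subseteq> L" using bb[OF T(1) S'(1), of "Min L"] by simp
  then have RR: "R \<subseteq> R'" using eq(3) e(4) by blast
  obtain x where "x \<in> R" using e(6) by blast
  then have "R' \<subseteq> R" using bb[OF T(2) S'(2), of x] RR by auto
  then have R: "R = R'" using RR by blast
  then have L: "L = L'" using LL eq(3) e(4) f(4) by blast
  have "a = a'"
    using state_le_block[OF assms(4,3,5) S'(1)] state_below_self[OF assms(4) T(1)] L by simp
  moreover have "b = b'"
    using state_le_block[OF assms(4,3,5) S'(2)] state_below_self[OF assms(4) T(2)] R by simp
  ultimately show ?thesis using e(2) f(2) eq L R by simp
qed

lemma from_top_inj:
  assumes "length c = n - 1" "length c' = n - 1" "\<And>k. k < n - 1 \<Longrightarrow> from_top n c k = from_top n c' k"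
  shows "c = c'"
proof (rule nth_equalityI)
  show "length c = length c'" using assms by simp
  fix i assume "i < length c"
  then have i: "i < n - 1" "n - 2 - i < n - 1" using assms(1) by simp_all
  show "c ! i = c' ! i" unfolding nth_from_top[OF i(1)] by (rule assms(3)[OF i(2)])
qed

text \<open>Between levels \<open>k\<close> and \<open>k + 2\<close> two different blocks are split,
  each once. The level between is determined by which of them is split first, so the face omitting
  it has two completions, and its relation says that their classes sum to zero.\<close>

lemma swap_expansions:
  assumes F: "expansion n t F" and G: "expansion n t G" and k: "Suc (Suc k) < n"
    and same: "\<And>j. j \<noteq> Suc k \<Longrightarrow> G j = F j"
    and Fk: "F k = xs @ Node c l r # zs @ Node d l2 r2 # ys"
    and F1: "F (Suc k) = xs @ l # r # zs @ Node d l2 r2 # ys"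
    and G1: "G (Suc k) = xs @ Node c l r # zs @ l2 # r2 # ys"
    and F2: "F (Suc (Suc k)) = xs @ l # r # zs @ l2 # r2 # ys"
  shows "same_up_to_sign K (expansion_chain n F) (expansion_chain n G)"
proof (rule same_up_to_sign_two_completions)
  let ?cF = "expansion_chain n F" and ?cG = "expansion_chain n G" and ?i = "n - 2 - Suc k"
  show X: "?cF \<in> max_chains n" "?cG \<in> max_chains n" using expansion_chain_in[OF n] F G by blast+
  have i: "?i < n - 1" "n - 2 - ?i = Suc k" using k by arith+
  show "?i < n - 1" by (rule i(1))
  have ft: "from_top n ?cF j = set (fstate (F j))" "from_top n ?cG j = set (fstate (G j))" if "j < n" for j
    using from_top_expansion_chain[OF n F that] from_top_expansion_chain[OF n G that] by simp_all
  have i_iff: "j = ?i" if "j < n - 1" "n - 2 - j = Suc k" for j using that by arith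
  have off: "from_top n c' j = from_top n ?cF j" if "agree_off {?i} ?cF c'" "j < n" "j \<noteq> Suc k" for c' j
  proof (cases "j < n - 1")
    case True
    then have "n - 2 - j < n - 1" "n - 2 - j \<noteq> ?i" using that(3) k by arith+
    then have "?cF ! (n - 2 - j) = c' ! (n - 2 - j)" using that(1) unfolding agree_off_def by blast
    then show ?thesis using True by (simp add: from_top_def)
  qed (simp add: from_top_def)
  show "agree_off {?i} ?cF ?cG" unfolding agree_off_def
  proof (intro allI impI)
    fix j assume j: "j < n - 1" "j \<notin> {?i}"
    have "n - 2 - j \<noteq> Suc k" "n - 2 - j < n" using j i_iff by auto
    then show "?cF ! j = ?cG ! j" unfolding nth_from_top[OF j(1)] using ft same by simp
  qed
  have stk: "forest n (F k)" "forest n (F (Suc k))" "forest n (G k)" using expansion_forest[OF n] F G k by simp_all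
  have spF: "splits (length xs) (color_weight c) (fstate (F k)) (fstate (F (Suc k)))"
    unfolding Fk F1 by (rule expands_splits) (use stk Fk in simp)
  have spG: "splits (length xs + 1 + length zs) (color_weight d) (fstate (F k)) (fstate (G (Suc k)))"
  proof -
    have "forest n ((xs @ Node c l r # zs) @ Node d l2 r2 # ys)" using stk(1) Fk by simp
    from expands_splits[OF this] show ?thesis unfolding Fk G1 by simp
  qed
  have "fstate (F (Suc k)) \<noteq> fstate (G (Suc k))"
    using split_pos_col(1)[OF spF] split_pos_col(1)[OF spG] by auto
  moreover have st1: "state n (fstate (F (Suc k)))" "state n (fstate (G (Suc k)))"
    using expansion_state(1)[OF n] F G k by simp_all
  ultimately have "set (fstate (F (Suc k))) \<noteq> set (fstate (G (Suc k)))"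
    using splits_unique[OF st1 spF spG] by blast
  then show "?cF \<noteq> ?cG" using ft[of "Suc k"] k by (metis Suc_lessD)
  fix c' assume c': "c' \<in> max_chains n" "agree_off {?i} ?cF c'"
  have dc: "down_chain n (from_top n c')" and len: "length c' = n - 1" using c'(1) max_chains_iff[OF n] by auto
  let ?x = "from_top n c' (Suc k)"
  have t: "from_top n c' k = set (fstate (F k))" "from_top n c' (Suc (Suc k)) = set (fstate (F (Suc (Suc k))))"
    using off[OF c'(2), of k] off[OF c'(2), of "Suc (Suc k)"] ft(1)[of k] ft(1)[of "Suc (Suc k)"] k by simp_all
  have sk: "state n (fstate (F k))" and sT: "state n (fstate (F (Suc (Suc k))))"
    using expansion_state(1)[OF n F] k by simp_all
  have x: "?x \<in> weighted_partitions n" "wp_le n ?x (set (fstate (F k)))" "wp_le n (set (fstate (F (Suc (Suc k))))) ?x"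
    "card ?x = Suc (length (fstate (F k)))"
    using dc k t expansion_forest[OF n F, of k] unfolding down_chain_def by (metis Suc_lessD, metis Suc_lessD, metis, simp)
  obtain p u S' where S': "splits p u (fstate (F k)) S'" "set S' = ?x" "state n S'"
    using splits_cover[OF sk x(1,2,4)] .
  have le: "wp_le n (set (fstate (F (Suc (Suc k))))) (set S')" using x(3) S'(2) by simp
  have pl: "p < length (fstate xs @ weighted_leaves (Node c l r) # fstate zs @ weighted_leaves (Node d l2 r2) # fstate ys)"
    using length_splits[OF S'(1)] Fk by simp
  \<comment> \<open>Every other block of level \<open>k\<close> still occurs at level
    \<open>k + 2\<close> and so cannot be split in between.\<close>
  have "p = length xs \<or> p = length xs + 1 + length zs"
  proof (rule ccontr)
    assume "\<not> ?thesis"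
    then have "fstate (F k) ! p \<in> set (fstate xs) \<union> set (fstate zs) \<union> set (fstate ys)"
      using nth_of_two[OF pl] unfolding Fk by simp
    then have "fstate (F k) ! p \<in> set (fstate (F (Suc (Suc k))))" unfolding F2 by auto
    then show False by (rule kept_block_not_split[OF sT S'(3) le S'(1)])
  qed
  then have "?x = set (fstate (F (Suc k))) \<or> ?x = set (fstate (G (Suc k)))"
  proof
    assume p: "p = length xs"
    have "S' = fstate (F (Suc k))"
    proof (rule split_into_kept[OF S'(1)[unfolded p] spF S'(3) sT le])
      show "fstate (F (Suc k)) ! length xs \<in> set (fstate (F (Suc (Suc k))))"
        "fstate (F (Suc k)) ! Suc (length xs) \<in> set (fstate (F (Suc (Suc k))))"
        unfolding F1 F2 by (simp_all add: nth_append)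
    qed
    then show ?thesis using S'(2) by simp
  next
    assume p: "p = length xs + 1 + length zs"
    have "S' = fstate (G (Suc k))"
    proof (rule split_into_kept[OF S'(1)[unfolded p] spG S'(3) sT le])
      have "fstate (G (Suc k)) = (fstate xs @ weighted_leaves (Node c l r) # fstate zs) @ weighted_leaves l2 # weighted_leaves r2 # fstate ys"
        "length xs + 1 + length zs = length (fstate xs @ weighted_leaves (Node c l r) # fstate zs)"
        unfolding G1 by simp_all
      then have "fstate (G (Suc k)) ! (length xs + 1 + length zs) = weighted_leaves l2"
        "fstate (G (Suc k)) ! Suc (length xs + 1 + length zs) = weighted_leaves r2"
        by (simp_all only: splits_nth)
      then show "fstate (G (Suc k)) ! (length xs + 1 + length zs) \<in> set (fstate (F (Suc (Suc k))))"
        "fstate (G (Suc k)) ! Suc (length xs + 1 + length zs) \<in> set (fstate (F (Suc (Suc k))))"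
        unfolding F2 by simp_all
    qed
    then show ?thesis using S'(2) by simp
  qed
  then show "c' = ?cF \<or> c' = ?cG"
  proof
    assume a: "?x = set (fstate (F (Suc k)))"
    have "c' = ?cF"
    proof (rule from_top_inj[OF len])
      show "length ?cF = n - 1" by (simp add: expansion_chain_def)
      show "from_top n c' j = from_top n ?cF j" if "j < n - 1" for j
        using off[OF c'(2), of j] a ft(1)[of j] that by (cases "j = Suc k") simp_all
    qed
    then show ?thesis ..
  next
    assume a: "?x = set (fstate (G (Suc k)))"
    have "c' = ?cG"
    proof (rule from_top_inj[OF len])
      show "length ?cG = n - 1" by (simp add: expansion_chain_def)
      show "from_top n c' j = from_top n ?cG j" if "j < n - 1" for j
        using off[OF c'(2), of j] a ft[of j] same[of j] that by (cases "j = Suc k") simp_all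
    qed
    then show ?thesis ..
  qed
qed

text \<open>Insertion sort by adjacent swaps. With the lower steps sorted, an unsorted step
  \<open>k\<close> is followed by the expansion of a tree further right. Swapping the two makes step
  \<open>k\<close> correct, and the induction hypothesis sorts the steps below again without
  touching levels up to \<open>k + 1\<close>.\<close>

lemma straighten_expansion:
  assumes "expansion n t F"
  shows "\<exists>F'. expansion n t F' \<and> (\<forall>j\<le>n - 1 - d. F' j = F j) \<and>
    (\<forall>j\<ge>n - 1 - d. Suc j < n \<longrightarrow> last_expansion n F' j) \<and> same_up_to_sign K (expansion_chain n F) (expansion_chain n F')"
  using assms
proof (induction d arbitrary: F)
  case 0
  have "\<not> Suc j < n" if "n - 1 \<le> j" for j using that by arith
  then show ?case using 0 same_up_to_sign_refl by (intro exI[of _ F]) simp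
next
  case (Suc d)
  show ?case
  proof (cases "Suc d \<le> n - 1")
    case False
    then have "n - 1 - Suc d = n - 1 - d" by simp
    then show ?thesis using Suc by simp
  next
    case True
    define k where "k = n - 1 - Suc d"
    have k: "Suc k < n" "n - 1 - d = Suc k" using True n by (auto simp: k_def)
    obtain F1 where F1: "expansion n t F1" "\<And>j. j \<le> Suc k \<Longrightarrow> F1 j = F j"
      "\<And>j. Suc k \<le> j \<Longrightarrow> Suc j < n \<Longrightarrow> last_expansion n F1 j"
      "same_up_to_sign K (expansion_chain n F) (expansion_chain n F1)"
      using Suc.IH[OF Suc.prems] unfolding k(2) by blast
    show ?thesis unfolding k_def[symmetric]
    proof (cases "last_expansion n F1 k")
      case True
      then have "last_expansion n F1 j" if "k \<le> j" "Suc j < n" for j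
        using that F1(3)[of j] by (cases "j = k") simp_all
      then show "\<exists>F'. expansion n t F' \<and> (\<forall>j\<le>k. F' j = F j) \<and> (\<forall>j\<ge>k. Suc j < n \<longrightarrow> last_expansion n F' j) \<and>
          same_up_to_sign K (expansion_chain n F) (expansion_chain n F')"
        using F1 by (intro exI[of _ F1]) simp
    next
      case False
      from n F1(1) k(1) obtain xs c l r ws where e: "F1 k = xs @ Node c l r # ws" "F1 (Suc k) = xs @ l # r # ws"
        "splits (length xs) (color_weight c) (fstate (F1 k)) (fstate (F1 (Suc k)))" by (rule expansion_step)
      have ws: "\<not> (\<forall>s\<in>set ws. is_leaf s)" using False e(1,2) unfolding last_expansion_def by blast
      have k2: "Suc (Suc k) < n"
      proof (rule ccontr)
        assume "\<not> ?thesis"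
        then have "Suc k = n - 1" using k(1) by simp
        then have "\<forall>s\<in>set (F1 (Suc k)). is_leaf s" using expansion_bot(2)[OF n F1(1)] by simp
        then show False using ws unfolding e(2) by simp
      qed
      obtain xs2 d2 l2 r2 ys where f: "F1 (Suc k) = xs2 @ Node d2 l2 r2 # ys" "F1 (Suc (Suc k)) = xs2 @ l2 # r2 # ys"
        "\<forall>s\<in>set ys. is_leaf s" using F1(3)[of "Suc k"] k2 unfolding last_expansion_def by blast
      have "xs @ l # r # ws = xs2 @ Node d2 l2 r2 # ys" using e(2) f(1) by simp
      \<comment> \<open>\<open>ws\<close> contains a nonleaf, so the last nonleaf lies in
        \<open>ws\<close>: the two expansions concern disjoint trees.\<close>
      then obtain zs where zs: "ws = zs @ Node d2 l2 r2 # ys" "xs2 = xs @ l # r # zs"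
      proof (cases rule: split_list_cases)
        case (right zs) then show thesis by (rule that)
      qed (use ws f(3) in auto)
      define G where "G = F1(Suc k := xs @ Node c l r # zs @ l2 # r2 # ys)"
      have Gk: "G (Suc k) = xs @ Node c l r # zs @ l2 # r2 # ys" "\<And>j. j \<noteq> Suc k \<Longrightarrow> G j = F1 j"
        by (simp_all add: G_def)
      have GE: "expansion n t G" unfolding expansion_def
      proof (intro conjI allI impI)
        show "t \<in> BT n" "normalized t" "G 0 = [t]" using F1(1) Gk(2)[of 0] by (simp_all add: expansion_def)
        fix j assume j: "Suc j < n"
        consider "j = k" | "j = Suc k" | "j \<noteq> k" "j \<noteq> Suc k" by blast
        then show "\<exists>p. expands p (G j) (G (Suc j))"
        proof cases
          case 1
          have "expands (length (xs @ Node c l r # zs)) ((xs @ Node c l r # zs) @ Node d2 l2 r2 # ys)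
              ((xs @ Node c l r # zs) @ l2 # r2 # ys)" by (rule expandsI[OF refl])
          then show ?thesis using 1 Gk e(1) zs(1) by (intro exI) simp
        next
          case 2
          have "expands (length xs) (xs @ Node c l r # zs @ l2 # r2 # ys) (xs @ l # r # zs @ l2 # r2 # ys)"
            by (rule expandsI[OF refl])
          then show ?thesis using 2 Gk f(2) zs(2) by (intro exI) simp
        next
          case 3
          then show ?thesis using Gk(2) F1(1) j by (simp add: expansion_def)
        qed
      qed
      have sim: "same_up_to_sign K (expansion_chain n F1) (expansion_chain n G)"
        using e(1,2) f(2) zs by (intro swap_expansions[OF F1(1) GE k2 Gk(2) _ _ Gk(1)]) simp_all
      obtain F3 where F3: "expansion n t F3" "\<And>j. j \<le> Suc k \<Longrightarrow> F3 j = G j"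
        "\<And>j. Suc k \<le> j \<Longrightarrow> Suc j < n \<Longrightarrow> last_expansion n F3 j"
        "same_up_to_sign K (expansion_chain n G) (expansion_chain n F3)"
        using Suc.IH[OF GE] unfolding k(2) by blast
      have "F3 k = (xs @ Node c l r # zs) @ Node d2 l2 r2 # ys" "F3 (Suc k) = (xs @ Node c l r # zs) @ l2 # r2 # ys"
        using F3(2)[of k] F3(2)[of "Suc k"] Gk e(1) zs(1) by simp_all
      then have "last_expansion n F3 k" unfolding last_expansion_def using f(3) by blast
      then have "last_expansion n F3 j" if "k \<le> j" "Suc j < n" for j
        using that F3(3)[of j] by (cases "j = k") simp_all
      moreover have "F3 j = F j" if "j \<le> k" for j using that F3(2)[of j] Gk(2)[of j] F1(2)[of j] by simp
      moreover have "same_up_to_sign K (expansion_chain n F) (expansion_chain n F3)"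
        using same_up_to_sign_trans[OF same_up_to_sign_trans[OF F1(4) sim] F3(4)] .
      ultimately show "\<exists>F'. expansion n t F' \<and> (\<forall>j\<le>k. F' j = F j) \<and> (\<forall>j\<ge>k. Suc j < n \<longrightarrow> last_expansion n F' j) \<and>
          same_up_to_sign K (expansion_chain n F) (expansion_chain n F')"
        using F3(1) by (intro exI[of _ F3]) simp
    qed
  qed
qed

lemma expansion_same_up_to_sign:
  assumes "expansion n t F"
  shows "same_up_to_sign K (expansion_chain n F) (reduced_tree_chain n t)"
proof -
  obtain F' where F': "expansion n t F'" "\<forall>j\<ge>0. Suc j < n \<longrightarrow> last_expansion n F' j"
    "same_up_to_sign K (expansion_chain n F) (expansion_chain n F')"
    using straighten_expansion[OF assms, of "n - 1" K] by auto
  then show ?thesis using reduced_tree_chain_expansion[OF n F'(1)] by simp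
qed

end

section \<open>The two bases\<close>

text \<open>A red first split forces the top weight to be the largest one above \<open>T\<close>, so
  every other top weight is smaller.\<close>

lemma comb_top_max:
  assumes run: "run comb_adj [({1..n}, i)] S1 T" and col: "split_col [({1..n}, i)] S1 = 1" and T: "state n T"
    and le: "wp_le n (set T) {({1..n}, i')}" and i': "i' < n" "i' \<noteq> i"
  shows "i' < i"
proof -
  have "split_pos [({1..n}, i)] S1 = 0" using length_splits[OF run_splits[OF run]] by simp
  then have "wsum (set T) {1..n} + card (below (set T) {1..n}) = Suc i" using comb_run_max[OF run T col] by simp
  moreover have "state n [({1..n}, i')]" using top_in[OF i'(1)] by (simp add: state_def)
  then have "i' < wsum (set T) {1..n} + card (below (set T) {1..n})"
    using state_le_block(2)[OF T, of "[({1..n}, i')]" "{1..n}" i'] le by simp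
  ultimately show ?thesis using i'(2) by simp
qed

text \<open>A blue first split forces the least top weight; the key \<open>n - i\<close> reverses
  the order so that this one is the largest.\<close>

lemma lyn_top_max:
  assumes run: "run lyn_adj [({1..n}, i)] S1 T" and col: "split_col [({1..n}, i)] S1 = 0" and T: "state n T"
    and le: "wp_le n (set T) {({1..n}, i')}" and i': "i' < n" "i' \<noteq> i"
  shows "n - i' < n - i"
proof -
  have "split_pos [({1..n}, i)] S1 = 0" using length_splits[OF run_splits[OF run]] by simp
  then have "wsum (set T) {1..n} = i" using lyn_run_min[OF run T col] by simp
  moreover have "state n [({1..n}, i')]" using top_in[OF i'(1)] by (simp add: state_def)
  then have "wsum (set T) {1..n} \<le> i'"
    using state_le_block(1)[OF T, of "[({1..n}, i')]" "{1..n}" i'] le by simp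
  ultimately show ?thesis using i' by simp
qed

lemma split_rule_comb: "2 \<le> n \<Longrightarrow> split_rule n comb_adj (comb_key n) 1 (\<lambda>i. i)"
proof (rule split_rule.intro)
  show "(1::nat) \<le> 1" by simp
qed (assumption | (rule comb_max comb_top_max comb_exchange; assumption))+

lemma split_rule_lyn: "2 \<le> n \<Longrightarrow> split_rule n lyn_adj (lyn_key n) 0 (\<lambda>i. n - i)"
proof (rule split_rule.intro)
  show "(0::nat) \<le> 1" by simp
qed (assumption | (rule lyn_max lyn_top_max lyn_exchange; assumption))+

text \<open>Deleting the last or the first of \<open>n\<close> entries would leave maximal chains
  starting at the first and the second entry respectively. Both entries would then have
  \<open>n - 1\<close> blocks, against strict descent.\<close>

lemma no_longer_chains:
  assumes n: "2 \<le> n"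
  shows "poset_chains (weighted_partitions n - {wp_bot n}) (wp_le n) (int n - 2 + 1) = {}"
proof (rule ccontr)
  let ?P = "weighted_partitions n - {wp_bot n}"
  assume "\<not> ?thesis"
  then obtain c where c: "c \<in> poset_chains ?P (wp_le n) (int n - 2 + 1)" by blast
  then have "int (length c) = int n" by (simp add: poset_chains_def)
  then have len: "length c = n" by simp
  have "del (n - 1) c \<in> max_chains n" "del 0 c \<in> max_chains n"
    using del_in_poset_chains[OF c, of "n - 1"] del_in_poset_chains[OF c, of 0] len n by simp_all
  then have dc: "down_chain n (from_top n (del (n - 1) c))" "down_chain n (from_top n (del 0 c))"
    using max_chains_iff[OF n] by blast+
  have n': "n - 2 < n - 1" "n - 2 < n" "n - 2 - (n - 2) = 0" "Suc (n - 2) = n - 1" using n by arith+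
  have "card (from_top n (del (n - 1) c) (n - 2)) = n - 1" "card (from_top n (del 0 c) (n - 2)) = n - 1"
    using dc n'(1,4) n unfolding down_chain_def by (auto simp: numeral_2_eq_2)
  then have "card (c ! 0) = n - 1" "card (c ! 1) = n - 1"
    using nth_del[of "n - 1" c 0] nth_del[of 0 c 0] len n n' by (simp_all add: from_top_def)
  moreover have "c ! 0 \<in> weighted_partitions n" "c ! 1 \<in> weighted_partitions n" "wp_le n (c ! 0) (c ! 1)" "c ! 0 \<noteq> c ! 1"
    using c len n by (auto simp: poset_chains_def sorted_wrt_iff_nth_less subset_iff)
  ultimately show False using wp_le_antisym_card[of "c ! 0" n "c ! 1"] by simp
qed

section \<open>Passage to the cohomology module and the two families of trees\<close>

lemma cohomology_basis_of_coset_basis: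
  assumes "2 \<le> n" "coset_basis K (max_chains n) S"
  shows "cohomology_basis K (weighted_partitions n - {wp_bot n}) (wp_le n) (int n - 2) S"
  using finite_weighted_partitions no_longer_chains[OF assms(1)] assms(2)
  by (intro coset_basis_imp_cohomology_basis) simp_all

text \<open>Normal chains expand the last nonleaf first, and this is the order in which postorder
  merges in reverse. So they are the chains of the trees themselves, with no sign to
  correct.\<close>

lemma comb_basis:
  assumes n: "2 \<le> n"
  shows "coset_basis K (max_chains n) (reduced_tree_chain n ` {t \<in> Comb2 n. root_color t = Some Blue})"
proof -
  interpret split_rule n comb_adj "comb_key n" 1 "\<lambda>i. i" by (rule split_rule_comb[OF n])
  have "normal_chains = reduced_tree_chain n ` {t \<in> Comb2 n. root_color t = Some Blue}"
  proof
    show "normal_chains \<subseteq> reduced_tree_chain n ` {t \<in> Comb2 n. root_color t = Some Blue}"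
    proof
      fix c assume c: "c \<in> normal_chains"
      then have "c \<in> max_chains n" unfolding normal_chains_iff by blast
      then obtain t F where F: "expansion n t F" "c = expansion_chain n F" by (rule max_chain_expansion[OF n])
      obtain d l r where t: "t = Node d l r" using expansion_root[OF F(1)] by blast
      have nl: "color_weight d \<noteq> 1" "\<And>k. Suc (Suc k) < n \<Longrightarrow> \<not> comb_adj (fstate (F k)) (fstate (F (Suc k))) (fstate (F (Suc (Suc k))))"
        using c normal_expansion_iff[OF F(1) t] F(2) by blast+
      note comb = comb_of_nonleading[OF n F(1) nl(2)]
      have "F 0 = [t]" "t \<in> BT n" using F(1) by (simp_all add: expansion_def)
      then have "t \<in> Comb2 n" using comb[of 0] n by (simp add: Comb2_def)
      moreover have "root_color t = Some Blue" using nl(1) t by (cases d) simp_all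
      moreover have "c = reduced_tree_chain n t"
        unfolding F(2) using comb by (intro reduced_tree_chain_expansion[OF n F(1), symmetric]) simp
      ultimately show "c \<in> reduced_tree_chain n ` {t \<in> Comb2 n. root_color t = Some Blue}" by blast
    qed
    show "reduced_tree_chain n ` {t \<in> Comb2 n. root_color t = Some Blue} \<subseteq> normal_chains"
    proof (rule image_subsetI)
      fix t assume "t \<in> {t \<in> Comb2 n. root_color t = Some Blue}"
      then have t: "t \<in> BT n" "bicolored_comb t" "root_color t = Some Blue" by (auto simp: Comb2_def)
      have "normalized t" using t(2) by (simp add: bicolored_comb_def)
      obtain F where F: "expansion n t F" "\<And>k. Suc k < n \<Longrightarrow> last_expansion n F k"
        by (rule last_expansion_exists[OF n t(1) \<open>normalized t\<close>]) (rule that, assumption, simp)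
      obtain d l r where tn: "t = Node d l r" using expansion_root[OF F(1)] by blast
      have chain: "reduced_tree_chain n t = expansion_chain n F"
        by (rule reduced_tree_chain_expansion[OF n F(1)]) (rule F(2))
      have nl: "\<not> comb_adj (fstate (F k)) (fstate (F (Suc k))) (fstate (F (Suc (Suc k))))" if "Suc (Suc k) < n" for k
        by (rule nonleading_of_comb[OF n F(1) _ t(2) that]) (rule F(2))
      have "color_weight d \<noteq> 1" using t(3) tn by simp
      then show "reduced_tree_chain n t \<in> normal_chains"
        unfolding chain normal_expansion_iff[OF F(1) tn] using nl by simp
    qed
  qed
  then show ?thesis using coset_basis_normal_chains[of K] by simp
qed

lemma tree_expansion:
  assumes "2 \<le> n" "t \<in> BT n" "normalized t"
  obtains F where "expansion n t F" "reduced_tree_chain n t = expansion_chain n F"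
proof -
  obtain F where F: "expansion n t F" "\<And>k. Suc k < n \<Longrightarrow> last_expansion n F k"
    by (rule last_expansion_exists[OF assms]) (rule that, assumption, simp)
  have "reduced_tree_chain n t = expansion_chain n F"
    by (rule reduced_tree_chain_expansion[OF assms(1) F(1)]) (rule F(2))
  then show thesis using F(1) by (intro that)
qed

text \<open>Normal chains expand from left to right, against postorder. They are in bijection with
  the trees, and each is replaced by the chain of its tree, which represents the same class up to
  sign.\<close>

lemma lyndon_basis:
  fixes K :: "'k::comm_ring_1 itself"
  assumes n: "2 \<le> n"
  shows "coset_basis K (max_chains n) (reduced_tree_chain n ` {t \<in> Lyn2 n. root_color t = Some Red})"
proof -
  interpret split_rule n lyn_adj "lyn_key n" 0 "\<lambda>i. n - i" by (rule split_rule_lyn[OF n])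
  let ?L = "{t \<in> Lyn2 n. root_color t = Some Red}"
  \<comment> \<open>The graph of the bijection between normal chains and trees: \<open>c\<close>
    arises from \<open>t\<close> by expanding from left to right.\<close>
  define E where "E c t \<longleftrightarrow> (\<exists>F. expansion n t F \<and> (\<forall>k. Suc k < n \<longrightarrow> first_expansion n F k) \<and> c = expansion_chain n F)" for c t
  have tree: "\<exists>t\<in>?L. E c t" if c: "c \<in> normal_chains" for c
  proof -
    have "c \<in> max_chains n" using c unfolding normal_chains_iff by blast
    then obtain t F where F: "expansion n t F" "c = expansion_chain n F" by (rule max_chain_expansion[OF n])
    obtain d l r where t: "t = Node d l r" using expansion_root[OF F(1)] by blast
    have nl: "color_weight d \<noteq> 0" "\<And>k. Suc (Suc k) < n \<Longrightarrow> \<not> lyn_adj (fstate (F k)) (fstate (F (Suc k))) (fstate (F (Suc (Suc k))))"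
      using c normal_expansion_iff[OF F(1) t] F(2) by blast+
    note lyn = lyndon_of_nonleading[OF n F(1) nl(2)]
    have "F 0 = [t]" "t \<in> BT n" using F(1) by (simp_all add: expansion_def)
    then have "t \<in> Lyn2 n" using lyn[of 0] n by (simp add: Lyn2_def)
    moreover have "root_color t = Some Red" using nl(1) t by (cases d) simp_all
    moreover have "E c t" unfolding E_def using F lyn by (intro exI[of _ F]) simp
    ultimately show ?thesis by (intro bexI[of _ t]) simp_all
  qed
  have chain: "\<exists>c\<in>normal_chains. E c t" if tL: "t \<in> ?L" for t
  proof -
    have t: "t \<in> BT n" "bicolored_Lyndon t" "root_color t = Some Red" using tL by (auto simp: Lyn2_def)
    have "normalized t" using t(2) by (simp add: bicolored_Lyndon_def)
    obtain F where F: "expansion n t F" "\<And>k. Suc k < n \<Longrightarrow> first_expansion n F k"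
      by (rule first_expansion_exists[OF n t(1) \<open>normalized t\<close>]) (rule that, assumption, simp)
    obtain d l r where tn: "t = Node d l r" using expansion_root[OF F(1)] by blast
    have nl: "\<not> lyn_adj (fstate (F k)) (fstate (F (Suc k))) (fstate (F (Suc (Suc k))))" if "Suc (Suc k) < n" for k
      by (rule nonleading_of_lyndon[OF n F(1) _ t(2) that]) (rule F(2))
    have "color_weight d \<noteq> 0" using t(3) tn by simp
    then have "expansion_chain n F \<in> normal_chains"
      unfolding normal_expansion_iff[OF F(1) tn] using nl by simp
    moreover have "E (expansion_chain n F) t" unfolding E_def using F by (intro exI[of _ F]) simp
    ultimately show ?thesis by (rule bexI[rotated])
  qed
  have E_tree: "t = s" if "E c t" "E c s" for c t s
    using that unfolding E_def by (elim exE conjE) (rule expansion_chain_inj[OF n], assumption+, simp)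
  have E_chain: "c = c'" if "E c t" "E c' t" for c c' t
    using that unfolding E_def by (elim exE conjE) (simp, rule first_expansion_unique[OF n], simp_all)
  have "\<forall>c\<in>normal_chains. \<exists>t. t \<in> ?L \<and> E c t" using tree by (meson bexE)
  from bchoice[OF this] obtain T where T: "\<forall>c\<in>normal_chains. T c \<in> ?L \<and> E c (T c)" by (elim exE)
  let ?\<phi> = "\<lambda>c. reduced_tree_chain n (T c)"
  have image: "?\<phi> ` normal_chains = reduced_tree_chain n ` ?L"
  proof
    show "?\<phi> ` normal_chains \<subseteq> reduced_tree_chain n ` ?L"
    proof (rule image_subsetI)
      fix c assume "c \<in> normal_chains"
      then have "T c \<in> ?L" using T by blast
      then show "?\<phi> c \<in> reduced_tree_chain n ` ?L" by (rule imageI)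
    qed
    show "reduced_tree_chain n ` ?L \<subseteq> ?\<phi> ` normal_chains"
    proof (rule image_subsetI)
      fix t assume "t \<in> ?L"
      then obtain c where c: "c \<in> normal_chains" "E c t" using chain by (meson bexE)
      have "E c (T c)" using T c(1) by blast
      then have "T c = t" using c(2) by (rule E_tree)
      then show "reduced_tree_chain n t \<in> ?\<phi> ` normal_chains" using c(1) by (intro image_eqI[of _ _ c]) simp_all
    qed
  qed
  have inj: "inj_on ?\<phi> normal_chains"
  proof (rule inj_onI)
    fix c c' assume c: "c \<in> normal_chains" "c' \<in> normal_chains" "?\<phi> c = ?\<phi> c'"
    have norm: "T c \<in> BT n" "normalized (T c)" "T c' \<in> BT n" "normalized (T c')"
      using T c(1,2) by (auto simp: Lyn2_def bicolored_Lyndon_def)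
    obtain F where F: "expansion n (T c) F" "reduced_tree_chain n (T c) = expansion_chain n F"
      using tree_expansion[OF n norm(1,2)] .
    obtain G where G: "expansion n (T c') G" "reduced_tree_chain n (T c') = expansion_chain n G"
      using tree_expansion[OF n norm(3,4)] .
    have eq: "T c = T c'" using c(3) unfolding F(2) G(2) by (rule expansion_chain_inj[OF n F(1) G(1)])
    have "E c (T c)" "E c' (T c)" using T c(1,2) eq by auto
    then show "c = c'" by (rule E_chain)
  qed
  have sim: "same_up_to_sign K c (?\<phi> c)" if "c \<in> normal_chains" for c
  proof -
    have "E c (T c)" using T that by blast
    then obtain F where F: "expansion n (T c) F" "c = expansion_chain n F" unfolding E_def by (elim exE conjE)
    show ?thesis using expansion_same_up_to_sign[OF F(1), of K] unfolding F(2)[symmetric] .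
  qed
  have "\<forall>c\<in>normal_chains. \<exists>\<epsilon>. \<epsilon> \<in> {1, - 1} \<and> exact_on (max_chains n)
    (\<lambda>d. (if d = ?\<phi> c then 1 else 0) - \<epsilon> * (if d = c then 1 else 0 :: 'k))"
    using sim unfolding same_up_to_sign_def Bex_def by (rule ballI)
  from bchoice[OF this] obtain \<epsilon> where eps: "\<forall>c\<in>normal_chains. \<epsilon> c \<in> {1, - 1} \<and> exact_on (max_chains n)
    (\<lambda>d. (if d = ?\<phi> c then 1 else 0) - \<epsilon> c * (if d = c then 1 else 0 :: 'k))" by (elim exE)
  have "coset_basis K (max_chains n) (?\<phi> ` normal_chains)"
  proof (rule coset_basis_transfer[OF _ coset_basis_normal_chains inj])
    show "finite normal_chains" using finX normal_sub by (rule finite_subset[rotated])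
    show "?\<phi> ` normal_chains \<subseteq> max_chains n"
    proof (rule image_subsetI)
      fix c assume "c \<in> normal_chains"
      then have norm: "T c \<in> BT n" "normalized (T c)" using T by (auto simp: Lyn2_def bicolored_Lyndon_def)
      obtain F where F: "expansion n (T c) F" "reduced_tree_chain n (T c) = expansion_chain n F"
        using tree_expansion[OF n norm] .
      show "?\<phi> c \<in> max_chains n" unfolding F(2) by (rule expansion_chain_in[OF n F(1)])
    qed
    show "\<epsilon> c \<in> {1, - 1} \<and> exact_on (max_chains n)
      (\<lambda>d. (if d = ?\<phi> c then 1 else 0) - \<epsilon> c * (if d = c then 1 else 0 :: 'k))" if "c \<in> normal_chains" for c
      using eps that by (rule bspec)
  qed
  then show ?thesis unfolding image .
qed

text \<open>Both basis statements hold over every commutative ring with 1, so the integers and an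
  arbitrary field are instances.\<close>

theorem theorem5p15:
  fixes n :: nat
  assumes "n \<ge> 2"
  shows "\<forall>S \<in> {reduced_tree_chain n ` {t \<in> Comb2 n. root_color t = Some Blue},
                reduced_tree_chain n ` {t \<in> Lyn2 n. root_color t = Some Red}}.
           cohomology_basis TYPE(int)
             (weighted_partitions n - {wp_bot n}) (wp_le n) (int n - 2) S \<and>
           cohomology_basis TYPE('k::field)
             (weighted_partitions n - {wp_bot n}) (wp_le n) (int n - 2) S"
  by (simp add: cohomology_basis_of_coset_basis[OF assms] comb_basis[OF assms] lyndon_basis[OF assms])

end
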